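(* Let $k$ be an algebraically closed field of characteristic zero and let $G$ be a finite group. For every $G$-equivariant birational isomorphism $\phi\colon X\dashrightarrow Y$ between smooth projective $n$-dimensional varieties over $k$ with generically free $G$-action, define $$ C_G(\phi) := \sum_{\substack{E\in \mathrm{Ex}_G(\phi^{-1})\\ \text{generic stabilizer of } E \text{ trivial}}} [E\curvearrowleft G]\;-\sum_{\substack{D\in \mathrm{Ex}_G(\phi)\\ \text{generic stabilizer of } D \text{ trivial}}} [D\curvearrowleft G]\;\in\; \mathbb Z[\mathrm{Bir}_{G,n-1}], $$ where $\mathrm{Ex}_G(\phi)$, respectively $\mathrm{Ex}_G(\phi^{-1})$, is the set of $G$-orbits of divisorial components of the exceptional locus of $\phi$ (in $X$), respectively of $\phi^{-1}$ (in $Y$), and the sums run only over those orbits having trivial generic stabilizer. Then for all smooth projective $n$-dimensional varieties $X$, $Y$, $Z$ over $k$ with generically free $G$-action and all $G$-equivariant birational isomorphisms $\phi\colon X\dashrightarrow Y$ and $\psi\colon Y\dashrightarrow Z$, $$ C_G(\psi\circ\phi)=C_G(\phi)+C_G(\psi). $$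
   Context: Conventions. Varieties over $k$ are reduced. A "variety with an action of $G$" is allowed to have several irreducible components, but $G$ is required to permute the irreducible components transitively; its dimension is the common dimension of the components. The action is generically free if the locus of points with trivial stabilizer is nonempty (hence dense). A $G$-equivariant birational isomorphism is a $G$-equivariant birational map, i.e. it is represented by a $G$-equivariant isomorphism between $G$-stable dense open subsets. Exceptional locus. The exceptional locus of a birational map $\phi\colon X\dashrightarrow Y$ is the complement in $X$ of the largest open subset on which $\phi$ is defined and is an open immersion into $Y$; its divisorial components are its irreducible components of codimension one in $X$. Thus, for smooth projective $X,Y$, a prime divisor $D\subset X$ is a divisorial component of the exceptional locus of $\phi$ if and only if $\phi$ does not map $D$ birationally onto a prime divisor of $Y$. There are finitely many such $D$, and for equivariant $\phi$ the group $G$ permutes them. Orbits and classes. A $G$-orbit of divisorial components is regarded as the reduced, possibly singular, projective $G$-variety of dimension $n-1$ which is the union of the components in the orbit. Its generic stabilizer is the stabilizer in $G$ of a general point of it (well-defined up to conjugation); it is trivial exactly when $G$ acts generically freely on this union. $\mathbb Z[\mathrm{Bir}_{G,n-1}]$ is the free abelian group on the set of $G$-equivariant birational equivalence classes of $(n-1)$-dimensional varieties over $k$ with generically free $G$-action (possibly with several irreducible components, permuted transitively by $G$). For such a variety $E$, $[E\curvearrowleft G]$ denotes the basis element given by its $G$-equivariant birational equivalence class. *)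

theory Defs
  imports
    "HOL-Analysis.Abstract_Topology"
    "HOL-Library.Extended_Nat"
    "HOL-Library.Poly_Mapping"
    "HOL-Computational_Algebra.Polynomial"
    "HOL-Algebra.Group_Action"
    "HOL-Algebra.Free_Abelian_Groups"
begin

section \<open>Topological notions\<close>

definition irreducible_in :: "'a topology \<Rightarrow> 'a set \<Rightarrow> bool" where
  "irreducible_in T Z \<longleftrightarrow> Z \<subseteq> topspace T \<and> Z \<noteq> {} \<and>
     (\<forall>A B. closedin T A \<and> closedin T B \<and> Z \<subseteq> A \<union> B \<longrightarrow> Z \<subseteq> A \<or> Z \<subseteq> B)"

definition irreducible_components :: "'a topology \<Rightarrow> 'a set set" where
  "irreducible_components T =
     {Z. irreducible_in T Z \<and> (\<forall>W. irreducible_in T W \<and> Z \<subseteq> W \<longrightarrow> W = Z)}"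

definition krull_dim :: "'a topology \<Rightarrow> enat" where
  "krull_dim T = Sup {enat n | n. \<exists>Z :: nat \<Rightarrow> 'a set.
     (\<forall>i\<le>n. closedin T (Z i) \<and> irreducible_in T (Z i)) \<and> (\<forall>i<n. Z i \<subset> Z (Suc i))}"


section \<open>Multivariate polynomials\<close>

text \<open>Variables are indexed by \<open>nat\<close>. Points of affine \<open>n\<close>-space are extended by zero,
  so that variables with index at least \<open>n\<close> evaluate to \<open>0\<close> on it.\<close>

type_synonym 'k mpoly = "(nat \<Rightarrow>\<^sub>0 nat) \<Rightarrow>\<^sub>0 'k"

definition mono_eval :: "(nat \<Rightarrow>\<^sub>0 nat) \<Rightarrow> (nat \<Rightarrow> 'k::field) \<Rightarrow> 'k" where
  "mono_eval m x = (\<Prod>i\<in>Poly_Mapping.keys m. x i ^ Poly_Mapping.lookup m i)"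

definition peval :: "'k::field mpoly \<Rightarrow> (nat \<Rightarrow> 'k) \<Rightarrow> 'k" where
  "peval p x = (\<Sum>m\<in>Poly_Mapping.keys p. Poly_Mapping.lookup p m * mono_eval m x)"

definition homogeneous :: "nat \<Rightarrow> 'k::field mpoly \<Rightarrow> bool" where
  "homogeneous d p \<longleftrightarrow>
     (\<forall>m\<in>Poly_Mapping.keys p. (\<Sum>i\<in>Poly_Mapping.keys m. Poly_Mapping.lookup m i) = d)"

lemma mono_eval_superset:
  assumes "finite A" "Poly_Mapping.keys m \<subseteq> A"
  shows "mono_eval m x = (\<Prod>i\<in>A. x i ^ Poly_Mapping.lookup m i)"
  unfolding mono_eval_def using assms
  by (intro prod.mono_neutral_left) (auto simp: in_keys_iff)

lemma mono_eval_add: "mono_eval (m + m') x = mono_eval m x * mono_eval m' x"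
proof -
  let ?A = "Poly_Mapping.keys m \<union> Poly_Mapping.keys m'"
  have "Poly_Mapping.keys (m + m') \<subseteq> ?A"
    by (rule Poly_Mapping.keys_add)
  then show ?thesis
    by (simp add: mono_eval_superset [of ?A] lookup_add power_add prod.distrib)
qed

lemma peval_superset:
  assumes "finite A" "Poly_Mapping.keys p \<subseteq> A"
  shows "peval p x = (\<Sum>m\<in>A. Poly_Mapping.lookup p m * mono_eval m x)"
  unfolding peval_def using assms
  by (intro sum.mono_neutral_left) (auto simp: in_keys_iff)

lemma peval_add: "peval (p + q) x = peval p x + peval q x"
proof -
  let ?A = "Poly_Mapping.keys p \<union> Poly_Mapping.keys q"
  have "Poly_Mapping.keys (p + q) \<subseteq> ?A"
    by (rule Poly_Mapping.keys_add)
  then show ?thesis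
    by (simp add: peval_superset [of ?A] lookup_add distrib_right sum.distrib)
qed

lemma peval_zero [simp]: "peval 0 x = 0"
  by (simp add: peval_def)

lemma peval_single: "peval (Poly_Mapping.single m c) x = c * mono_eval m x"
  by (simp add: peval_superset [of "{m}"])

lemma peval_one [simp]: "peval 1 x = 1"
  using peval_single [of 0 1 x] by (simp add: mono_eval_def)

lemma mpoly_induct [case_names zero add]:
  assumes "P 0"
    and "\<And>p m c. P p \<Longrightarrow> P (p + Poly_Mapping.single m c)"
  shows "P (p :: 'k::field mpoly)"
proof (induction p rule: update_induct)
  case const
  show ?case by (rule assms(1))
next
  case (update p m c)
  have "Poly_Mapping.update m c p = p + Poly_Mapping.single m c"
    using update(1) by (intro poly_mapping_eqI)
      (auto simp: lookup_update lookup_add lookup_single when_def in_keys_iff)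
  then show ?case using assms(2) update(3) by simp
qed

lemma peval_mult: "peval (p * q) x = peval p x * peval q x"
proof (induction p rule: mpoly_induct)
  case zero
  then show ?case by simp
next
  case (add p m c)
  have "peval (Poly_Mapping.single m c * q) x = c * mono_eval m x * peval q x"
    by (induction q rule: mpoly_induct)
      (simp_all add: distrib_left peval_add mult_single peval_single mono_eval_add)
  then show ?case using add by (simp add: distrib_right peval_add peval_single)
qed

lemma homogeneous_mult:
  assumes "homogeneous d p" "homogeneous e q"
  shows "homogeneous (d + e) (p * q)"
  unfolding homogeneous_def
proof
  fix m assume "m \<in> Poly_Mapping.keys (p * q)"
  then obtain a b where ab: "a \<in> Poly_Mapping.keys p" "b \<in> Poly_Mapping.keys q" "m = a + b"
    using keys_mult by blast
  have *: "(\<Sum>i\<in>Poly_Mapping.keys r. Poly_Mapping.lookup r i) =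
      (\<Sum>i\<in>Poly_Mapping.keys a \<union> Poly_Mapping.keys b. Poly_Mapping.lookup r i)"
    if "Poly_Mapping.keys r \<subseteq> Poly_Mapping.keys a \<union> Poly_Mapping.keys b" for r :: "nat \<Rightarrow>\<^sub>0 nat"
    using that by (intro sum.mono_neutral_left) (auto simp: in_keys_iff)
  show "(\<Sum>i\<in>Poly_Mapping.keys m. Poly_Mapping.lookup m i) = d + e"
    using assms ab * [of m] * [of a] * [of b] Poly_Mapping.keys_add [of a b]
    by (simp add: homogeneous_def lookup_add sum.distrib)
qed

lemma peval_homogeneous_scale:
  assumes "homogeneous d p"
  shows "peval p (\<lambda>i. c * x i) = c ^ d * peval p x"
proof -
  have "mono_eval m (\<lambda>i. c * x i) = c ^ d * mono_eval m x" if "m \<in> Poly_Mapping.keys p" for m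
    using that assms
    by (simp add: mono_eval_def homogeneous_def power_mult_distrib prod.distrib flip: power_sum)
  then show ?thesis
    by (simp add: peval_def sum_distrib_left mult.left_commute cong: sum.cong)
qed


section \<open>Spaces with functions and varieties\<close>

text \<open>A reduced scheme of finite type over an algebraically closed field is encoded by its set of
  closed points, the Zariski topology, and the sheaf of regular functions, viewed as a sheaf of
  functions with values in the field. \<open>reg X U\<close> is meaningful only for open \<open>U\<close>, and membership of
  \<open>f\<close> in \<open>reg X U\<close> depends only on the values of \<open>f\<close> on \<open>U\<close>.\<close>

record ('a, 'k) fspace =
  zar :: "'a topology"
  reg :: "'a set \<Rightarrow> ('a \<Rightarrow> 'k) set"

abbreviation pts :: "('a, 'k) fspace \<Rightarrow> 'a set" where
  "pts X \<equiv> topspace (zar X)"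

text \<open>The equivalence below comprises restriction, gluing, and dependence on the values on \<open>U\<close>
  only.\<close>

definition function_sheaf :: "('a, 'k) fspace \<Rightarrow> bool" where
  "function_sheaf X \<longleftrightarrow> (\<forall>U f. openin (zar X) U \<longrightarrow>
     (f \<in> reg X U \<longleftrightarrow>
       (\<forall>x\<in>U. \<exists>V h. openin (zar X) V \<and> x \<in> V \<and> h \<in> reg X V \<and> (\<forall>y\<in>U \<inter> V. f y = h y))))"

text \<open>The reduced induced structure on a locally closed subset. On an open subset it is the
  restriction of the sheaf.\<close>

definition sub :: "('a, 'k) fspace \<Rightarrow> 'a set \<Rightarrow> ('a, 'k) fspace" where
  "sub X Z = \<lparr> zar = subtopology (zar X) Z,
     reg = (\<lambda>U. {f. \<forall>x\<in>U. \<exists>V h. openin (zar X) V \<and> x \<in> V \<and> h \<in> reg X V \<and>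
                        (\<forall>y\<in>U \<inter> V. f y = h y)}) \<rparr>"

definition morphism :: "('a, 'k) fspace \<Rightarrow> ('b, 'k) fspace \<Rightarrow> ('a \<Rightarrow> 'b) \<Rightarrow> bool" where
  "morphism X Y f \<longleftrightarrow> continuous_map (zar X) (zar Y) f \<and>
     (\<forall>V h. openin (zar Y) V \<and> h \<in> reg Y V \<longrightarrow> (\<lambda>x. h (f x)) \<in> reg X {x \<in> pts X. f x \<in> V})"

definition isomorphism :: "('a, 'k) fspace \<Rightarrow> ('b, 'k) fspace \<Rightarrow> ('a \<Rightarrow> 'b) \<Rightarrow> bool" where
  "isomorphism X Y f \<longleftrightarrow> bij_betw f (pts X) (pts Y) \<and>
     morphism X Y f \<and> morphism Y X (inv_into (pts X) f)"

definition open_immersion :: "('a, 'k) fspace \<Rightarrow> ('b, 'k) fspace \<Rightarrow> ('a \<Rightarrow> 'b) \<Rightarrow> bool" where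
  "open_immersion X Y f \<longleftrightarrow> openin (zar Y) (f ` pts X) \<and> isomorphism X (sub Y (f ` pts X)) f"


subsection \<open>Affine space\<close>

definition affine_points :: "nat \<Rightarrow> (nat \<Rightarrow> 'k::field) set" where
  "affine_points n = {x. \<forall>i\<ge>n. x i = 0}"

definition affine_zeros :: "nat \<Rightarrow> 'k::field mpoly set \<Rightarrow> (nat \<Rightarrow> 'k) set" where
  "affine_zeros n S = {x \<in> affine_points n. \<forall>p\<in>S. peval p x = 0}"

definition affine_space :: "nat \<Rightarrow> (nat \<Rightarrow> 'k::field, 'k) fspace" where
  "affine_space n = \<lparr> zar = topology (\<lambda>U. \<exists>S. U = affine_points n - affine_zeros n S),
     reg = (\<lambda>U. {f. \<forall>x\<in>U. \<exists>p q. peval q x \<noteq> 0 \<and>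
                        (\<forall>y\<in>U. peval q y \<noteq> 0 \<longrightarrow> f y = peval p y / peval q y)}) \<rparr>"

lemma affine_zeros_subset: "affine_zeros n S \<subseteq> affine_points n"
  by (auto simp: affine_zeros_def)

lemma istopology_affine:
  "istopology (\<lambda>U. \<exists>S :: 'k::field mpoly set. U = affine_points n - affine_zeros n S)"
  unfolding istopology_def
proof (intro conjI allI impI)
  fix U V :: "(nat \<Rightarrow> 'k) set"
  assume "\<exists>S. U = affine_points n - affine_zeros n S" "\<exists>S. V = affine_points n - affine_zeros n S"
  then obtain S T where "U = affine_points n - affine_zeros n S" "V = affine_points n - affine_zeros n T"
    by blast
  moreover have "affine_zeros n {p * q | p q. p \<in> S \<and> q \<in> T} = affine_zeros n S \<union> affine_zeros n T"
  proof (intro equalityI subsetI)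
    fix x assume x: "x \<in> affine_zeros n {p * q | p q. p \<in> S \<and> q \<in> T}"
    have "peval p x * peval q x = 0" if "p \<in> S" "q \<in> T" for p q
    proof -
      have "peval (p * q) x = 0" using x that unfolding affine_zeros_def by blast
      then show ?thesis by (simp add: peval_mult)
    qed
    then show "x \<in> affine_zeros n S \<union> affine_zeros n T"
      using x unfolding affine_zeros_def by fastforce
  qed (auto simp: affine_zeros_def peval_mult)
  ultimately have "U \<inter> V = affine_points n - affine_zeros n {p * q | p q. p \<in> S \<and> q \<in> T}"
    by blast
  then show "\<exists>S. U \<inter> V = affine_points n - affine_zeros n S" by blast
next
  fix \<K> :: "(nat \<Rightarrow> 'k) set set"
  assume "\<forall>K\<in>\<K>. \<exists>S. K = affine_points n - affine_zeros n S"
  then obtain S where S: "\<forall>K\<in>\<K>. K = affine_points n - affine_zeros n (S K)"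
    by metis
  have "\<Union>\<K> = (\<Union>K\<in>\<K>. K)" by simp
  also have "\<dots> = (\<Union>K\<in>\<K>. affine_points n - affine_zeros n (S K))"
    by (rule SUP_cong [OF refl]) (rule S [rule_format])
  also have "\<dots> = affine_points n - affine_zeros n (\<Union>K\<in>\<K>. S K)"
    unfolding affine_zeros_def by blast
  finally show "\<exists>S. \<Union>\<K> = affine_points n - affine_zeros n S" by blast
qed

lemma closedin_affine_space:
  "closedin (zar (affine_space n)) C \<longleftrightarrow> (\<exists>S. C = affine_zeros n (S :: 'k::field mpoly set))"
proof -
  have op: "openin (zar (affine_space n)) U \<longleftrightarrow>
      (\<exists>S :: 'k mpoly set. U = affine_points n - affine_zeros n S)" for U
    by (simp add: affine_space_def istopology_affine topology_inverse')
  have "openin (zar (affine_space n)) (affine_points n :: (nat \<Rightarrow> 'k) set)"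
    unfolding op by (rule exI [of _ "{1}"]) (simp add: affine_zeros_def)
  moreover have "U \<subseteq> affine_points n" if "openin (zar (affine_space n)) U" for U :: "(nat \<Rightarrow> 'k) set"
    using that unfolding op by auto
  ultimately have "pts (affine_space n) = (affine_points n :: (nat \<Rightarrow> 'k) set)"
    by (metis openin_subset openin_topspace subset_antisym)
  then have "closedin (zar (affine_space n)) C \<longleftrightarrow> C \<subseteq> affine_points n \<and>
      (\<exists>S :: 'k mpoly set. affine_points n - C = affine_points n - affine_zeros n S)"
    by (simp only: closedin_def op)
  moreover have "C \<subseteq> affine_points n \<and> affine_points n - C = affine_points n - affine_zeros n S \<longleftrightarrow>
      C = affine_zeros n S" for S :: "'k mpoly set"
    using affine_zeros_subset [of n S] by fast
  ultimately show ?thesis by metis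
qed


subsection \<open>Projective space\<close>

text \<open>A point is the set of all its homogeneous coordinate vectors.\<close>

definition proj_points :: "nat \<Rightarrow> (nat \<Rightarrow> 'k::field) set set" where
  "proj_points n = {{w. \<exists>c. c \<noteq> 0 \<and> w = (\<lambda>i. c * v i)} | v.
     v \<in> affine_points (Suc n) \<and> v \<noteq> (\<lambda>_. 0)}"

definition proj_zeros :: "nat \<Rightarrow> 'k::field mpoly set \<Rightarrow> (nat \<Rightarrow> 'k) set set" where
  "proj_zeros n S = {P \<in> proj_points n. \<forall>p\<in>S. \<forall>v\<in>P. peval p v = 0}"

definition proj_space :: "nat \<Rightarrow> ((nat \<Rightarrow> 'k::field) set, 'k) fspace" where
  "proj_space n = \<lparr> zar = topology (\<lambda>U. \<exists>S. (\<forall>p\<in>S. \<exists>d. homogeneous d p) \<and>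
                                U = proj_points n - proj_zeros n S),
     reg = (\<lambda>U. {f. \<forall>P\<in>U. \<exists>d p q. homogeneous d p \<and> homogeneous d q \<and>
                        (\<forall>v\<in>P. peval q v \<noteq> 0) \<and>
                        (\<forall>Q\<in>U. \<forall>w\<in>Q. peval q w \<noteq> 0 \<longrightarrow> f Q = peval p w / peval q w)}) \<rparr>"

lemma proj_points_vanish:
  assumes "P \<in> proj_points n" "homogeneous d p" "v \<in> P" "w \<in> P" "peval p v = 0"
  shows "peval p w = 0"
proof -
  obtain u where u: "P = {w. \<exists>c. c \<noteq> 0 \<and> w = (\<lambda>i. c * u i)}"
    using assms(1) by (auto simp: proj_points_def)
  obtain a b where "a \<noteq> 0" "v = (\<lambda>i. a * u i)" "w = (\<lambda>i. b * u i)"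
    using assms(3,4) u by auto
  then show ?thesis
    using assms(5) by (simp add: peval_homogeneous_scale [OF assms(2)])
qed

lemma proj_points_nonempty: "P \<in> proj_points n \<Longrightarrow> P \<noteq> {}"
  unfolding proj_points_def using zero_neq_one by blast

lemma proj_zeros_subset: "proj_zeros n S \<subseteq> proj_points n"
  by (auto simp: proj_zeros_def)

lemma istopology_proj:
  "istopology (\<lambda>U. \<exists>S :: 'k::field mpoly set. (\<forall>p\<in>S. \<exists>d. homogeneous d p) \<and>
     U = proj_points n - proj_zeros n S)"
  unfolding istopology_def
proof (intro conjI allI impI)
  fix U V :: "(nat \<Rightarrow> 'k) set set"
  assume "\<exists>S. (\<forall>p\<in>S. \<exists>d. homogeneous d p) \<and> U = proj_points n - proj_zeros n S"
    "\<exists>S. (\<forall>p\<in>S. \<exists>d. homogeneous d p) \<and> V = proj_points n - proj_zeros n S"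
  then obtain S T where ST: "\<forall>p\<in>S. \<exists>d. homogeneous d p" "\<forall>p\<in>T. \<exists>d. homogeneous d p"
    and UV: "U = proj_points n - proj_zeros n S" "V = proj_points n - proj_zeros n T"
    by blast
  let ?R = "{p * q | p q. p \<in> S \<and> q \<in> T}"
  have "proj_zeros n ?R = proj_zeros n S \<union> proj_zeros n T"
  proof (intro equalityI subsetI)
    fix P assume P: "P \<in> proj_zeros n ?R"
    then have Pn: "P \<in> proj_points n" by (simp add: proj_zeros_def)
    show "P \<in> proj_zeros n S \<union> proj_zeros n T"
    proof (rule ccontr)
      assume "P \<notin> proj_zeros n S \<union> proj_zeros n T"
      then obtain p q v w where pq: "p \<in> S" "v \<in> P" "peval p v \<noteq> 0" "q \<in> T" "w \<in> P" "peval q w \<noteq> 0"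
        using Pn by (auto simp: proj_zeros_def)
      then have "peval q v \<noteq> 0"
        using proj_points_vanish [OF Pn] ST(2) by blast
      then have "peval (p * q) v \<noteq> 0" using pq by (simp add: peval_mult)
      then show False using P pq by (auto simp: proj_zeros_def)
    qed
  qed (auto simp: proj_zeros_def peval_mult)
  moreover have "\<forall>r\<in>?R. \<exists>d. homogeneous d r"
    using ST homogeneous_mult by blast
  ultimately show "\<exists>S. (\<forall>p\<in>S. \<exists>d. homogeneous d p) \<and> U \<inter> V = proj_points n - proj_zeros n S"
    using UV by (intro exI [of _ ?R]) auto
next
  fix \<K> :: "(nat \<Rightarrow> 'k) set set set"
  assume "\<forall>K\<in>\<K>. \<exists>S. (\<forall>p\<in>S. \<exists>d. homogeneous d p) \<and> K = proj_points n - proj_zeros n S"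
  then obtain S where S: "\<forall>K\<in>\<K>. (\<forall>p\<in>S K. \<exists>d. homogeneous d p) \<and>
      K = proj_points n - proj_zeros n (S K)"
    by metis
  then have hom: "\<forall>p\<in>\<Union>K\<in>\<K>. S K. \<exists>d. homogeneous d p" by blast
  have "\<Union>\<K> = (\<Union>K\<in>\<K>. K)" by simp
  also have "\<dots> = (\<Union>K\<in>\<K>. proj_points n - proj_zeros n (S K))"
    by (rule SUP_cong [OF refl]) (rule S [rule_format, THEN conjunct2])
  also have "\<dots> = proj_points n - proj_zeros n (\<Union>K\<in>\<K>. S K)"
    unfolding proj_zeros_def by blast
  finally show "\<exists>S. (\<forall>p\<in>S. \<exists>d. homogeneous d p) \<and> \<Union>\<K> = proj_points n - proj_zeros n S"
    using hom by blast
qed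

lemma closedin_proj_space:
  "closedin (zar (proj_space n)) C \<longleftrightarrow>
     (\<exists>S :: 'k::field mpoly set. (\<forall>p\<in>S. \<exists>d. homogeneous d p) \<and> C = proj_zeros n S)"
proof -
  have op: "openin (zar (proj_space n)) U \<longleftrightarrow>
      (\<exists>S :: 'k mpoly set. (\<forall>p\<in>S. \<exists>d. homogeneous d p) \<and> U = proj_points n - proj_zeros n S)" for U
    by (simp add: proj_space_def istopology_proj topology_inverse')
  have "homogeneous 0 (1 :: 'k mpoly)"
    by (simp add: homogeneous_def)
  moreover have "proj_zeros n {1 :: 'k mpoly} = {}"
    using proj_points_nonempty by (auto simp: proj_zeros_def)
  ultimately have "openin (zar (proj_space n)) (proj_points n :: (nat \<Rightarrow> 'k) set set)"
    unfolding op by (intro exI [of _ "{1}"]) auto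
  moreover have "U \<subseteq> proj_points n" if "openin (zar (proj_space n)) U" for U :: "(nat \<Rightarrow> 'k) set set"
    using that unfolding op by auto
  ultimately have "pts (proj_space n) = (proj_points n :: (nat \<Rightarrow> 'k) set set)"
    by (metis openin_subset openin_topspace subset_antisym)
  then have "closedin (zar (proj_space n)) C \<longleftrightarrow> C \<subseteq> proj_points n \<and>
      (\<exists>S :: 'k mpoly set. (\<forall>p\<in>S. \<exists>d. homogeneous d p) \<and>
        proj_points n - C = proj_points n - proj_zeros n S)"
    by (simp only: closedin_def op)
  moreover have "C \<subseteq> proj_points n \<and> proj_points n - C = proj_points n - proj_zeros n S \<longleftrightarrow>
      C = proj_zeros n S" for S :: "'k mpoly set"
    using proj_zeros_subset [of n S] by fast
  ultimately show ?thesis by metis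
qed


subsection \<open>Varieties\<close>

definition affine_variety :: "('a, 'k::field) fspace \<Rightarrow> bool" where
  "affine_variety X \<longleftrightarrow> (\<exists>n Z h. closedin (zar (affine_space n :: (nat \<Rightarrow> 'k, 'k) fspace)) Z \<and>
     isomorphism X (sub (affine_space n) Z) h)"

definition prevariety :: "('a, 'k::field) fspace \<Rightarrow> bool" where
  "prevariety X \<longleftrightarrow> function_sheaf X \<and>
     (\<exists>\<U>. finite \<U> \<and> \<Union>\<U> = pts X \<and> (\<forall>U\<in>\<U>. openin (zar X) U \<and> affine_variety (sub X U)))"

text \<open>Testing on affine varieties suffices, since equalizers can be computed locally on the
  source. This avoids products of prevarieties.\<close>

definition separated :: "('a, 'k::field) fspace \<Rightarrow> bool" where
  "separated X \<longleftrightarrow> (\<forall>n Z f g. closedin (zar (affine_space n :: (nat \<Rightarrow> 'k, 'k) fspace)) Z \<and>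
     morphism (sub (affine_space n) Z) X f \<and> morphism (sub (affine_space n) Z) X g \<longrightarrow>
     closedin (zar (affine_space n)) {z \<in> Z. f z = g z})"

definition variety :: "('a, 'k::field) fspace \<Rightarrow> bool" where
  "variety X \<longleftrightarrow> prevariety X \<and> separated X"

definition projective :: "('a, 'k::field) fspace \<Rightarrow> bool" where
  "projective X \<longleftrightarrow> (\<exists>n Z h. closedin (zar (proj_space n :: ((nat \<Rightarrow> 'k) set, 'k) fspace)) Z \<and>
     isomorphism X (sub (proj_space n) Z) h)"


subsection \<open>Smoothness\<close>

text \<open>Functions representing germs in the maximal ideal \<open>\<mm>\<close> of the local ring at \<open>x\<close>, and
  germs in \<open>\<mm>\<^sup>2\<close>.\<close>

definition max_ideal :: "('a, 'k::field) fspace \<Rightarrow> 'a \<Rightarrow> ('a \<Rightarrow> 'k) set" where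
  "max_ideal X x = {f. f x = 0 \<and> (\<exists>U. openin (zar X) U \<and> x \<in> U \<and> f \<in> reg X U)}"

definition max_ideal_sq :: "('a, 'k::field) fspace \<Rightarrow> 'a \<Rightarrow> ('a \<Rightarrow> 'k) set" where
  "max_ideal_sq X x = {f. \<exists>U (r::nat) a b. openin (zar X) U \<and> x \<in> U \<and>
     (\<forall>j<r. a j \<in> max_ideal X x \<and> b j \<in> max_ideal X x) \<and>
     (\<forall>y\<in>U. f y = (\<Sum>j<r. a j y * b j y))}"

text \<open>The cotangent space \<open>\<mm>/\<mm>\<^sup>2\<close> has a basis with \<open>n\<close> elements \<open>t 0, \<dots>, t (n - 1)\<close>. For \<open>X\<close> of
  pure dimension \<open>n\<close> over an algebraically closed field this is smoothness at \<open>x\<close>.\<close>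

definition smooth_at :: "nat \<Rightarrow> ('a, 'k::field) fspace \<Rightarrow> 'a \<Rightarrow> bool" where
  "smooth_at n X x \<longleftrightarrow> (\<exists>t. (\<forall>i<n. t i \<in> max_ideal X x) \<and>
     (\<forall>f\<in>max_ideal X x. \<exists>!c. (\<forall>i\<ge>n. c i = 0) \<and>
        (\<lambda>y. f y - (\<Sum>i<n. c i * t i y)) \<in> max_ideal_sq X x))"


section \<open>Varieties with an action of a finite group\<close>

definition locus_trivial_stabilizer ::
    "('g, 'm) monoid_scheme \<Rightarrow> ('a, 'k) fspace \<Rightarrow> ('g \<Rightarrow> 'a \<Rightarrow> 'a) \<Rightarrow> 'a set" where
  "locus_trivial_stabilizer G X \<alpha> = {x \<in> pts X. stabilizer G \<alpha> x = {\<one>\<^bsub>G\<^esub>}}"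

definition generically_free ::
    "('g, 'm) monoid_scheme \<Rightarrow> ('a, 'k) fspace \<Rightarrow> ('g \<Rightarrow> 'a \<Rightarrow> 'a) \<Rightarrow> bool" where
  "generically_free G X \<alpha> \<longleftrightarrow> locus_trivial_stabilizer G X \<alpha> \<noteq> {}"

definition generic_stabilizer_trivial ::
    "('g, 'm) monoid_scheme \<Rightarrow> ('a, 'k) fspace \<Rightarrow> ('g \<Rightarrow> 'a \<Rightarrow> 'a) \<Rightarrow> bool" where
  "generic_stabilizer_trivial G X \<alpha> \<longleftrightarrow>
     (\<exists>U. openin (zar X) U \<and> zar X closure_of U = pts X \<and> U \<subseteq> locus_trivial_stabilizer G X \<alpha>)"

definition G_variety ::
    "('g, 'm) monoid_scheme \<Rightarrow> nat \<Rightarrow> ('a, 'k::field) fspace \<Rightarrow> ('g \<Rightarrow> 'a \<Rightarrow> 'a) \<Rightarrow> bool" where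
  "G_variety G n X \<alpha> \<longleftrightarrow> variety X \<and> krull_dim (zar X) = enat n \<and>
     group_action G (pts X) \<alpha> \<and> (\<forall>g\<in>carrier G. morphism X X (\<alpha> g)) \<and>
     (\<forall>Z\<in>irreducible_components (zar X). \<forall>W\<in>irreducible_components (zar X).
        \<exists>g\<in>carrier G. \<alpha> g ` Z = W)"

definition smooth_projective_G_variety ::
    "('g, 'm) monoid_scheme \<Rightarrow> nat \<Rightarrow> ('a, 'k::field) fspace \<Rightarrow> ('g \<Rightarrow> 'a \<Rightarrow> 'a) \<Rightarrow> bool" where
  "smooth_projective_G_variety G n X \<alpha> \<longleftrightarrow> G_variety G n X \<alpha> \<and> generically_free G X \<alpha> \<and>
     projective X \<and> (\<forall>x\<in>pts X. smooth_at n X x)"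


section \<open>Birational maps\<close>

text \<open>A rational map is given by a representative \<open>(U, f)\<close>: a morphism \<open>f\<close> on a dense open
  subset \<open>U\<close>. All notions below depend only on its equivalence class.\<close>

type_synonym ('a, 'b) rational_map = "'a set \<times> ('a \<Rightarrow> 'b)"

definition equivariant_birational ::
    "('g, 'm) monoid_scheme \<Rightarrow> ('a, 'k::field) fspace \<Rightarrow> ('g \<Rightarrow> 'a \<Rightarrow> 'a) \<Rightarrow>
      ('b, 'k) fspace \<Rightarrow> ('g \<Rightarrow> 'b \<Rightarrow> 'b) \<Rightarrow> ('a, 'b) rational_map \<Rightarrow> bool" where
  "equivariant_birational G X \<alpha> Y \<beta> \<phi> \<longleftrightarrow> (case \<phi> of (U, f) \<Rightarrow>
     openin (zar X) U \<and> zar X closure_of U = pts X \<and>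
     openin (zar Y) (f ` U) \<and> zar Y closure_of (f ` U) = pts Y \<and>
     isomorphism (sub X U) (sub Y (f ` U)) f \<and>
     (\<forall>g\<in>carrier G. \<alpha> g ` U = U \<and> \<beta> g ` f ` U = f ` U \<and> (\<forall>x\<in>U. f (\<alpha> g x) = \<beta> g (f x))))"

definition rational_inv :: "('a, 'b) rational_map \<Rightarrow> ('b, 'a) rational_map" where
  "rational_inv \<phi> = (snd \<phi> ` fst \<phi>, inv_into (fst \<phi>) (snd \<phi>))"

definition rational_comp ::
    "('b, 'c) rational_map \<Rightarrow> ('a, 'b) rational_map \<Rightarrow> ('a, 'c) rational_map" where
  "rational_comp \<psi> \<phi> = ({x \<in> fst \<phi>. snd \<phi> x \<in> fst \<psi>}, snd \<psi> \<circ> snd \<phi>)"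

text \<open>A local extension of \<open>f\<close> to \<open>W\<close> is unique, as \<open>U\<close> is dense and the target is separated.\<close>

definition exceptional_locus ::
    "('a, 'k) fspace \<Rightarrow> ('b, 'k) fspace \<Rightarrow> ('a, 'b) rational_map \<Rightarrow> 'a set" where
  "exceptional_locus X Y \<phi> = pts X -
     \<Union>{W. openin (zar X) W \<and>
          (\<exists>h. open_immersion (sub X W) Y h \<and> (\<forall>x\<in>fst \<phi> \<inter> W. h x = snd \<phi> x))}"

definition divisorial_components ::
    "('a, 'k) fspace \<Rightarrow> ('b, 'k) fspace \<Rightarrow> ('a, 'b) rational_map \<Rightarrow> 'a set set" where
  "divisorial_components X Y \<phi> =
     {D \<in> irreducible_components (subtopology (zar X) (exceptional_locus X Y \<phi>)).
        krull_dim (subtopology (zar X) D) + 1 = krull_dim (zar X)}"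

definition Ex_orbits ::
    "('g, 'm) monoid_scheme \<Rightarrow> ('a, 'k) fspace \<Rightarrow> ('g \<Rightarrow> 'a \<Rightarrow> 'a) \<Rightarrow>
      ('b, 'k) fspace \<Rightarrow> ('a, 'b) rational_map \<Rightarrow> 'a set set set" where
  "Ex_orbits G X \<alpha> Y \<phi> = orbits G (divisorial_components X Y \<phi>) (\<lambda>g. image (\<alpha> g))"


section \<open>The group of birational classes and the invariant\<close>

type_synonym ('g, 'a, 'k) G_space = "('a, 'k) fspace \<times> ('g \<Rightarrow> 'a \<Rightarrow> 'a)"

definition free_G_varieties ::
    "('g, 'm) monoid_scheme \<Rightarrow> nat \<Rightarrow> ('g, 'a, 'k::field) G_space set" where
  "free_G_varieties G m = {(X, \<alpha>). G_variety G m X \<alpha> \<and> generically_free G X \<alpha>}"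

definition birational_rel ::
    "('g, 'm) monoid_scheme \<Rightarrow> nat \<Rightarrow> (('g, 'a, 'k::field) G_space \<times> ('g, 'a, 'k) G_space) set" where
  "birational_rel G m = {(A, B). A \<in> free_G_varieties G m \<and> B \<in> free_G_varieties G m \<and>
     (\<exists>\<phi>. equivariant_birational G (fst A) (snd A) (fst B) (snd B) \<phi>)}"

definition Bir ::
    "('g, 'm) monoid_scheme \<Rightarrow> nat \<Rightarrow> ('g, 'a, 'k::field) G_space set set" where
  "Bir G m = free_G_varieties G m // birational_rel G m"

abbreviation Z_Bir ::
    "('g, 'm) monoid_scheme \<Rightarrow> nat \<Rightarrow> (('g, 'a, 'k::field) G_space set \<Rightarrow>\<^sub>0 int) monoid" where
  "Z_Bir G m \<equiv> free_Abelian_group (Bir G m)"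

definition bir_class ::
    "('g, 'm) monoid_scheme \<Rightarrow> nat \<Rightarrow> ('g, 'a, 'k::field) G_space \<Rightarrow>
      ('g, 'a, 'k) G_space set \<Rightarrow>\<^sub>0 int" where
  "bir_class G m A = frag_of (birational_rel G m `` {A})"

definition orbit_space ::
    "('a, 'k) fspace \<Rightarrow> ('g \<Rightarrow> 'a \<Rightarrow> 'a) \<Rightarrow> 'a set set \<Rightarrow> ('g, 'a, 'k) G_space" where
  "orbit_space X \<alpha> \<D> = (sub X (\<Union>\<D>), \<lambda>g. restrict (\<alpha> g) (\<Union>\<D>))"

definition free_Ex_orbits ::
    "('g, 'm) monoid_scheme \<Rightarrow> ('a, 'k) fspace \<Rightarrow> ('g \<Rightarrow> 'a \<Rightarrow> 'a) \<Rightarrow>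
      ('b, 'k) fspace \<Rightarrow> ('a, 'b) rational_map \<Rightarrow> 'a set set set" where
  "free_Ex_orbits G X \<alpha> Y \<phi> = {\<D> \<in> Ex_orbits G X \<alpha> Y \<phi>.
     generic_stabilizer_trivial G (fst (orbit_space X \<alpha> \<D>)) (snd (orbit_space X \<alpha> \<D>))}"

text \<open>For \<open>n = 0\<close> both sums are empty, so the truncated subtraction \<open>n - 1\<close> is harmless.\<close>

definition C_inv ::
    "('g, 'm) monoid_scheme \<Rightarrow> nat \<Rightarrow> ('a, 'k::field) fspace \<Rightarrow> ('g \<Rightarrow> 'a \<Rightarrow> 'a) \<Rightarrow>
      ('a, 'k) fspace \<Rightarrow> ('g \<Rightarrow> 'a \<Rightarrow> 'a) \<Rightarrow> ('a, 'a) rational_map \<Rightarrow>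
      ('g, 'a, 'k) G_space set \<Rightarrow>\<^sub>0 int" where
  "C_inv G n X \<alpha> Y \<beta> \<phi> =
     (\<Sum>\<E>\<in>free_Ex_orbits G Y \<beta> X (rational_inv \<phi>). bir_class G (n - 1) (orbit_space Y \<beta> \<E>)) -
     (\<Sum>\<D>\<in>free_Ex_orbits G X \<alpha> Y \<phi>. bir_class G (n - 1) (orbit_space X \<alpha> \<D>))"

end

theory Submission
  imports Defs "HOL-Library.Function_Algebras"
begin

text \<open>
  A prime divisor of \<open>X\<close> which is not exceptional for \<open>\<phi>\<close> meets the largest open subset on which \<open>\<phi>\<close>
  extends to an open immersion, and therefore has a strict transform in \<open>Y\<close>, birational to it. So \<open>\<phi>\<close>
  induces a partial bijection, compatible with \<open>G\<close>, from the prime divisors of \<open>X\<close> to those of \<open>Y\<close>;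
  the divisors on which it and its inverse are undefined are the divisorial components of the
  exceptional loci of \<open>\<phi>\<close> and \<open>\<phi>\<^sup>-\<^sup>1\<close>. By maximality of the extensions, the partial bijections of \<open>\<phi>\<close>,
  \<open>\<psi>\<close> and \<open>\<psi> \<circ> \<phi>\<close> are compatible: whenever two of them are defined, so is the third. Hence
  \<open>C_G(\<phi>)\<close> is the formal difference of the divisors of \<open>Y\<close> and of \<open>X\<close>, after cancelling common ones,
  which is additive.

  Two facts from algebraic geometry enter. The local extensions of \<open>\<phi>\<close> glue because morphisms to a
  separated space that agree on a dense open subset agree. The strict transform of a divisor is
  a divisor because an irreducible variety and its nonempty open subsets have the same Krull
  dimension: a chain of \<open>d + 1\<close> irreducible closed subsets yields a dominant map to affine \<open>d\<close>-space;
  by the extension theorem for homomorphisms to an algebraically closed field, the image of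
  a nonempty open subset under such a map contains a nonempty open subset, and hyperplane sections
  then give a chain of length \<open>d\<close> all of whose members meet the given open subset.
\<close>


section \<open>Extension of homomorphisms and Hilbert's basis theorem\<close>

subsection \<open>Adjoining elements to a subring\<close>

text \<open>Dimension is here a supremum of lengths of chains of closed sets, so its invariance
  under passage to open subsets has to be obtained from chains; dominant maps take over the role of
  the transcendence degree. The coordinate ring of an irreducible set is represented by a subring of
  the ring of all functions together with an ideal \<open>P\<close> that is prime on that subring;
  instead of passing to a quotient domain, vanishing, degrees and algebraic dependence are read
  modulo \<open>P\<close>. On the geometric side, gluing local open immersions could destroy
  injectivity. The extensions of \<open>\<phi>\<close> and of its inverse are therefore built
  together: inverting the local extensions of one gives those of the other, so the glued maps are
  mutually inverse. The three compatibility statements are one statement, applied to a commuting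
  triangle and to its two rotations. The bijections are used on orbits instead of single divisors,
  since classes and generic stabilizers belong to orbits; and the sets of all free orbits are in
  general infinite, so additivity is formulated through complements that are finite.\<close>

definition subring_set :: "'r::comm_ring_1 set \<Rightarrow> bool" where
  "subring_set A \<longleftrightarrow> 1 \<in> A \<and> (\<forall>a\<in>A. \<forall>b\<in>A. a - b \<in> A \<and> a * b \<in> A)"

lemma subring_set_0: "subring_set A \<Longrightarrow> 0 \<in> A"
  unfolding subring_set_def by (metis diff_self)

lemma subring_set_1: "subring_set A \<Longrightarrow> 1 \<in> A"
  unfolding subring_set_def by blast

lemma subring_set_uminus: "subring_set A \<Longrightarrow> a \<in> A \<Longrightarrow> - a \<in> A"
  using subring_set_0 [of A] unfolding subring_set_def by (metis diff_0)

lemma subring_set_diff: "subring_set A \<Longrightarrow> a \<in> A \<Longrightarrow> b \<in> A \<Longrightarrow> a - b \<in> A"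
  unfolding subring_set_def by blast

lemma subring_set_add: "subring_set A \<Longrightarrow> a \<in> A \<Longrightarrow> b \<in> A \<Longrightarrow> a + b \<in> A"
  using subring_set_uminus [of A b] subring_set_diff [of A a "- b"] by simp

lemma subring_set_mult: "subring_set A \<Longrightarrow> a \<in> A \<Longrightarrow> b \<in> A \<Longrightarrow> a * b \<in> A"
  unfolding subring_set_def by blast

lemma subring_set_sum: "subring_set A \<Longrightarrow> (\<And>i. i \<in> I \<Longrightarrow> f i \<in> A) \<Longrightarrow> sum f I \<in> A"
  by (induction I rule: infinite_finite_induct) (auto simp: subring_set_0 subring_set_add)

lemma subring_set_power: "subring_set A \<Longrightarrow> a \<in> A \<Longrightarrow> a ^ n \<in> A"
  by (induction n) (auto simp: subring_set_1 subring_set_mult)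

lemmas subring_set_intros = subring_set_0 subring_set_1 subring_set_uminus subring_set_diff
  subring_set_add subring_set_mult subring_set_sum subring_set_power

definition polys :: "'r::comm_ring_1 set \<Rightarrow> 'r poly set" where
  "polys A = {p. \<forall>i. coeff p i \<in> A}"

definition adjoin :: "'r::comm_ring_1 set \<Rightarrow> 'r \<Rightarrow> 'r set" where
  "adjoin A t = (\<lambda>p. poly p t) ` polys A"

lemma coeff_polys: "p \<in> polys A \<Longrightarrow> coeff p i \<in> A"
  by (simp add: polys_def)

lemma subring_set_polys:
  assumes "subring_set A" shows "subring_set (polys A)"
  unfolding subring_set_def using assms
  by (auto simp: polys_def coeff_mult coeff_1 subring_set_intros)

lemma monom_polys: "subring_set A \<Longrightarrow> c \<in> A \<Longrightarrow> monom c n \<in> polys A"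
  by (simp add: polys_def subring_set_0)

lemma smult_polys: "subring_set A \<Longrightarrow> c \<in> A \<Longrightarrow> p \<in> polys A \<Longrightarrow> smult c p \<in> polys A"
  by (simp add: polys_def subring_set_mult)

lemma adjoinI: "p \<in> polys A \<Longrightarrow> poly p t \<in> adjoin A t"
  by (simp add: adjoin_def)

lemma subring_set_adjoin:
  assumes "subring_set A" shows "subring_set (adjoin A t)"
  unfolding subring_set_def
proof (intro conjI ballI)
  note S = subring_set_polys [OF assms]
  show "1 \<in> adjoin A t"
    using adjoinI [of 1 A t] subring_set_1 [OF S] by simp
  fix a b assume "a \<in> adjoin A t" "b \<in> adjoin A t"
  then obtain p q where pq: "p \<in> polys A" "q \<in> polys A" "a = poly p t" "b = poly q t"
    by (auto simp: adjoin_def)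
  show "a - b \<in> adjoin A t" "a * b \<in> adjoin A t"
    using adjoinI [of "p - q" A t] adjoinI [of "p * q" A t] pq
      subring_set_diff [OF S, of p q] subring_set_mult [OF S, of p q] by simp_all
qed

lemma adjoin_superset: "subring_set A \<Longrightarrow> A \<subseteq> adjoin A t"
  using adjoinI [OF monom_polys [of A _ 0]] by (force simp: poly_monom)

lemma adjoin_generator: "subring_set A \<Longrightarrow> t \<in> adjoin A t"
  using adjoinI [OF monom_polys [of A 1 1], of t] by (simp add: poly_monom subring_set_1)


subsection \<open>Hilbert's basis theorem\<close>

text \<open>The ascending chain condition in sequential form: a sequence in which no term is a
  combination of its predecessors generates a strictly increasing chain of ideals. Descending chains
  of closed sets in affine space produce just such a sequence.\<close>

definition noeth :: "'r::comm_ring_1 set \<Rightarrow> bool" where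
  "noeth A \<longleftrightarrow> (\<forall>f. (\<forall>i::nat. f i \<in> A) \<longrightarrow>
     (\<exists>m c. (\<forall>i<m. c i \<in> A) \<and> f m = (\<Sum>i<m. c i * f i)))"

lemma noethD:
  fixes f :: "nat \<Rightarrow> 'r::comm_ring_1"
  assumes "noeth A" "\<And>i. f i \<in> A"
  shows "\<exists>m c. (\<forall>i<m. c i \<in> A) \<and> f m = (\<Sum>i<m. c i * f i)"
  using assms unfolding noeth_def by blast

definition ideal_span :: "'r::comm_ring_1 set \<Rightarrow> (nat \<Rightarrow> 'r) \<Rightarrow> nat \<Rightarrow> 'r set" where
  "ideal_span A g m = {\<Sum>i<m. c i * g i | c. \<forall>i. c i \<in> A}"

lemma ideal_span_0: "subring_set A \<Longrightarrow> 0 \<in> ideal_span A g m"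
  unfolding ideal_span_def by (auto intro!: exI [of _ "\<lambda>_. 0"] simp: subring_set_0)

lemma ideal_span_diff:
  assumes "subring_set A" "x \<in> ideal_span A g m" "y \<in> ideal_span A g m"
  shows "x - y \<in> ideal_span A g m"
proof -
  obtain c d where "\<forall>i. c i \<in> A" "\<forall>i. d i \<in> A" "x = (\<Sum>i<m. c i * g i)" "y = (\<Sum>i<m. d i * g i)"
    using assms(2,3) by (auto simp: ideal_span_def)
  then have "x - y = (\<Sum>i<m. (c i - d i) * g i)" "\<forall>i. c i - d i \<in> A"
    using assms(1) by (auto simp: left_diff_distrib sum_subtractf subring_set_diff)
  then show ?thesis unfolding ideal_span_def by (auto intro!: exI [of _ "\<lambda>i. c i - d i"])
qed

lemma ideal_span_mult:
  assumes "subring_set A" "x \<in> ideal_span A g m" "a \<in> A"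
  shows "a * x \<in> ideal_span A g m"
proof -
  obtain c where "\<forall>i. c i \<in> A" "x = (\<Sum>i<m. c i * g i)"
    using assms(2) by (auto simp: ideal_span_def)
  then have "a * x = (\<Sum>i<m. (a * c i) * g i)" "\<forall>i. a * c i \<in> A"
    using assms(1,3) by (auto simp: sum_distrib_left mult.assoc subring_set_mult)
  then show ?thesis unfolding ideal_span_def by (auto intro!: exI [of _ "\<lambda>i. a * c i"])
qed

lemma ideal_span_add:
  assumes "subring_set A" "x \<in> ideal_span A g m" "y \<in> ideal_span A g m"
  shows "x + y \<in> ideal_span A g m"
  using ideal_span_diff [OF assms(1,2), of "- y"] ideal_span_mult [OF assms(1,3), of "- 1"] assms(1)
  by (simp add: subring_set_1 subring_set_uminus)

lemma ideal_span_sum: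
  "subring_set A \<Longrightarrow> (\<And>i. i \<in> I \<Longrightarrow> f i \<in> ideal_span A g m) \<Longrightarrow> sum f I \<in> ideal_span A g m"
  by (induction I rule: infinite_finite_induct) (auto simp: ideal_span_0 ideal_span_add)

lemma ideal_span_generator:
  assumes "subring_set A" "i < m"
  shows "g i \<in> ideal_span A g m"
proof -
  have "(\<Sum>j<m. (if j = i then 1 else 0) * g j) = (\<Sum>j<m. if j = i then g j else 0)"
    by (intro sum.cong) auto
  also have "\<dots> = g i"
    using assms(2) by simp
  finally show ?thesis
    unfolding ideal_span_def using assms(1)
    by (auto intro!: exI [of _ "\<lambda>j. if j = i then 1 else 0"] simp: subring_set_intros)
qed

lemma ideal_span_subset:
  assumes "subring_set A" "\<And>i. i < m \<Longrightarrow> g i \<in> ideal_span A h n"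
  shows "ideal_span A g m \<subseteq> ideal_span A h n"
  using assms(2) by (force simp: ideal_span_def [of A g] intro: ideal_span_sum ideal_span_mult assms(1))

lemma ideal_span_mono:
  assumes "subring_set A" "m \<le> n"
  shows "ideal_span A g m \<subseteq> ideal_span A g n"
  by (rule ideal_span_subset [OF assms(1)]) (use assms in \<open>auto intro: ideal_span_generator\<close>)

text \<open>Hilbert's argument. A sequence \<open>f\<close> violating the condition generates an
  ideal \<open>J\<close> that is not finitely generated. Choose \<open>g n\<close> in
  \<open>J\<close> of least degree outside the span of the earlier \<open>g i\<close>. A relation
  among the leading coefficients then yields an element of that span whose subtraction cancels the
  top term of some \<open>g m\<close>, against minimality.\<close>

theorem noeth_polys:
  assumes A: "subring_set A" and N: "noeth A"
  shows "noeth (polys A)"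
  unfolding noeth_def
proof (intro allI impI, rule ccontr)
  fix f :: "nat \<Rightarrow> 'a poly"
  assume f: "\<forall>i. f i \<in> polys A"
    and nex: "\<not> (\<exists>m c. (\<forall>i<m. c i \<in> polys A) \<and> f m = (\<Sum>i<m. c i * f i))"
  have nf: "f m \<notin> ideal_span (polys A) f m" for m
  proof
    assume "f m \<in> ideal_span (polys A) f m"
    then obtain c where "f m = (\<Sum>i<m. c i * f i)" "\<forall>i. c i \<in> polys A"
      unfolding ideal_span_def mem_Collect_eq by blast
    then show False using nex by blast
  qed
  note S = subring_set_polys [OF A]
  define J where "J = (\<Union>m. ideal_span (polys A) f m)"
  have J_bound: "\<exists>M. \<forall>i<n. g i \<in> ideal_span (polys A) f M" if "\<forall>i<n. g i \<in> J" for g and n :: nat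
  proof -
    obtain M where M: "\<forall>i<n. g i \<in> ideal_span (polys A) f (M i)"
      using \<open>\<forall>i<n. g i \<in> J\<close> by (auto simp: J_def) metis
    \<comment> \<open>The sum serves as a common upper bound.\<close>
    have "M i \<le> (\<Sum>i<n. M i)" if "i < n" for i
      using that by (intro member_le_sum) auto
    then show ?thesis
      using M ideal_span_mono [OF S] by blast
  qed
  have J_diff: "x - y \<in> J" if "x \<in> J" "y \<in> J" for x y
  proof -
    have "\<forall>i<2::nat. (if i = 0 then x else y) \<in> J"
      using that by simp
    then obtain M where M: "\<forall>i<2::nat. (if i = 0 then x else y) \<in> ideal_span (polys A) f M"
      using J_bound [of 2 "\<lambda>i. if i = 0 then x else y"] by blast
    have "x \<in> ideal_span (polys A) f M" "y \<in> ideal_span (polys A) f M"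
      using M [rule_format, of 0] M [rule_format, of 1] by simp_all
    then have "x - y \<in> ideal_span (polys A) f M" by (rule ideal_span_diff [OF S])
    then show ?thesis unfolding J_def by blast
  qed
  have J_sub: "ideal_span (polys A) g n \<subseteq> J" if gJ: "\<forall>i<n. g i \<in> J" for g n
  proof -
    obtain M where "\<forall>i<n. g i \<in> ideal_span (polys A) f M"
      using J_bound [OF gJ] by blast
    then have "ideal_span (polys A) g n \<subseteq> ideal_span (polys A) f M"
      by (intro ideal_span_subset [OF S]) simp
    then show ?thesis unfolding J_def by blast
  qed
  have J_not: "\<not> J \<subseteq> ideal_span (polys A) g n" if gJ: "\<forall>i<n. g i \<in> J" for g n
  proof
    assume "J \<subseteq> ideal_span (polys A) g n"
    moreover obtain M where "\<forall>i<n. g i \<in> ideal_span (polys A) f M"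
      using J_bound [OF gJ] by blast
    moreover have "f M \<in> J"
      unfolding J_def using ideal_span_generator [OF S, of M "Suc M"] by blast
    ultimately show False
      using nf [of M] ideal_span_subset [OF S, of n g f M] by blast
  qed
  \<comment> \<open>Every \<open>g n\<close> depends on all its predecessors through the span, so
    the sequence is obtained by course-of-values choice.\<close>
  have "\<exists>g. \<forall>n. g n \<in> J - ideal_span (polys A) g n \<and>
      (\<forall>h\<in>J - ideal_span (polys A) g n. degree (g n) \<le> degree h)"
  proof (rule dependent_wellorder_choice)
    fix r :: "'a poly" and f g :: "nat \<Rightarrow> 'a poly" and n :: nat
    assume "\<And>y. y < n \<Longrightarrow> f y = g y"
    then have "ideal_span (polys A) f n = ideal_span (polys A) g n"
      by (simp add: ideal_span_def)
    then show "(r \<in> J - ideal_span (polys A) f n \<and>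
        (\<forall>h\<in>J - ideal_span (polys A) f n. degree r \<le> degree h)) =
      (r \<in> J - ideal_span (polys A) g n \<and>
        (\<forall>h\<in>J - ideal_span (polys A) g n. degree r \<le> degree h))"
      by simp
  next
    fix n :: nat and g :: "nat \<Rightarrow> 'a poly"
    assume "\<And>y. y < n \<Longrightarrow> g y \<in> J - ideal_span (polys A) g y \<and>
      (\<forall>h\<in>J - ideal_span (polys A) g y. degree (g y) \<le> degree h)"
    then have "\<exists>h. h \<in> J - ideal_span (polys A) g n"
      using J_not [of n g] by blast
    then show "\<exists>r. r \<in> J - ideal_span (polys A) g n \<and>
        (\<forall>h\<in>J - ideal_span (polys A) g n. degree r \<le> degree h)"
      using ex_has_least_nat [of "\<lambda>h. h \<in> J - ideal_span (polys A) g n" _ degree] by blast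
  qed
  then obtain g where g: "\<And>n. g n \<in> J - ideal_span (polys A) g n"
    and g_min: "\<And>n h. h \<in> J - ideal_span (polys A) g n \<Longrightarrow> degree (g n) \<le> degree h"
    by blast
  have JA: "J \<subseteq> polys A"
    unfolding J_def ideal_span_def using f S by (force intro!: subring_set_sum subring_set_mult)
  then have "lead_coeff (g i) \<in> A" for i
    using g coeff_polys by blast
  then obtain m c where c: "\<forall>i<m. c i \<in> A" and
    eq: "lead_coeff (g m) = (\<Sum>i<m. c i * lead_coeff (g i))"
    using noethD [OF N, of "\<lambda>i. lead_coeff (g i)"] by blast
  have deg: "degree (g i) \<le> degree (g m)" if "i < m" for i
    using g_min [of "g m" i] g [of m] ideal_span_mono [OF S, of i m g] \<open>i < m\<close> by force
  \<comment> \<open>The monomial factors lift every \<open>g i\<close> to the degree of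
    \<open>g m\<close>. This is possible because \<open>g m\<close> was also a candidate at the
    earlier stage \<open>i\<close>, so \<open>g i\<close> has at most its degree.\<close>
  define s where "s = (\<Sum>i<m. monom (c i) (degree (g m) - degree (g i)) * g i)"
  have s_span: "s \<in> ideal_span (polys A) g m"
    unfolding s_def using c
    by (intro ideal_span_sum ideal_span_mult S ideal_span_generator monom_polys A) auto
  have gJ: "\<forall>i<m. g i \<in> J" using g by blast
  have "g m - s \<in> J"
    using J_diff J_sub [OF gJ] s_span g by blast
  moreover have notin: "g m - s \<notin> ideal_span (polys A) g m"
  proof
    assume "g m - s \<in> ideal_span (polys A) g m"
    then have "g m - s + s \<in> ideal_span (polys A) g m"
      by (rule ideal_span_add [OF S _ s_span])
    then show False using g [of m] by simp
  qed
  ultimately have le: "degree (g m) \<le> degree (g m - s)"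
    using g_min by blast
  have "degree (monom (c i) (degree (g m) - degree (g i)) * g i) \<le> degree (g m)" if "i < m" for i
    using degree_mult_le [of "monom (c i) (degree (g m) - degree (g i))" "g i"]
      degree_monom_le [of "c i" "degree (g m) - degree (g i)"] deg [OF that] by linarith
  then have "degree s \<le> degree (g m)"
    unfolding s_def by (intro degree_sum_le) auto
  then have "degree (g m - s) \<le> degree (g m)"
    by (intro degree_diff_le) auto
  moreover have "coeff s (degree (g m)) = (\<Sum>i<m. c i * lead_coeff (g i))"
    unfolding s_def using deg by (auto simp: coeff_sum coeff_monom_mult intro!: sum.cong)
  then have "coeff (g m - s) (degree (g m)) = 0"
    using eq by simp
  \<comment> \<open>The difference has exactly the degree of \<open>g m\<close>, yet its coefficient
    there is zero; only the zero polynomial is like this, and it lies in every span.\<close>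
  ultimately have "g m - s = 0"
    using le by (metis le_antisym leading_coeff_0_iff)
  then show False
    using notin ideal_span_0 [OF S] by simp
qed

lemma noeth_adjoin:
  assumes "subring_set A" "noeth A"
  shows "noeth (adjoin A t)"
  unfolding noeth_def
proof (intro allI impI)
  fix f :: "nat \<Rightarrow> 'a" assume "\<forall>i. f i \<in> adjoin A t"
  then obtain p where p: "\<forall>i. p i \<in> polys A \<and> f i = poly (p i) t"
    unfolding adjoin_def image_iff by metis
  then obtain m c where c: "\<forall>i<m. c i \<in> polys A" "p m = (\<Sum>i<m. c i * p i)"
    using noethD [OF noeth_polys [OF assms], of p] by blast
  then have "f m = (\<Sum>i<m. poly (c i) t * f i)"
    using p by (simp add: poly_sum)
  then show "\<exists>m c. (\<forall>i<m. c i \<in> adjoin A t) \<and> f m = (\<Sum>i<m. c i * f i)"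
    using c by (intro exI [of _ m] exI [of _ "\<lambda>i. poly (c i) t"]) (auto intro: adjoinI)
qed


subsection \<open>Extension of homomorphisms\<close>

definition ring_hom_on :: "'r::comm_ring_1 set \<Rightarrow> ('r \<Rightarrow> 'k::field) \<Rightarrow> bool" where
  "ring_hom_on A \<phi> \<longleftrightarrow> \<phi> 1 = 1 \<and>
     (\<forall>a\<in>A. \<forall>b\<in>A. \<phi> (a + b) = \<phi> a + \<phi> b \<and> \<phi> (a * b) = \<phi> a * \<phi> b)"

lemma ring_hom_on_0: "subring_set A \<Longrightarrow> ring_hom_on A \<phi> \<Longrightarrow> \<phi> 0 = 0"
  unfolding ring_hom_on_def by (metis add_cancel_right_right subring_set_0)

lemma ring_hom_on_diff:
  assumes "subring_set A" "ring_hom_on A \<phi>" "a \<in> A" "b \<in> A"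
  shows "\<phi> (a - b) = \<phi> a - \<phi> b"
proof -
  have "\<phi> (a - b + b) = \<phi> (a - b) + \<phi> b"
    using assms subring_set_diff unfolding ring_hom_on_def by metis
  then show ?thesis by simp
qed

lemma ring_hom_on_sum:
  "subring_set A \<Longrightarrow> ring_hom_on A \<phi> \<Longrightarrow> (\<And>i. i \<in> I \<Longrightarrow> f i \<in> A) \<Longrightarrow>
    \<phi> (sum f I) = (\<Sum>i\<in>I. \<phi> (f i))"
proof (induction I rule: infinite_finite_induct)
  case (insert x F)
  then show ?case
    using subring_set_sum [of A F f] by (simp add: ring_hom_on_def)
qed (simp_all add: ring_hom_on_0)

lemma ring_hom_on_power:
  "subring_set A \<Longrightarrow> ring_hom_on A \<phi> \<Longrightarrow> a \<in> A \<Longrightarrow> \<phi> (a ^ n) = \<phi> a ^ n"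
proof (induction n)
  case (Suc n)
  then show ?case using subring_set_power [of A a n] by (simp add: ring_hom_on_def)
qed (simp add: ring_hom_on_def)

context
  fixes A :: "'r::comm_ring_1 set" and \<phi> :: "'r \<Rightarrow> 'k::field"
  assumes A: "subring_set A" and hom: "ring_hom_on A \<phi>"
begin

lemma coeff_map_hom: "coeff (map_poly \<phi> p) i = \<phi> (coeff p i)"
  by (simp add: coeff_map_poly ring_hom_on_0 [OF A hom])

lemma map_hom_1: "map_poly \<phi> 1 = 1"
  by (rule poly_eqI) (use hom ring_hom_on_0 [OF A hom] in \<open>auto simp: coeff_map_hom coeff_1 ring_hom_on_def\<close>)

lemma map_hom_add: "p \<in> polys A \<Longrightarrow> q \<in> polys A \<Longrightarrow> map_poly \<phi> (p + q) = map_poly \<phi> p + map_poly \<phi> q"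
  by (rule poly_eqI) (use hom in \<open>simp add: coeff_map_hom polys_def ring_hom_on_def\<close>)

lemma map_hom_diff: "p \<in> polys A \<Longrightarrow> q \<in> polys A \<Longrightarrow> map_poly \<phi> (p - q) = map_poly \<phi> p - map_poly \<phi> q"
  by (rule poly_eqI) (simp add: coeff_map_hom polys_def ring_hom_on_diff [OF A hom])

lemma map_hom_mult:
  assumes "p \<in> polys A" "q \<in> polys A"
  shows "map_poly \<phi> (p * q) = map_poly \<phi> p * map_poly \<phi> q"
proof (rule poly_eqI)
  fix n
  have "\<phi> (\<Sum>i\<le>n. coeff p i * coeff q (n - i)) = (\<Sum>i\<le>n. \<phi> (coeff p i * coeff q (n - i)))"
    using assms by (intro ring_hom_on_sum [OF A hom] subring_set_mult [OF A] coeff_polys)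
  then show "coeff (map_poly \<phi> (p * q)) n = coeff (map_poly \<phi> p * map_poly \<phi> q) n"
    using assms hom by (simp add: coeff_map_hom coeff_mult polys_def ring_hom_on_def)
qed

lemma map_hom_smult:
  "c \<in> A \<Longrightarrow> p \<in> polys A \<Longrightarrow> map_poly \<phi> (smult c p) = smult (\<phi> c) (map_poly \<phi> p)"
  by (rule poly_eqI) (use hom in \<open>simp add: coeff_map_hom polys_def ring_hom_on_def\<close>)

lemma map_hom_const: "map_poly \<phi> [:c:] = [:\<phi> c:]"
  by (rule poly_eqI) (use ring_hom_on_0 [OF A hom] in \<open>auto simp: coeff_map_hom coeff_pCons split: nat.splits\<close>)

text \<open>The value at an element of \<open>A[t]\<close> is read off from an arbitrary
  representing polynomial. Two representatives differ by a relation of \<open>t\<close>, whose image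
  vanishes at \<open>\<xi>\<close> by hypothesis, so the choice does not matter.\<close>

lemma hom_extend_adjoin:
  assumes zero: "\<And>p. p \<in> polys A \<Longrightarrow> poly p t = 0 \<Longrightarrow> poly (map_poly \<phi> p) \<xi> = 0"
  shows "\<exists>\<psi>. ring_hom_on (adjoin A t) \<psi> \<and> (\<forall>a\<in>A. \<psi> a = \<phi> a) \<and>
    (\<forall>p\<in>polys A. \<psi> (poly p t) = poly (map_poly \<phi> p) \<xi>)"
proof -
  note S = subring_set_polys [OF A]
  define \<psi> where "\<psi> b = poly (map_poly \<phi> (SOME p. p \<in> polys A \<and> poly p t = b)) \<xi>" for b
  have *: "\<psi> (poly p t) = poly (map_poly \<phi> p) \<xi>" if "p \<in> polys A" for p
  proof -
    define q where "q = (SOME q. q \<in> polys A \<and> poly q t = poly p t)"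
    have "q \<in> polys A \<and> poly q t = poly p t"
      unfolding q_def by (rule someI [of _ p]) (simp add: that)
    then have "poly (map_poly \<phi> (q - p)) \<xi> = 0"
      using that by (intro zero) (auto intro: subring_set_diff [OF S])
    then have "poly (map_poly \<phi> q) \<xi> = poly (map_poly \<phi> p) \<xi>"
      using that \<open>q \<in> polys A \<and> _\<close> by (simp add: map_hom_diff)
    then show ?thesis by (simp add: \<psi>_def q_def)
  qed
  have "ring_hom_on (adjoin A t) \<psi>"
    unfolding ring_hom_on_def
  proof (intro conjI ballI)
    show "\<psi> 1 = 1"
      using * [of 1] by (simp add: map_hom_1 subring_set_1 [OF S])
    fix a b assume "a \<in> adjoin A t" "b \<in> adjoin A t"
    then obtain p q where pq: "p \<in> polys A" "q \<in> polys A" "a = poly p t" "b = poly q t"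
      by (auto simp: adjoin_def)
    show "\<psi> (a + b) = \<psi> a + \<psi> b"
      using * [of "p + q"] * [of p] * [of q] pq by (simp add: map_hom_add subring_set_add [OF S])
    show "\<psi> (a * b) = \<psi> a * \<psi> b"
      using * [of "p * q"] * [of p] * [of q] pq by (simp add: map_hom_mult subring_set_mult [OF S])
  qed
  moreover have "\<psi> a = \<phi> a" if "a \<in> A" for a
    using * [OF monom_polys [OF A that, of 0]] by (simp add: monom_0 map_hom_const)
  ultimately show ?thesis using * by blast
qed

end

text \<open>\<open>P\<close> absorbs products with the whole ambient ring but is prime only on
  \<open>B\<close>. This is the situation of the functions vanishing on an irreducible set: they
  form an ideal among all functions, while primality holds among polynomial functions.\<close>

definition prime_ideal_on :: "'r::comm_ring_1 set \<Rightarrow> 'r set \<Rightarrow> bool" where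
  "prime_ideal_on B P \<longleftrightarrow> 0 \<in> P \<and> 1 \<notin> P \<and> (\<forall>a\<in>P. \<forall>b\<in>P. a + b \<in> P) \<and> (\<forall>a\<in>P. \<forall>c. c * a \<in> P) \<and>
     (\<forall>a\<in>B. \<forall>b\<in>B. a * b \<in> P \<longrightarrow> a \<in> P \<or> b \<in> P)"

lemma prime_ideal_on_mono: "prime_ideal_on B P \<Longrightarrow> A \<subseteq> B \<Longrightarrow> prime_ideal_on A P"
  unfolding prime_ideal_on_def by blast

context
  fixes B P :: "'r::comm_ring_1 set"
  assumes P: "prime_ideal_on B P"
begin

lemma pideal_0: "0 \<in> P" and pideal_1: "1 \<notin> P"
  and pideal_add: "a \<in> P \<Longrightarrow> b \<in> P \<Longrightarrow> a + b \<in> P"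
  and pideal_mult: "a \<in> P \<Longrightarrow> c * a \<in> P"
  and pideal_prime: "a \<in> B \<Longrightarrow> b \<in> B \<Longrightarrow> a * b \<in> P \<Longrightarrow> a \<in> P \<or> b \<in> P"
  using P unfolding prime_ideal_on_def by blast+

lemma pideal_mult2: "a \<in> P \<Longrightarrow> a * c \<in> P"
  using pideal_mult [of a c] by (simp add: mult.commute)

lemma pideal_uminus: "a \<in> P \<Longrightarrow> - a \<in> P"
  using pideal_mult [of a "- 1"] by simp

lemma pideal_diff: "a \<in> P \<Longrightarrow> b \<in> P \<Longrightarrow> a - b \<in> P"
  using pideal_add [of a "- b"] pideal_uminus by simp

lemma pideal_add_iff: "b \<in> P \<Longrightarrow> a + b \<in> P \<longleftrightarrow> a \<in> P"
  using pideal_diff [of "a + b" b] pideal_add [of a b] by auto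

lemma pideal_power: "subring_set B \<Longrightarrow> a \<in> B \<Longrightarrow> a \<notin> P \<Longrightarrow> a ^ n \<notin> P"
proof (induction n)
  case 0
  then show ?case using pideal_1 by simp
next
  case (Suc n)
  then show ?case using pideal_prime [of a "a ^ n"] subring_set_power by auto
qed

lemma pideal_sum: "(\<And>i. i \<in> I \<Longrightarrow> f i \<in> P) \<Longrightarrow> sum f I \<in> P"
  by (induction I rule: infinite_finite_induct) (auto simp: pideal_0 pideal_add)

lemma pideal_poly: "(\<And>i. coeff p i \<in> P) \<Longrightarrow> poly p t \<in> P"
  unfolding poly_altdef by (intro pideal_sum pideal_mult2)

end

text \<open>Division is impossible over a ring, so each cancellation of a leading term costs a
  factor \<open>lead_coeff m\<close>. The bound on \<open>degree q\<close> is recorded for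
  \<open>algebraic_multiple\<close>, where the quotient of a minimal polynomial must have smaller
  degree than that polynomial.\<close>

lemma pseudo_division:
  fixes p m :: "'r::comm_ring_1 poly"
  assumes A: "subring_set A" and m: "m \<in> polys A" "degree m > 0" and p: "p \<in> polys A"
  shows "\<exists>e q r. q \<in> polys A \<and> r \<in> polys A \<and> smult (lead_coeff m ^ e) p = m * q + r \<and>
    degree r < degree m \<and> degree q \<le> degree p - degree m"
  using p
proof (induction "degree p" arbitrary: p rule: less_induct)
  case (less p)
  note S = subring_set_polys [OF A]
  define a where "a = lead_coeff m"
  have aA: "a \<in> A" using m by (simp add: a_def polys_def)
  show ?case
  proof (cases "degree p < degree m")
    case True
    then show ?thesis
      using less.prems S by (intro exI [of _ 0] exI [of _ p]) (auto simp: subring_set_0)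
  next
    case False
    define s where "s = monom (lead_coeff p) (degree p - degree m)"
    define p' where "p' = smult a p - m * s"
    have sA: "s \<in> polys A"
      unfolding s_def by (intro monom_polys A coeff_polys less.prems)
    have p'A: "p' \<in> polys A"
      unfolding p'_def
      by (intro subring_set_diff [OF S] subring_set_mult [OF S] smult_polys A aA less.prems m sA)
    have ds: "degree s \<le> degree p - degree m"
      unfolding s_def by (rule degree_monom_le)
    have "degree (m * s) \<le> degree p"
      using degree_mult_le [of m s] ds False by linarith
    then have "degree p' \<le> degree p"
      unfolding p'_def using degree_smult_le [of a p] by (intro degree_diff_le) auto
    moreover have "coeff (m * s) (degree p) = a * lead_coeff p"
      using False by (simp add: s_def a_def mult.commute [of m] coeff_monom_mult)
    then have "coeff p' (degree p) = 0"
      by (simp add: p'_def)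
    ultimately have lt: "degree p' < degree p"
      using False m(2)
      by (metis degree_0 le_neq_implies_less leading_coeff_0_iff not_gr_zero order_le_less_trans not_less)
    then obtain e q r where IH: "q \<in> polys A" "r \<in> polys A" "smult (a ^ e) p' = m * q + r"
      "degree r < degree m" "degree q \<le> degree p' - degree m"
      using less.hyps [OF _ p'A] unfolding a_def by blast
    have "smult (a ^ Suc e) p = smult (a ^ e) (p' + m * s)"
      by (simp add: p'_def mult.commute)
    also have "\<dots> = m * (q + smult (a ^ e) s) + r"
      using IH(3) by (simp add: smult_add_right distrib_left)
    finally have "smult (lead_coeff m ^ Suc e) p = m * (q + smult (a ^ e) s) + r"
      by (simp only: a_def)
    moreover have "degree (q + smult (a ^ e) s) \<le> degree p - degree m"
      using IH(5) lt ds degree_smult_le [of "a ^ e" s] by (intro degree_add_le) linarith+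
    moreover have "q + smult (a ^ e) s \<in> polys A"
      by (intro subring_set_add [OF S] IH smult_polys A sA subring_set_power aA)
    ultimately show ?thesis using IH(2,4) by blast
  qed
qed

lemma exists_top_coeff:
  fixes p :: "'r::comm_ring_1 poly"
  assumes A: "subring_set A" and P: "prime_ideal_on B P" and p: "p \<in> polys A" "coeff p i \<notin> P"
  shows "\<exists>q\<in>polys A. lead_coeff q \<notin> P \<and> degree q \<le> degree p \<and> (\<forall>t. poly p t - poly q t \<in> P)"
  using p
proof (induction "degree p" arbitrary: p rule: less_induct)
  case (less p)
  note S = subring_set_polys [OF A]
  show ?case
  proof (cases "lead_coeff p \<in> P")
    case False
    then show ?thesis using less.prems pideal_0 [OF P] by (intro bexI [of _ p]) auto
  next
    case True
    define h where "h = monom (lead_coeff p) (degree p)"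
    have hA: "h \<in> polys A"
      unfolding h_def by (intro monom_polys A coeff_polys less.prems)
    have i: "i \<noteq> degree p" using True less.prems by auto
    then have c: "coeff (p - h) i \<notin> P" using less.prems by (simp add: h_def)
    have "i < degree p"
      using i less.prems(2) pideal_0 [OF P] by (metis le_degree le_neq_implies_less)
    moreover have "degree (p - h) \<le> degree p"
      unfolding h_def by (intro degree_diff_le degree_monom_le) simp
    moreover have "coeff (p - h) (degree p) = 0" by (simp add: h_def)
    ultimately have lt: "degree (p - h) < degree p"
      by (metis degree_0 le_neq_implies_less leading_coeff_0_iff not_gr_zero not_less_zero)
    then obtain q where q: "q \<in> polys A" "lead_coeff q \<notin> P" "degree q \<le> degree (p - h)"
      "\<forall>t. poly (p - h) t - poly q t \<in> P"
      using less.hyps [OF lt subring_set_diff [OF S less.prems(1) hA] c] by blast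
    have "poly p t - poly q t \<in> P" for t
    proof -
      have "poly h t \<in> P"
        using True by (simp add: h_def poly_monom pideal_mult2 [OF P])
      then have "poly (p - h) t - poly q t + poly h t \<in> P"
        using q(4) by (intro pideal_add [OF P]) auto
      then show ?thesis by (simp add: algebra_simps)
    qed
    then show ?thesis using q lt by (intro bexI [of _ q]) auto
  qed
qed

text \<open>A polynomial \<open>m\<close> of least degree that vanishes at \<open>t\<close> modulo \<open>P\<close> need not be monic, hence the
  pseudo-division; homomorphisms not killing its leading coefficient do not notice the difference.\<close>

lemma algebraic_multiple:
  fixes m :: "'r::comm_ring_1 poly"
  assumes A: "subring_set A" and P: "prime_ideal_on (adjoin A t) P"
    and m: "m \<in> polys A" "degree m > 0" "poly m t \<in> P" "lead_coeff m \<notin> P"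
    and min: "\<And>p i. p \<in> polys A \<Longrightarrow> poly p t \<in> P \<Longrightarrow> degree p < degree m \<Longrightarrow> coeff p i \<in> P"
    and g: "g \<in> polys A" "poly g t \<notin> P"
  shows "\<exists>w\<in>polys A. \<exists>c\<in>A - P. poly g t * poly w t - c \<in> P"
  using g
proof (induction "degree g" arbitrary: g rule: less_induct)
  case (less g)
  note S = subring_set_polys [OF A]
  note SB = subring_set_adjoin [OF A, of t]
  have AB: "a \<in> adjoin A t" if "a \<in> A" for a using adjoin_superset [OF A] that by blast
  note prime = pideal_prime [OF P]
  \<comment> \<open>It is enough to find a multiple of \<open>poly g t\<close> that is congruent
    modulo \<open>P\<close> to a value of a polynomial of smaller degree and not in
    \<open>P\<close>: multiplying by the witness of the latter gives one for
    \<open>g\<close>.\<close>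
  have step: ?case if r: "r \<in> polys A" "degree r < degree g" "poly r t \<notin> P"
    and q: "q \<in> polys A" "poly g t * poly q t - poly r t \<in> P" for q r
  proof -
    obtain w c where w: "w \<in> polys A" "c \<in> A - P" "poly r t * poly w t - c \<in> P"
      using less.hyps [OF r(2,1,3)] by blast
    have "(poly g t * poly q t - poly r t) * poly w t + (poly r t * poly w t - c) \<in> P"
      by (intro pideal_add [OF P] pideal_mult2 [OF P] q w)
    then have "poly g t * poly (q * w) t - c \<in> P"
      by (simp add: algebra_simps)
    then show ?thesis using w q subring_set_mult [OF S] by blast
  qed
  obtain i where "coeff g i \<notin> P"
    using less.prems pideal_poly [OF P] by blast
  then obtain h where h: "h \<in> polys A" "lead_coeff h \<notin> P" "degree h \<le> degree g"
    "poly g t - poly h t \<in> P"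
    using exists_top_coeff [OF A P less.prems(1)] by blast
  have ht: "poly h t \<notin> P"
    using pideal_add [OF P h(4), of "poly h t"] less.prems by auto
  \<comment> \<open>Euclid's algorithm for \<open>h\<close> and \<open>m\<close>: whichever has the
    larger degree is pseudo-divided by the other one, until a constant outside \<open>P\<close> is
    reached.\<close>
  consider "degree h < degree g" | "degree h = degree g" "degree h = 0"
    | "degree h = degree g" "degree h > 0" "degree h < degree m" | "degree h = degree g" "degree m \<le> degree h"
    using h(3) by linarith
  then show ?case
  proof cases
    case 1
    then show ?thesis
      using step [OF h(1) 1 ht, of 1] h(4) subring_set_1 [OF S] by simp
  next
    case 2
    then obtain c where c: "h = [:c:]" using degree_eq_zeroE by blast
    then have "c \<in> A - P" using h coeff_polys [OF h(1), of 0] by auto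
    then show ?thesis
      using h(4) c subring_set_1 [OF S] by (intro bexI [of _ 1] bexI [of _ c]) auto
  next
    case 3
    define b where "b = lead_coeff h"
    have b: "b \<in> A" "b \<notin> P" using h by (auto simp: b_def polys_def)
    obtain e q r where qr: "q \<in> polys A" "r \<in> polys A" "smult (b ^ e) m = h * q + r"
      "degree r < degree h" "degree q \<le> degree m - degree h"
      using pseudo_division [OF A h(1) 3(2) m(1)] unfolding b_def by blast
    have be: "b ^ e \<notin> P"
      by (rule pideal_power [OF P SB AB [OF b(1)] b(2)])
    \<comment> \<open>Otherwise minimality of \<open>m\<close> would put all coefficients of
      \<open>q\<close>, whose degree is smaller than that of \<open>m\<close>, into
      \<open>P\<close>, and comparing coefficients at \<open>degree m\<close> would give
      \<open>b ^ e * lead_coeff m \<in> P\<close>.\<close>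
    have "poly q t \<notin> P"
    proof
      assume "poly q t \<in> P"
      then have "coeff q i \<in> P" for i
        using qr 3 by (intro min) auto
      then have "coeff (h * q) (degree m) \<in> P"
        unfolding coeff_mult by (intro pideal_sum [OF P] pideal_mult [OF P])
      moreover have "coeff r (degree m) = 0"
        using qr(4) 3 by (intro coeff_eq_0) auto
      moreover have "b ^ e * lead_coeff m = coeff (h * q) (degree m) + coeff r (degree m)"
        using arg_cong [OF qr(3), of "\<lambda>p. coeff p (degree m)"] by simp
      ultimately have "b ^ e * lead_coeff m \<in> P" by simp
      then show False
        using prime [of "b ^ e" "lead_coeff m"] be m AB subring_set_power [OF A b(1)] coeff_polys by blast
    qed
    then have hq: "poly h t * poly q t \<notin> P"
      using ht prime [of "poly h t" "poly q t"] h(1) qr(1) adjoinI by blast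
    have "b ^ e * poly m t = poly h t * poly q t + poly r t"
      using arg_cong [OF qr(3), of "\<lambda>p. poly p t"] by simp
    then have sum: "poly h t * poly q t + poly r t \<in> P"
      using pideal_mult [OF P m(3), of "b ^ e"] by simp
    have "poly r t \<notin> P"
      using sum hq pideal_add_iff [OF P] by blast
    moreover have "poly g t * poly (- q) t - poly r t \<in> P"
    proof -
      have "- ((poly g t - poly h t) * poly q t + (poly h t * poly q t + poly r t)) \<in> P"
        by (intro pideal_uminus [OF P] pideal_add [OF P] pideal_mult2 [OF P] h sum)
      also have "- ((poly g t - poly h t) * poly q t + (poly h t * poly q t + poly r t)) =
          poly g t * poly (- q) t - poly r t"
        by (simp add: left_diff_distrib)
      finally show ?thesis .
    qed
    ultimately show ?thesis
      using step [of r "- q"] qr 3 subring_set_uminus [OF S] by auto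
  next
    case 4
    define a where "a = lead_coeff m"
    have a: "a \<in> A" "a \<notin> P" using m by (auto simp: a_def polys_def)
    obtain e q r where qr: "q \<in> polys A" "r \<in> polys A" "smult (a ^ e) h = m * q + r" "degree r < degree m"
      using pseudo_division [OF A m(1,2) h(1)] unfolding a_def by blast
    have ae: "a ^ e \<notin> P"
      by (rule pideal_power [OF P SB AB [OF a(1)] a(2)])
    have eq: "a ^ e * poly h t = poly m t * poly q t + poly r t"
      using arg_cong [OF qr(3), of "\<lambda>p. poly p t"] by simp
    have "a ^ e * poly h t \<notin> P"
      using ae ht prime AB subring_set_power [OF A a(1)] adjoinI [OF h(1)] by blast
    then have "poly r t \<notin> P"
      using eq pideal_add [OF P pideal_mult2 [OF P m(3)]] by auto
    moreover have "poly g t * poly [:a ^ e:] t - poly r t \<in> P"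
    proof -
      have "(poly g t - poly h t) * a ^ e + poly m t * poly q t \<in> P"
        by (intro pideal_add [OF P] pideal_mult2 [OF P] h m)
      then show ?thesis using eq by (simp add: algebra_simps)
    qed
    moreover have "[:a ^ e:] \<in> polys A"
      using monom_polys [OF A subring_set_power [OF A a(1)], of e 0] by (simp add: monom_0)
    ultimately show ?thesis
      using step [of r "[:a ^ e:]"] qr 4 by auto
  qed
qed

text \<open>If \<open>t\<close> is transcendental modulo \<open>P\<close>, its relations have all
  coefficients in \<open>P\<close>, so \<open>t\<close> may be sent to any \<open>\<xi>\<close>;
  here \<open>u\<close> is a coefficient outside \<open>P\<close> of a polynomial \<open>g\<close>
  representing \<open>v\<close>, and the infinite field contains a point where the image of
  \<open>g\<close> does not vanish. If \<open>t\<close> is algebraic, it has to go to a root of the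
  image of a minimal polynomial \<open>m\<close>, which exists over an algebraically closed
  field.\<close>

lemma hom_extension_step:
  fixes A P :: "'r::comm_ring_1 set"
  assumes A: "subring_set A" and P: "prime_ideal_on (adjoin A t) P"
    and v: "v \<in> adjoin A t" "v \<notin> P"
  shows "\<exists>u\<in>A - P. \<forall>\<phi> :: 'r \<Rightarrow> 'k::{alg_closed_field, field_char_0}.
    ring_hom_on A \<phi> \<and> (\<forall>a\<in>A \<inter> P. \<phi> a = 0) \<and> \<phi> u \<noteq> 0 \<longrightarrow>
    (\<exists>\<psi>. ring_hom_on (adjoin A t) \<psi> \<and> (\<forall>a\<in>A. \<psi> a = \<phi> a) \<and>
       (\<forall>b\<in>adjoin A t \<inter> P. \<psi> b = 0) \<and> \<psi> v \<noteq> 0)"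
proof -
  note S = subring_set_polys [OF A]
  note SB = subring_set_adjoin [OF A, of t]
  have AB: "a \<in> adjoin A t" if "a \<in> A" for a using adjoin_superset [OF A] that by blast
  obtain g where g: "g \<in> polys A" "v = poly g t"
    using v(1) by (auto simp: adjoin_def)
  show ?thesis
  proof (cases "\<forall>p\<in>polys A. poly p t \<in> P \<longrightarrow> (\<forall>i. coeff p i \<in> P)")
    case True
    obtain i where i: "coeff g i \<notin> P"
      using v g pideal_poly [OF P] by blast
    show ?thesis
    proof (intro bexI [of _ "coeff g i"] allI impI, elim conjE)
      show "coeff g i \<in> A - P" using i g by (simp add: polys_def)
      fix \<phi> :: "'r \<Rightarrow> 'k"
      assume \<phi>: "ring_hom_on A \<phi>" "\<forall>a\<in>A \<inter> P. \<phi> a = 0" "\<phi> (coeff g i) \<noteq> 0"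
      have "map_poly \<phi> g \<noteq> 0"
        using \<phi>(3) coeff_map_hom [OF A \<phi>(1), of g i] by auto
      then obtain \<xi> where \<xi>: "poly (map_poly \<phi> g) \<xi> \<noteq> 0"
        using poly_all_0_iff_0 by blast
      have zero: "poly (map_poly \<phi> p) \<xi> = 0" if "p \<in> polys A" "poly p t \<in> P" for p
      proof -
        have "map_poly \<phi> p = 0"
          using that True \<phi>(2) by (intro poly_eqI) (auto simp: coeff_map_hom [OF A \<phi>(1)] polys_def)
        then show ?thesis by simp
      qed
      obtain \<psi> where \<psi>: "ring_hom_on (adjoin A t) \<psi>" "\<forall>a\<in>A. \<psi> a = \<phi> a"
        "\<forall>p\<in>polys A. \<psi> (poly p t) = poly (map_poly \<phi> p) \<xi>"
        using hom_extend_adjoin [OF A \<phi>(1), of t \<xi>] zero pideal_0 [OF P] by metis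
      moreover have "\<psi> b = 0" if "b \<in> adjoin A t \<inter> P" for b
        using that \<psi>(3) zero by (auto simp: adjoin_def)
      ultimately show "\<exists>\<psi>. ring_hom_on (adjoin A t) \<psi> \<and> (\<forall>a\<in>A. \<psi> a = \<phi> a) \<and>
          (\<forall>b\<in>adjoin A t \<inter> P. \<psi> b = 0) \<and> \<psi> v \<noteq> 0"
        using g \<xi> by metis
    qed
  next
    case False
    define Q where "Q m \<longleftrightarrow> m \<in> polys A \<and> poly m t \<in> P \<and> lead_coeff m \<notin> P" for m
    have Q_ex: "\<exists>m. Q m \<and> degree m \<le> degree p" if p: "p \<in> polys A" "poly p t \<in> P" "coeff p i \<notin> P" for p i
    proof -
      obtain q where q: "q \<in> polys A" "lead_coeff q \<notin> P" "degree q \<le> degree p" "poly p t - poly q t \<in> P"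
        using exists_top_coeff [OF A P p(1,3)] by blast
      have "poly q t \<in> P" using pideal_diff [OF P p(2) q(4)] by simp
      then show ?thesis using q by (auto simp: Q_def)
    qed
    then have "\<exists>m. Q m" using False by blast
    then obtain m where m: "Q m" and m_min: "\<And>p. Q p \<Longrightarrow> degree m \<le> degree p"
      using ex_has_least_nat [of Q _ degree] by blast
    have min: "coeff p i \<in> P" if "p \<in> polys A" "poly p t \<in> P" "degree p < degree m" for p i
      using Q_ex [OF that(1,2), of i] m_min that(3) by force
    have deg: "degree m > 0"
    proof (rule ccontr)
      assume "\<not> degree m > 0"
      then obtain c where "m = [:c:]" using degree_eq_zeroE by blast
      then show False using m by (simp add: Q_def)
    qed
    define a where "a = lead_coeff m"
    have a: "a \<in> A" "a \<notin> P" using m by (auto simp: Q_def a_def polys_def)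
    obtain w c where w: "w \<in> polys A" "c \<in> A" "c \<notin> P" "poly g t * poly w t - c \<in> P"
      using algebraic_multiple [OF A P _ deg _ _ min g(1)] m v g unfolding Q_def by blast
    show ?thesis
    \<comment> \<open>The factor \<open>a\<close> keeps the degree of the image of \<open>m\<close>
      positive, so that a root exists, and makes pseudo-division by \<open>m\<close> harmless. The
      factor \<open>c\<close>, a multiple of \<open>v\<close> modulo \<open>P\<close>, forces
      \<open>\<psi> v \<noteq> 0\<close>.\<close>
    proof (intro bexI [of _ "a * c"] allI impI, elim conjE)
      show "a * c \<in> A - P"
        using a w AB pideal_prime [OF P, of a c] subring_set_mult [OF A] by blast
      fix \<phi> :: "'r \<Rightarrow> 'k"
      assume \<phi>: "ring_hom_on A \<phi>" "\<forall>a\<in>A \<inter> P. \<phi> a = 0" "\<phi> (a * c) \<noteq> 0"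
      then have nz: "\<phi> a \<noteq> 0" "\<phi> c \<noteq> 0"
        using a w by (auto simp: ring_hom_on_def)
      have "degree (map_poly \<phi> m) \<ge> degree m"
        using nz(1) by (intro le_degree) (simp add: coeff_map_hom [OF A \<phi>(1)] a_def)
      then obtain \<xi> where \<xi>: "poly (map_poly \<phi> m) \<xi> = 0"
        using alg_closed_imp_poly_has_root [of "map_poly \<phi> m"] deg by auto
      \<comment> \<open>After multiplication by a power of \<open>a\<close>, a relation
        \<open>p\<close> of \<open>t\<close> modulo \<open>P\<close> is a multiple of
        \<open>m\<close> up to a remainder whose coefficients lie in \<open>P\<close> by minimality,
        and \<open>\<phi>\<close> kills these coefficients.\<close>
      have zero: "poly (map_poly \<phi> p) \<xi> = 0" if p: "p \<in> polys A" "poly p t \<in> P" for p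
      proof -
        obtain e q r where qr: "q \<in> polys A" "r \<in> polys A" "smult (a ^ e) p = m * q + r" "degree r < degree m"
          using pseudo_division [OF A _ deg p(1)] m unfolding a_def Q_def by blast
        have "a ^ e * poly p t = poly m t * poly q t + poly r t"
          using arg_cong [OF qr(3), of "\<lambda>p. poly p t"] by simp
        then have "poly r t = a ^ e * poly p t - poly q t * poly m t"
          by (simp add: algebra_simps)
        also have "\<dots> \<in> P"
          using m unfolding Q_def by (intro pideal_diff [OF P] pideal_mult [OF P] p) auto
        finally have "coeff r i \<in> P" for i using min [OF qr(2) _ qr(4)] by blast
        then have "map_poly \<phi> r = 0"
          using qr(2) \<phi>(2) by (intro poly_eqI) (auto simp: coeff_map_hom [OF A \<phi>(1)] polys_def)
        moreover have "smult (\<phi> a ^ e) (map_poly \<phi> p) = map_poly \<phi> m * map_poly \<phi> q + map_poly \<phi> r"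
        proof -
          have mA: "m \<in> polys A" using m by (simp add: Q_def)
          have "smult (\<phi> a ^ e) (map_poly \<phi> p) = map_poly \<phi> (smult (a ^ e) p)"
            by (simp only: map_hom_smult [OF A \<phi>(1) subring_set_power [OF A a(1)] p(1)]
                ring_hom_on_power [OF A \<phi>(1) a(1)])
          also have "\<dots> = map_poly \<phi> (m * q) + map_poly \<phi> r"
            unfolding qr(3) by (rule map_hom_add [OF A \<phi>(1) subring_set_mult [OF S mA qr(1)] qr(2)])
          also have "map_poly \<phi> (m * q) = map_poly \<phi> m * map_poly \<phi> q"
            by (rule map_hom_mult [OF A \<phi>(1) mA qr(1)])
          finally show ?thesis .
        qed
        ultimately have "smult (\<phi> a ^ e) (map_poly \<phi> p) = map_poly \<phi> m * map_poly \<phi> q"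
          by simp
        then have "poly (smult (\<phi> a ^ e) (map_poly \<phi> p)) \<xi> = 0"
          using \<xi> by simp
        then show ?thesis using nz by simp
      qed
      obtain \<psi> where \<psi>: "ring_hom_on (adjoin A t) \<psi>" "\<forall>a\<in>A. \<psi> a = \<phi> a"
        "\<forall>p\<in>polys A. \<psi> (poly p t) = poly (map_poly \<phi> p) \<xi>"
        using hom_extend_adjoin [OF A \<phi>(1), of t \<xi>] zero pideal_0 [OF P] by metis
      have kill: "\<psi> b = 0" if "b \<in> adjoin A t" "b \<in> P" for b
        using that \<psi>(3) zero by (auto simp: adjoin_def)
      have in_B: "poly g t \<in> adjoin A t" "poly w t \<in> adjoin A t" "c \<in> adjoin A t"
        using g w AB adjoinI by blast+
      have "\<psi> (poly g t * poly w t - c) = \<psi> (poly g t) * \<psi> (poly w t) - \<psi> c"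
        using ring_hom_on_diff [OF SB \<psi>(1), of "poly g t * poly w t" c] in_B \<psi>(1) subring_set_mult [OF SB]
        by (simp add: ring_hom_on_def)
      moreover have "\<psi> (poly g t * poly w t - c) = 0"
        using w in_B by (intro kill subring_set_diff [OF SB] subring_set_mult [OF SB])
      ultimately have "\<psi> v \<noteq> 0"
        using \<psi>(2) w nz g by auto
      then show "\<exists>\<psi>. ring_hom_on (adjoin A t) \<psi> \<and> (\<forall>a\<in>A. \<psi> a = \<phi> a) \<and>
          (\<forall>b\<in>adjoin A t \<inter> P. \<psi> b = 0) \<and> \<psi> v \<noteq> 0"
        using \<psi> kill by blast
    qed
  qed
qed

section \<open>Finitely generated extensions of a subring\<close>

primrec adjoin_list :: "'r::comm_ring_1 set \<Rightarrow> (nat \<Rightarrow> 'r) \<Rightarrow> nat \<Rightarrow> 'r set" where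
  "adjoin_list A x 0 = A"
| "adjoin_list A x (Suc n) = adjoin (adjoin_list A x n) (x n)"

lemma subring_set_adjoin_list: "subring_set A \<Longrightarrow> subring_set (adjoin_list A x n)"
  by (induction n) (auto intro: subring_set_adjoin)

lemma adjoin_list_mono: "subring_set A \<Longrightarrow> m \<le> n \<Longrightarrow> adjoin_list A x m \<subseteq> adjoin_list A x n"
proof (induction n)
  case (Suc n)
  then show ?case
    using adjoin_superset [OF subring_set_adjoin_list, of A x n "x n"] by (cases "m = Suc n") auto
qed simp

lemma adjoin_list_superset: "subring_set A \<Longrightarrow> A \<subseteq> adjoin_list A x n"
  using adjoin_list_mono [of A 0 n x] by simp

lemma adjoin_list_generator: "subring_set A \<Longrightarrow> i < n \<Longrightarrow> x i \<in> adjoin_list A x n"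
  using adjoin_list_mono [of A "Suc i" n x] adjoin_generator [OF subring_set_adjoin_list, of A "x i" x i] by auto

lemma noeth_adjoin_list: "subring_set A \<Longrightarrow> noeth A \<Longrightarrow> noeth (adjoin_list A x n)"
  by (induction n) (auto intro: noeth_adjoin subring_set_adjoin_list)

lemma adjoin_list_least:
  assumes "subring_set C" "A \<subseteq> C" "\<And>i. i < n \<Longrightarrow> x i \<in> C"
  shows "adjoin_list A x n \<subseteq> C"
  using assms(3)
proof (induction n)
  case (Suc n)
  have "poly p (x n) \<in> C" if "p \<in> polys (adjoin_list A x n)" for p
    unfolding poly_altdef using that Suc
    by (intro subring_set_sum subring_set_mult subring_set_power assms(1)) (auto simp: polys_def)
  then show ?case by (auto simp: adjoin_def)
qed (use assms in auto)

text \<open>The algebraic form of Chevalley's theorem on images. The element \<open>u\<close>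
  obtained for the last generator takes the place of \<open>v\<close> for the remaining ones, so
  nonvanishing conditions are pushed down to \<open>A\<close> one generator at a time.\<close>

theorem hom_extension:
  fixes A P :: "'r::comm_ring_1 set"
  assumes A: "subring_set A" and P: "prime_ideal_on (adjoin_list A x n) P"
    and v: "v \<in> adjoin_list A x n" "v \<notin> P"
  shows "\<exists>u\<in>A - P. \<forall>\<phi> :: 'r \<Rightarrow> 'k::{alg_closed_field, field_char_0}.
    ring_hom_on A \<phi> \<and> (\<forall>a\<in>A \<inter> P. \<phi> a = 0) \<and> \<phi> u \<noteq> 0 \<longrightarrow>
    (\<exists>\<psi>. ring_hom_on (adjoin_list A x n) \<psi> \<and> (\<forall>a\<in>A. \<psi> a = \<phi> a) \<and>
       (\<forall>b\<in>adjoin_list A x n \<inter> P. \<psi> b = 0) \<and> \<psi> v \<noteq> 0)"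
  using P v
proof (induction n arbitrary: v)
  case 0
  then show ?case by auto
next
  case (Suc n)
  let ?B = "adjoin_list A x n"
  have B: "subring_set ?B" by (rule subring_set_adjoin_list [OF A])
  have P': "prime_ideal_on ?B P"
    using Suc.prems(1) adjoin_superset [OF B, of "x n"] by (auto intro: prime_ideal_on_mono)
  obtain u where u: "u \<in> ?B - P" "\<forall>\<phi> :: 'r \<Rightarrow> 'k.
    ring_hom_on ?B \<phi> \<and> (\<forall>a\<in>?B \<inter> P. \<phi> a = 0) \<and> \<phi> u \<noteq> 0 \<longrightarrow>
    (\<exists>\<psi>. ring_hom_on (adjoin ?B (x n)) \<psi> \<and> (\<forall>a\<in>?B. \<psi> a = \<phi> a) \<and>
       (\<forall>b\<in>adjoin ?B (x n) \<inter> P. \<psi> b = 0) \<and> \<psi> v \<noteq> 0)"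
    using hom_extension_step [OF B, of "x n" P v] Suc.prems by auto
  obtain u' where u': "u' \<in> A - P" "\<forall>\<phi> :: 'r \<Rightarrow> 'k.
    ring_hom_on A \<phi> \<and> (\<forall>a\<in>A \<inter> P. \<phi> a = 0) \<and> \<phi> u' \<noteq> 0 \<longrightarrow>
    (\<exists>\<psi>. ring_hom_on ?B \<psi> \<and> (\<forall>a\<in>A. \<psi> a = \<phi> a) \<and> (\<forall>b\<in>?B \<inter> P. \<psi> b = 0) \<and> \<psi> u \<noteq> 0)"
    using Suc.IH [OF P', of u] u(1) by auto
  show ?case
  proof (intro bexI [OF _ u'(1)] allI impI)
    fix \<phi> :: "'r \<Rightarrow> 'k"
    assume "ring_hom_on A \<phi> \<and> (\<forall>a\<in>A \<inter> P. \<phi> a = 0) \<and> \<phi> u' \<noteq> 0"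
    then obtain \<psi> where \<psi>: "ring_hom_on ?B \<psi>" "\<forall>a\<in>A. \<psi> a = \<phi> a" "\<forall>b\<in>?B \<inter> P. \<psi> b = 0" "\<psi> u \<noteq> 0"
      using u'(2) by blast
    then obtain \<chi> where "ring_hom_on (adjoin ?B (x n)) \<chi>" "\<forall>a\<in>?B. \<chi> a = \<psi> a"
       "\<forall>b\<in>adjoin ?B (x n) \<inter> P. \<chi> b = 0" "\<chi> v \<noteq> 0"
      using u(2) by blast
    then show "\<exists>\<psi>. ring_hom_on (adjoin_list A x (Suc n)) \<psi> \<and> (\<forall>a\<in>A. \<psi> a = \<phi> a) \<and>
       (\<forall>b\<in>adjoin_list A x (Suc n) \<inter> P. \<psi> b = 0) \<and> \<psi> v \<noteq> 0"
      using \<psi>(2) adjoin_list_superset [OF A, of x n] by (intro exI [of _ \<chi>]) auto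
  qed
qed


section \<open>Noetherian spaces and Krull dimension\<close>

subsection \<open>Irreducible sets\<close>

lemma irreducible_in_iff_open:
  "irreducible_in T Z \<longleftrightarrow> Z \<subseteq> topspace T \<and> Z \<noteq> {} \<and>
    (\<forall>U V. openin T U \<and> openin T V \<and> Z \<inter> U \<noteq> {} \<and> Z \<inter> V \<noteq> {} \<longrightarrow> Z \<inter> U \<inter> V \<noteq> {})"
proof -
  have "(\<forall>A B. closedin T A \<and> closedin T B \<and> Z \<subseteq> A \<union> B \<longrightarrow> Z \<subseteq> A \<or> Z \<subseteq> B) \<longleftrightarrow>
    (\<forall>U V. openin T U \<and> openin T V \<and> Z \<inter> U \<noteq> {} \<and> Z \<inter> V \<noteq> {} \<longrightarrow> Z \<inter> U \<inter> V \<noteq> {})"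
    if Z: "Z \<subseteq> topspace T"
  proof (intro iffI allI impI)
    fix U V
    assume "\<forall>A B. closedin T A \<and> closedin T B \<and> Z \<subseteq> A \<union> B \<longrightarrow> Z \<subseteq> A \<or> Z \<subseteq> B"
      and "openin T U \<and> openin T V \<and> Z \<inter> U \<noteq> {} \<and> Z \<inter> V \<noteq> {}"
    moreover from this have "closedin T (topspace T - U)" "closedin T (topspace T - V)" by auto
    ultimately have "\<not> Z \<subseteq> (topspace T - U) \<union> (topspace T - V)" by blast
    then show "Z \<inter> U \<inter> V \<noteq> {}" using Z by blast
  next
    fix A B
    assume *: "\<forall>U V. openin T U \<and> openin T V \<and> Z \<inter> U \<noteq> {} \<and> Z \<inter> V \<noteq> {} \<longrightarrow> Z \<inter> U \<inter> V \<noteq> {}"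
      and AB: "closedin T A \<and> closedin T B \<and> Z \<subseteq> A \<union> B"
    then have "openin T (topspace T - A)" "openin T (topspace T - B)" by auto
    then have "\<not> (Z \<inter> (topspace T - A) \<noteq> {} \<and> Z \<inter> (topspace T - B) \<noteq> {})"
      using * AB by blast
    then show "Z \<subseteq> A \<or> Z \<subseteq> B" using Z by blast
  qed
  then show ?thesis unfolding irreducible_in_def by (intro conj_cong refl)
qed

lemma irreducible_inD:
  assumes "irreducible_in T Z" "openin T U" "openin T V" "Z \<inter> U \<noteq> {}" "Z \<inter> V \<noteq> {}"
  shows "Z \<inter> U \<inter> V \<noteq> {}"
  using assms(1) [unfolded irreducible_in_iff_open] assms(2-) by simp

lemma irreducible_in_closedD:
  assumes "irreducible_in T Z" "closedin T A" "closedin T B" "Z \<subseteq> A \<union> B"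
  shows "Z \<subseteq> A \<or> Z \<subseteq> B"
  using assms(1) [unfolded irreducible_in_def] assms(2-) by simp

lemma irreducible_in_subtopology:
  "irreducible_in (subtopology T S) Z \<longleftrightarrow> Z \<subseteq> S \<and> irreducible_in T Z"
proof (cases "Z \<subseteq> S")
  case True
  have "(\<forall>A B. closedin (subtopology T S) A \<and> closedin (subtopology T S) B \<and> Z \<subseteq> A \<union> B \<longrightarrow>
      Z \<subseteq> A \<or> Z \<subseteq> B) \<longleftrightarrow> (\<forall>A B. closedin T A \<and> closedin T B \<and> Z \<subseteq> A \<union> B \<longrightarrow> Z \<subseteq> A \<or> Z \<subseteq> B)"
  proof (intro iffI allI impI)
    fix A B
    assume *: "\<forall>A B. closedin (subtopology T S) A \<and> closedin (subtopology T S) B \<and> Z \<subseteq> A \<union> B \<longrightarrow>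
        Z \<subseteq> A \<or> Z \<subseteq> B" and AB: "closedin T A \<and> closedin T B \<and> Z \<subseteq> A \<union> B"
    have "closedin (subtopology T S) (A \<inter> S)" "closedin (subtopology T S) (B \<inter> S)"
      using AB by (auto simp: closedin_subtopology)
    moreover have "Z \<subseteq> A \<inter> S \<union> B \<inter> S" using AB True by blast
    ultimately have "Z \<subseteq> A \<inter> S \<or> Z \<subseteq> B \<inter> S" using *[rule_format, of "A \<inter> S" "B \<inter> S"] by blast
    then show "Z \<subseteq> A \<or> Z \<subseteq> B" by blast
  next
    fix A B
    assume *: "\<forall>A B. closedin T A \<and> closedin T B \<and> Z \<subseteq> A \<union> B \<longrightarrow> Z \<subseteq> A \<or> Z \<subseteq> B"
      and AB: "closedin (subtopology T S) A \<and> closedin (subtopology T S) B \<and> Z \<subseteq> A \<union> B"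
    then obtain A' B' where "closedin T A'" "A = A' \<inter> S" "closedin T B'" "B = B' \<inter> S"
      by (auto simp: closedin_subtopology)
    then show "Z \<subseteq> A \<or> Z \<subseteq> B" using AB True *[rule_format, of A' B'] by blast
  qed
  then show ?thesis using True unfolding irreducible_in_def by auto
qed (auto simp: irreducible_in_def)

lemma irreducible_in_nonempty: "irreducible_in T Z \<Longrightarrow> Z \<noteq> {}"
  by (simp add: irreducible_in_def)

lemma irreducible_in_subset: "irreducible_in T Z \<Longrightarrow> Z \<subseteq> topspace T"
  by (simp add: irreducible_in_def)

lemma irreducible_in_closure_of:
  assumes "irreducible_in T Z" shows "irreducible_in T (T closure_of Z)"
  unfolding irreducible_in_def
proof (intro conjI allI impI)
  show "T closure_of Z \<subseteq> topspace T" by (rule closure_of_subset_topspace)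
  have sub: "Z \<subseteq> T closure_of Z"
    by (rule closure_of_subset [OF irreducible_in_subset [OF assms]])
  then show "T closure_of Z \<noteq> {}" using irreducible_in_nonempty [OF assms] by blast
  fix A B assume AB: "closedin T A \<and> closedin T B \<and> T closure_of Z \<subseteq> A \<union> B"
  then have "Z \<subseteq> A \<or> Z \<subseteq> B" using sub by (intro irreducible_in_closedD [OF assms]) auto
  then show "T closure_of Z \<subseteq> A \<or> T closure_of Z \<subseteq> B"
    using AB closure_of_minimal by metis
qed

lemma irreducible_in_singleton: "x \<in> topspace T \<Longrightarrow> irreducible_in T {x}"
  by (auto simp: irreducible_in_def)

lemma irreducible_in_image:
  assumes f: "continuous_map S T f" and Z: "irreducible_in S Z"
  shows "irreducible_in T (f ` Z)"
  unfolding irreducible_in_def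
proof (intro conjI allI impI)
  show "f ` Z \<subseteq> topspace T"
    using irreducible_in_subset [OF Z] f by (auto simp: continuous_map_def)
  show "f ` Z \<noteq> {}" using irreducible_in_nonempty [OF Z] by blast
  fix A B assume AB: "closedin T A \<and> closedin T B \<and> f ` Z \<subseteq> A \<union> B"
  let ?p = "\<lambda>C. {x \<in> topspace S. f x \<in> C}"
  have "closedin S (?p A)" "closedin S (?p B)"
    using AB f by (auto simp: closedin_continuous_map_preimage)
  moreover have "Z \<subseteq> ?p A \<union> ?p B" using AB irreducible_in_subset [OF Z] by blast
  ultimately have "Z \<subseteq> ?p A \<or> Z \<subseteq> ?p B" using Z unfolding irreducible_in_def by blast
  then show "f ` Z \<subseteq> A \<or> f ` Z \<subseteq> B" by blast
qed

lemma irreducible_in_Int_open: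
  assumes Z: "irreducible_in T Z" and U: "openin T U" "Z \<inter> U \<noteq> {}"
  shows "irreducible_in T (Z \<inter> U)" "Z \<subseteq> T closure_of (Z \<inter> U)"
proof -
  show "irreducible_in T (Z \<inter> U)"
    unfolding irreducible_in_iff_open
  proof (intro conjI allI impI)
    fix V W assume VW: "openin T V \<and> openin T W \<and> Z \<inter> U \<inter> V \<noteq> {} \<and> Z \<inter> U \<inter> W \<noteq> {}"
    then have "openin T (U \<inter> V)" "openin T (U \<inter> W)" using U by auto
    then have "Z \<inter> (U \<inter> V) \<inter> (U \<inter> W) \<noteq> {}"
      by (rule irreducible_inD [OF Z]) (use VW in blast)+
    then show "Z \<inter> U \<inter> V \<inter> W \<noteq> {}" by blast
  qed (use Z U irreducible_in_subset in auto)
  show "Z \<subseteq> T closure_of (Z \<inter> U)"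
  proof
    fix x assume x: "x \<in> Z"
    have "\<exists>y. y \<in> Z \<inter> U \<and> y \<in> V" if "x \<in> V" "openin T V" for V
      using irreducible_inD [OF Z U(1) that(2) U(2)] that x by blast
    then show "x \<in> T closure_of (Z \<inter> U)"
      using x irreducible_in_subset [OF Z] by (auto simp: in_closure_of)
  qed
qed

lemma irreducible_closed_eq_closure_of_Int_open:
  assumes "irreducible_in T Z" "closedin T Z" "openin T U" "Z \<inter> U \<noteq> {}"
  shows "T closure_of (Z \<inter> U) = Z"
  using irreducible_in_Int_open(2) [OF assms(1,3,4)] closure_of_minimal [OF _ assms(2), of "Z \<inter> U"] by blast

lemma irreducible_in_Union_closed:
  assumes "irreducible_in T Z" "finite F" "\<And>C. C \<in> F \<Longrightarrow> closedin T C" "Z \<subseteq> \<Union>F"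
  shows "\<exists>C\<in>F. Z \<subseteq> C"
  using assms(2,3,4)
proof (induction F)
  case empty
  then show ?case using irreducible_in_nonempty [OF assms(1)] by auto
next
  case (insert C F)
  have "closedin T (\<Union>F)" using insert by (intro closedin_Union) auto
  moreover have "Z \<subseteq> C \<union> \<Union>F" using insert by auto
  ultimately have "Z \<subseteq> C \<or> Z \<subseteq> \<Union>F"
    using insert.prems by (intro irreducible_in_closedD [OF assms(1)]) auto
  then show ?case using insert by auto
qed

lemma irreducible_component_closed:
  assumes "Z \<in> irreducible_components T" shows "closedin T Z"
proof -
  have Z: "irreducible_in T Z" using assms by (simp add: irreducible_components_def)
  have "T closure_of Z = Z"
    using assms irreducible_in_closure_of [OF Z] closure_of_subset [OF irreducible_in_subset [OF Z]]
    by (simp add: irreducible_components_def)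
  then show ?thesis by (metis closedin_closure_of)
qed


subsection \<open>Noetherian spaces\<close>

text \<open>The descending chain condition for closed sets, stated as well-foundedness so that
  Noetherian induction is directly available.\<close>

definition noetherian_space :: "'a topology \<Rightarrow> bool" where
  "noetherian_space T \<longleftrightarrow> wf {(A, B). closedin T A \<and> closedin T B \<and> A \<subset> B}"

lemma noetherian_spaceI:
  assumes "\<And>C :: nat \<Rightarrow> 'a set. (\<And>i. closedin T (C i)) \<Longrightarrow> (\<And>i. C (Suc i) \<subset> C i) \<Longrightarrow> False"
  shows "noetherian_space T"
  unfolding noetherian_space_def wf_iff_no_infinite_down_chain
proof
  assume "\<exists>C. \<forall>i. (C (Suc i), C i) \<in> {(A, B). closedin T A \<and> closedin T B \<and> A \<subset> B}"
  then obtain C where "\<forall>i. (C (Suc i), C i) \<in> {(A, B). closedin T A \<and> closedin T B \<and> A \<subset> B}" ..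
  then show False by (intro assms [of C]) auto
qed

lemma noetherian_space_stationary:
  fixes C :: "nat \<Rightarrow> 'a set"
  assumes T: "noetherian_space T" and C: "\<And>i. closedin T (C i)" "\<And>i. C (Suc i) \<subseteq> C i"
  shows "\<exists>n. \<forall>i\<ge>n. C i = C n"
proof -
  obtain D where D: "D \<in> range C" "\<And>E. (E, D) \<in> {(A, B). closedin T A \<and> closedin T B \<and> A \<subset> B} \<Longrightarrow> E \<notin> range C"
    using T unfolding noetherian_space_def by (rule wfE_min [where Q = "range C" and x = "C 0"]) auto
  then obtain n where n: "D = C n" by blast
  have "C i = C n" if "i \<ge> n" for i
  proof -
    have "C i \<subseteq> C n" using that C(2) by (rule lift_Suc_antimono_le [rotated])
    then show ?thesis using D(2) [of "C i"] n C(1) by auto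
  qed
  then show ?thesis by blast
qed

text \<open>A relatively closed set is the trace of its closure, so a strictly descending chain in
  the subspace remains strict after taking closures.\<close>

lemma noetherian_space_subtopology:
  assumes "noetherian_space T" shows "noetherian_space (subtopology T S)"
proof (rule noetherian_spaceI)
  fix C :: "nat \<Rightarrow> 'a set"
  assume C: "\<And>i. closedin (subtopology T S) (C i)" and dec: "\<And>i. C (Suc i) \<subset> C i"
  have eq: "C i = S \<inter> T closure_of C i" for i
    using C [of i] by (metis closure_of_closedin closure_of_subtopology closedin_subset inf.absorb2 le_inf_iff topspace_subtopology)
  have "T closure_of C (Suc i) \<subseteq> T closure_of C i" for i
    using dec by (intro closure_of_mono) auto
  then obtain n where n: "\<forall>i\<ge>n. T closure_of C i = T closure_of C n"
    using noetherian_space_stationary [OF assms, of "\<lambda>i. T closure_of C i"] by auto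
  have "T closure_of C (Suc n) = T closure_of C n" using n [rule_format, of "Suc n"] by simp
  then have "C (Suc n) = C n" using eq by metis
  then show False using dec [of n] by auto
qed

lemma noetherian_space_Union:
  assumes "finite \<U>" "\<Union>\<U> = topspace T" "\<And>U. U \<in> \<U> \<Longrightarrow> noetherian_space (subtopology T U)"
  shows "noetherian_space T"
proof (rule noetherian_spaceI)
  fix C :: "nat \<Rightarrow> 'a set"
  assume C: "\<And>i. closedin T (C i)" and dec: "\<And>i. C (Suc i) \<subset> C i"
  have "\<exists>n. \<forall>i\<ge>n. C i \<inter> U = C n \<inter> U" if "U \<in> \<U>" for U
    using noetherian_space_stationary [OF assms(3) [OF that], of "\<lambda>i. C i \<inter> U"] C dec
    by (auto simp: closedin_subtopology)
  then obtain n where n: "\<And>U i. U \<in> \<U> \<Longrightarrow> i \<ge> n U \<Longrightarrow> C i \<inter> U = C (n U) \<inter> U"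
    by metis
  define N where "N = (\<Sum>U\<in>\<U>. n U)"
  have le: "n U \<le> N" if "U \<in> \<U>" for U
    unfolding N_def using that assms(1) by (intro member_le_sum) auto
  have "C (Suc N) \<inter> U = C N \<inter> U" if "U \<in> \<U>" for U
    using n [OF that, of N] n [OF that, of "Suc N"] le [OF that] by auto
  then have "C (Suc N) \<inter> \<Union>\<U> = C N \<inter> \<Union>\<U>" by blast
  then have "C (Suc N) = C N"
    using assms(2) C [THEN closedin_subset] by (metis inf.absorb1)
  then show False using dec [of N] by auto
qed

lemma homeomorphic_map_noetherian:
  assumes f: "homeomorphic_map S T f" and T: "noetherian_space T"
  shows "noetherian_space S"
proof (rule noetherian_spaceI)
  fix C :: "nat \<Rightarrow> 'a set"
  assume C: "\<And>i. closedin S (C i)" and dec: "\<And>i. C (Suc i) \<subset> C i"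
  have "closedin T (f ` C i)" for i
    using C [of i] f by (metis homeomorphic_map_closedness_eq)
  then obtain n where n: "\<forall>i\<ge>n. f ` C i = f ` C n"
    using noetherian_space_stationary [OF T, of "\<lambda>i. f ` C i"] dec by (metis image_mono psubset_imp_subset)
  have "f ` C (Suc n) = f ` C n" using n [rule_format, of "Suc n"] by simp
  then have "C (Suc n) = C n"
    using f C [THEN closedin_subset] unfolding homeomorphic_map_def
    by (metis homeomorphic_imp_injective_map f inj_on_image_eq_iff)
  then show False using dec [of n] by auto
qed

lemma noetherian_closed_Union_irreducible:
  assumes T: "noetherian_space T" and C: "closedin T C"
  shows "\<exists>F. finite F \<and> C = \<Union>F \<and> (\<forall>Z\<in>F. closedin T Z \<and> irreducible_in T Z)"
  using C
proof (induction C rule: wf_induct_rule [OF T [unfolded noetherian_space_def]])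
  case (1 C)
  consider "C = {}" | "irreducible_in T C"
    | A B where "closedin T A" "closedin T B" "C \<subseteq> A \<union> B" "\<not> C \<subseteq> A" "\<not> C \<subseteq> B"
    using closedin_subset [OF 1(2)] unfolding irreducible_in_def by blast
  then show ?case
  proof cases
    case 1
    then show ?thesis by (intro exI [of _ "{}"]) simp
  next
    case 2
    then show ?thesis using 1(2) by (intro exI [of _ "{C}"]) simp
  next
    case 3
    have cl: "closedin T (C \<inter> A)" "closedin T (C \<inter> B)" using 1(2) 3 by auto
    obtain F where F: "finite F" "C \<inter> A = \<Union>F" "\<forall>Z\<in>F. closedin T Z \<and> irreducible_in T Z"
      using 1(1) [of "C \<inter> A"] 1(2) 3 cl by blast
    obtain F' where F': "finite F'" "C \<inter> B = \<Union>F'" "\<forall>Z\<in>F'. closedin T Z \<and> irreducible_in T Z"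
      using 1(1) [of "C \<inter> B"] 1(2) 3 cl by blast
    have "C = (C \<inter> A) \<union> (C \<inter> B)" using 3(3) by blast
    then have "C = \<Union>(F \<union> F')" unfolding F(2) F'(2) by blast
    then show ?thesis using F F' by (intro exI [of _ "F \<union> F'"]) auto
  qed
qed

lemma finite_irreducible_components:
  assumes "noetherian_space T" shows "finite (irreducible_components T)"
proof -
  obtain F where F: "finite F" "topspace T = \<Union>F" "\<forall>Z\<in>F. closedin T Z \<and> irreducible_in T Z"
    using noetherian_closed_Union_irreducible [OF assms closedin_topspace] by blast
  have "Z \<in> F" if Z: "Z \<in> irreducible_components T" for Z
  proof -
    have irr: "irreducible_in T Z" using Z by (simp add: irreducible_components_def)
    then obtain C where "C \<in> F" "Z \<subseteq> C"
      using irreducible_in_Union_closed [OF irr F(1)] F irreducible_in_subset by metis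
    then show ?thesis using Z F(3) unfolding irreducible_components_def by auto
  qed
  then show ?thesis using F(1) by (meson finite_subset subsetI)
qed

lemma irreducible_in_subset_component:
  assumes T: "noetherian_space T" and Z: "irreducible_in T Z"
  shows "\<exists>C\<in>irreducible_components T. Z \<subseteq> C"
proof -
  obtain F where F: "finite F" "topspace T = \<Union>F" "\<forall>Z\<in>F. closedin T Z \<and> irreducible_in T Z"
    using noetherian_closed_Union_irreducible [OF T closedin_topspace] by blast
  have in_F: "\<exists>C\<in>F. W \<subseteq> C" if "irreducible_in T W" for W
    using irreducible_in_Union_closed [OF that F(1)] F irreducible_in_subset [OF that] by metis
  obtain C where C: "C \<in> F" "Z \<subseteq> C" using in_F [OF Z] by blast
  then obtain M where M: "M \<in> {D \<in> F. C \<subseteq> D}" "\<And>D. D \<in> {D \<in> F. C \<subseteq> D} \<Longrightarrow> M \<subseteq> D \<Longrightarrow> D = M"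
  proof -
    have "finite {D \<in> F. C \<subseteq> D}" "{D \<in> F. C \<subseteq> D} \<noteq> {}" using F(1) C by auto
    from finite_has_maximal [OF this] obtain M where M: "M \<in> {D \<in> F. C \<subseteq> D}"
      "\<forall>D\<in>{D \<in> F. C \<subseteq> D}. M \<subseteq> D \<longrightarrow> M = D" by blast
    show ?thesis by (rule that [OF M(1)]) (use M(2) in blast)
  qed
  have "M \<in> irreducible_components T"
    unfolding irreducible_components_def
  proof (intro CollectI conjI allI impI)
    show "irreducible_in T M" using M F by blast
    fix W assume W: "irreducible_in T W \<and> M \<subseteq> W"
    then obtain D where "D \<in> F" "W \<subseteq> D" using in_F by blast
    then show "W = M" using M W by blast
  qed
  then show ?thesis using C M by blast
qed

text \<open>A dense set missing \<open>C\<close> would lie in the finite, hence closed, union of the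
  other components. This union would be the whole space, and irreducibility would put
  \<open>C\<close> into one of them, against maximality.\<close>

lemma dense_open_meets_component:
  assumes T: "noetherian_space T" and C: "C \<in> irreducible_components T"
    and U: "T closure_of U = topspace T" "U \<subseteq> topspace T"
  shows "C \<inter> U \<noteq> {}"
proof
  assume empty: "C \<inter> U = {}"
  let ?F = "irreducible_components T - {C}"
  have fin: "finite ?F" using finite_irreducible_components [OF T] by simp
  have cl: "closedin T D" if "D \<in> ?F" for D using that irreducible_component_closed by blast
  have "U \<subseteq> \<Union>?F"
  proof
    fix x assume x: "x \<in> U"
    then obtain D where "D \<in> irreducible_components T" "x \<in> D"
      using irreducible_in_subset_component [OF T irreducible_in_singleton, of x] U by blast
    then show "x \<in> \<Union>?F" using x empty by auto
  qed
  moreover have "closedin T (\<Union>?F)" using fin cl by (intro closedin_Union) auto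
  ultimately have "topspace T \<subseteq> \<Union>?F" using closure_of_minimal U by metis
  moreover have irr: "irreducible_in T C" using C by (simp add: irreducible_components_def)
  ultimately obtain D where "D \<in> ?F" "C \<subseteq> D"
    using irreducible_in_Union_closed [OF irr fin cl] irreducible_in_subset [OF irr] by blast
  then show False using C unfolding irreducible_components_def by auto
qed


subsection \<open>Krull dimension\<close>

definition irr_chain :: "'a topology \<Rightarrow> nat \<Rightarrow> (nat \<Rightarrow> 'a set) \<Rightarrow> bool" where
  "irr_chain T n Z \<longleftrightarrow> (\<forall>i\<le>n. closedin T (Z i) \<and> irreducible_in T (Z i)) \<and> (\<forall>i<n. Z i \<subset> Z (Suc i))"

lemma krull_dim_altdef: "krull_dim T = Sup {enat n | n. \<exists>Z. irr_chain T n Z}"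
  by (simp add: krull_dim_def irr_chain_def)

lemma krull_dim_ge: "irr_chain T n Z \<Longrightarrow> enat n \<le> krull_dim T"
  unfolding krull_dim_altdef by (intro Sup_upper) auto

lemma krull_dim_le: "(\<And>n Z. irr_chain T n Z \<Longrightarrow> enat n \<le> d) \<Longrightarrow> krull_dim T \<le> d"
  unfolding krull_dim_altdef by (intro Sup_least) auto

lemma irr_chain_mono: "irr_chain T n Z \<Longrightarrow> i \<le> j \<Longrightarrow> j \<le> n \<Longrightarrow> Z i \<subseteq> Z j"
proof (induction j)
  case (Suc j)
  show ?case
  proof (cases "i = Suc j")
    case False
    have "Z j \<subset> Z (Suc j)" using Suc.prems by (auto simp: irr_chain_def)
    then show ?thesis using False Suc by auto
  qed simp
qed auto

lemma irr_chain_shorten: "irr_chain T n Z \<Longrightarrow> m \<le> n \<Longrightarrow> irr_chain T m Z"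
  by (auto simp: irr_chain_def)

text \<open>Nonemptiness matters for \<open>n = 0\<close>: the empty space has dimension
  \<open>0\<close> as well, being a supremum over the empty set.\<close>

lemma exists_irr_chain:
  assumes "enat n \<le> krull_dim T" "topspace T \<noteq> {}"
  shows "\<exists>Z. irr_chain T n Z"
proof (cases n)
  case 0
  obtain x where "x \<in> topspace T" using assms by blast
  then have "irr_chain T 0 (\<lambda>_. T closure_of {x})"
    by (auto simp: irr_chain_def intro: irreducible_in_closure_of irreducible_in_singleton)
  then show ?thesis using 0 by blast
next
  case (Suc m)
  show ?thesis
  proof (rule ccontr)
    assume no: "\<nexists>Z. irr_chain T n Z"
    have "krull_dim T \<le> enat m"
    proof (rule krull_dim_le)
      fix k Z assume "irr_chain T k Z"
      then have "\<not> n \<le> k" using no irr_chain_shorten [of T k Z n] by blast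
      then show "enat k \<le> enat m" using Suc by simp
    qed
    then have "enat n \<le> enat m" using assms(1) by (rule order_trans [rotated])
    then show False using Suc by simp
  qed
qed

lemma irr_chain_closed_subspace:
  assumes "closedin T D"
  shows "irr_chain (subtopology T D) n Z \<longleftrightarrow> irr_chain T n Z \<and> Z n \<subseteq> D"
proof
  assume "irr_chain (subtopology T D) n Z"
  then show "irr_chain T n Z \<and> Z n \<subseteq> D"
    using assms by (auto simp: irr_chain_def irreducible_in_subtopology closedin_closed_subtopology)
next
  assume *: "irr_chain T n Z \<and> Z n \<subseteq> D"
  then have "Z i \<subseteq> D" if "i \<le> n" for i using irr_chain_mono [of T n Z i n] that by auto
  then show "irr_chain (subtopology T D) n Z"
    using * assms by (auto simp: irr_chain_def irreducible_in_subtopology closedin_closed_subtopology)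
qed

lemma krull_dim_closed_mono:
  assumes "closedin T A" "closedin T B" "A \<subseteq> B"
  shows "krull_dim (subtopology T A) \<le> krull_dim (subtopology T B)"
proof (rule krull_dim_le)
  fix n Z assume "irr_chain (subtopology T A) n Z"
  then show "enat n \<le> krull_dim (subtopology T B)"
    using assms by (intro krull_dim_ge [of _ _ Z]) (auto simp: irr_chain_closed_subspace)
qed

lemma krull_dim_strict:
  assumes A: "closedin T A" "irreducible_in T A" and B: "closedin T B" "irreducible_in T B" and "A \<subset> B"
  shows "krull_dim (subtopology T A) + 1 \<le> krull_dim (subtopology T B)"
proof -
  have step: "enat n + 1 \<le> krull_dim (subtopology T B)" if "enat n \<le> krull_dim (subtopology T A)" for n
  proof -
    have "topspace (subtopology T A) \<noteq> {}"
      using irreducible_in_nonempty [OF A(2)] irreducible_in_subset [OF A(2)] by auto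
    then obtain Z where "irr_chain (subtopology T A) n Z"
      using exists_irr_chain [OF \<open>enat n \<le> krull_dim (subtopology T A)\<close>] by blast
    then have Z: "irr_chain T n Z" "Z n \<subseteq> A" using A by (auto simp: irr_chain_closed_subspace)
    let ?Z = "\<lambda>i. if i \<le> n then Z i else B"
    have "irr_chain T (Suc n) ?Z"
      using Z B \<open>A \<subset> B\<close> by (auto simp: irr_chain_def le_Suc_eq less_Suc_eq)
    then have "irr_chain (subtopology T B) (Suc n) ?Z"
      using B by (simp add: irr_chain_closed_subspace)
    then have "enat (Suc n) \<le> krull_dim (subtopology T B)" by (rule krull_dim_ge)
    then show ?thesis by (simp add: one_enat_def)
  qed
  show ?thesis
  proof (cases "krull_dim (subtopology T A)")
    case (enat n)
    then show ?thesis using step [of n] by simp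
  next
    case infinity
    have "enat n \<le> krull_dim (subtopology T B)" for n
      using step [of n] infinity by (simp add: one_enat_def order_trans [OF _ step [of n]])
    then have "krull_dim (subtopology T B) = \<infinity>"
      by (metis enat_ord_simps(1) not_enat_eq not_less_eq_eq order_refl)
    then show ?thesis by simp
  qed
qed

lemma irr_chain_image:
  assumes f: "homeomorphic_map S T f" and Z: "irr_chain S n Z"
  shows "irr_chain T n (\<lambda>i. f ` Z i)"
  unfolding irr_chain_def
proof (intro conjI allI impI)
  have c: "continuous_map S T f" and inj: "inj_on f (topspace S)"
    using f homeomorphic_imp_continuous_map homeomorphic_imp_injective_map by blast+
  fix i
  show "closedin T (f ` Z i)" if "i \<le> n"
    using Z f that unfolding irr_chain_def
    by (metis homeomorphic_map_closedness_eq)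
  show "irreducible_in T (f ` Z i)" if "i \<le> n"
    using Z c that irreducible_in_image unfolding irr_chain_def by blast
  assume "i < n"
  then have "Z i \<subset> Z (Suc i)" "Z (Suc i) \<subseteq> topspace S"
    using Z closedin_subset [of S "Z (Suc i)"] unfolding irr_chain_def by auto
  then show "f ` Z i \<subset> f ` Z (Suc i)"
    using inj by (meson image_strict_mono inj_on_subset)
qed

lemma krull_dim_homeomorphic:
  assumes "S homeomorphic_space T" shows "krull_dim S = krull_dim T"
proof -
  have "krull_dim S \<le> krull_dim T" if "S homeomorphic_space T" for S :: "'c topology" and T :: "'d topology"
    using that irr_chain_image krull_dim_ge krull_dim_le unfolding homeomorphic_space by metis
  then show ?thesis
    using assms homeomorphic_space_sym
    by (smt (verit) homeomorphic_space irr_chain_image krull_dim_ge krull_dim_le order_antisym)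
qed

text \<open>The closures of the members of a chain form a chain in the whole space; it stays strict
  because each member is the trace of its closure.\<close>

lemma krull_dim_open_le:
  assumes U: "openin T U"
  shows "krull_dim (subtopology T U) \<le> krull_dim T"
proof (rule krull_dim_le)
  fix n Z assume Z: "irr_chain (subtopology T U) n Z"
  have eq: "U \<inter> T closure_of Z i = Z i" if "i \<le> n" for i
    using Z that unfolding irr_chain_def
    by (metis closure_of_closedin closure_of_subtopology closedin_subset inf.absorb2 le_inf_iff topspace_subtopology)
  have "irr_chain T n (\<lambda>i. T closure_of Z i)"
    unfolding irr_chain_def
  proof (intro conjI allI impI)
    fix i show "closedin T (T closure_of Z i)" by simp
    show "irreducible_in T (T closure_of Z i)" if "i \<le> n"
      using Z that by (intro irreducible_in_closure_of) (auto simp: irr_chain_def irreducible_in_subtopology)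
    assume i: "i < n"
    then have "Z i \<subset> Z (Suc i)" using Z by (auto simp: irr_chain_def)
    then show "T closure_of Z i \<subset> T closure_of Z (Suc i)"
    proof -
      have "T closure_of Z i \<subseteq> T closure_of Z (Suc i)"
        using \<open>Z i \<subset> Z (Suc i)\<close> by (intro closure_of_mono) auto
      moreover have "T closure_of Z i \<noteq> T closure_of Z (Suc i)"
      proof
        assume "T closure_of Z i = T closure_of Z (Suc i)"
        then have "Z i = Z (Suc i)" using eq [of i] eq [of "Suc i"] i by (metis Suc_leI less_imp_le)
        then show False using \<open>Z i \<subset> Z (Suc i)\<close> by blast
      qed
      ultimately show ?thesis by blast
    qed
  qed
  then show "enat n \<le> krull_dim T" by (rule krull_dim_ge)
qed

text \<open>If the smallest member meets \<open>U\<close>, all of them do, and each is the closure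
  of its trace; hence distinct members have distinct traces.\<close>

lemma irr_chain_Int_open:
  assumes Z: "irr_chain T n Z" and U: "openin T U" "Z 0 \<inter> U \<noteq> {}"
  shows "irr_chain (subtopology T U) n (\<lambda>i. Z i \<inter> U)"
  unfolding irr_chain_def
proof (intro conjI allI impI)
  have ne: "Z i \<inter> U \<noteq> {}" if "i \<le> n" for i
    using irr_chain_mono [OF Z, of 0 i] that U(2) by auto
  have irr: "irreducible_in T (Z i)" and cl: "closedin T (Z i)" if "i \<le> n" for i
    using Z that by (auto simp: irr_chain_def)
  fix i
  show "closedin (subtopology T U) (Z i \<inter> U)" if "i \<le> n"
    using cl [OF that] by (auto simp: closedin_subtopology)
  show "irreducible_in (subtopology T U) (Z i \<inter> U)" if "i \<le> n"
    using irreducible_in_Int_open(1) [OF irr [OF that] U(1) ne [OF that]]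
    by (simp add: irreducible_in_subtopology)
  assume i: "i < n"
  have "T closure_of (Z j \<inter> U) = Z j" if "j \<le> n" for j
    using irreducible_closed_eq_closure_of_Int_open [OF irr cl U(1) ne] that by blast
  then have "T closure_of (Z i \<inter> U) \<noteq> T closure_of (Z (Suc i) \<inter> U)"
    using Z i by (auto simp: irr_chain_def)
  moreover have "Z i \<subset> Z (Suc i)" using Z i by (auto simp: irr_chain_def)
  ultimately show "Z i \<inter> U \<subset> Z (Suc i) \<inter> U" by auto
qed

text \<open>If the complement of \<open>E\<close> is dense, a closed irreducible subset of codimension one that lies in
  \<open>E\<close> is automatically a component of \<open>E\<close>: anything between it and a component of the whole space
  would produce too long a chain.\<close>

lemma codim_one_components:
  assumes T: "noetherian_space T" "krull_dim T = enat n"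
    and E: "closedin T E" "T closure_of (topspace T - E) = topspace T"
  shows "{D \<in> irreducible_components (subtopology T E). krull_dim (subtopology T D) + 1 = krull_dim T} =
    {D. closedin T D \<and> irreducible_in T D \<and> krull_dim (subtopology T D) + 1 = krull_dim T \<and> D \<subseteq> E}"
proof (intro equalityI subsetI)
  fix D assume "D \<in> {D \<in> irreducible_components (subtopology T E). krull_dim (subtopology T D) + 1 = krull_dim T}"
  then have D: "D \<in> irreducible_components (subtopology T E)" "krull_dim (subtopology T D) + 1 = krull_dim T"
    by auto
  have "closedin T D"
    using irreducible_component_closed [OF D(1)] E by (simp add: closedin_closed_subtopology)
  then show "D \<in> {D. closedin T D \<and> irreducible_in T D \<and> krull_dim (subtopology T D) + 1 = krull_dim T \<and> D \<subseteq> E}"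
    using D by (auto simp: irreducible_components_def irreducible_in_subtopology)
next
  fix D assume "D \<in> {D. closedin T D \<and> irreducible_in T D \<and> krull_dim (subtopology T D) + 1 = krull_dim T \<and> D \<subseteq> E}"
  then have D: "closedin T D" "irreducible_in T D" "krull_dim (subtopology T D) + 1 = krull_dim T" "D \<subseteq> E"
    by auto
  have "W = D" if W: "irreducible_in (subtopology T E) W" "D \<subseteq> W" for W
  proof (rule ccontr)
    assume "W \<noteq> D"
    have W': "irreducible_in T W" "W \<subseteq> E" using W by (auto simp: irreducible_in_subtopology)
    let ?W = "T closure_of W"
    have irrW: "irreducible_in T ?W" by (rule irreducible_in_closure_of [OF W'(1)])
    have "W \<subseteq> ?W" by (rule closure_of_subset [OF irreducible_in_subset [OF W'(1)]])
    then have DW: "D \<subset> ?W" using W \<open>W \<noteq> D\<close> by blast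
    have WE: "?W \<subseteq> E" by (rule closure_of_minimal [OF W'(2) E(1)])
    obtain C where C: "C \<in> irreducible_components T" "?W \<subseteq> C"
      using irreducible_in_subset_component [OF T(1) irrW] by blast
    then have irrC: "irreducible_in T C" "closedin T C"
      using irreducible_component_closed by (auto simp: irreducible_components_def)
    have "C \<inter> (topspace T - E) \<noteq> {}"
      by (rule dense_open_meets_component [OF T(1) C(1) E(2)]) auto
    then have WC: "?W \<subset> C" using C WE by blast
    have "krull_dim (subtopology T D) + 1 + 1 \<le> krull_dim (subtopology T ?W) + 1"
      using krull_dim_strict [OF D(1,2) _ irrW DW] by (simp add: add_right_mono)
    also have "\<dots> \<le> krull_dim (subtopology T C)"
      using krull_dim_strict [OF _ irrW irrC(2,1) WC] by simp
    also have "\<dots> \<le> krull_dim T"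
      using krull_dim_closed_mono [OF irrC(2) closedin_topspace] irrC closedin_subset by fastforce
    finally show False using D(3) T(2) by (auto simp: one_enat_def)
  qed
  then show "D \<in> {D \<in> irreducible_components (subtopology T E). krull_dim (subtopology T D) + 1 = krull_dim T}"
    using D by (auto simp: irreducible_components_def irreducible_in_subtopology)
qed


section \<open>Affine space\<close>

subsection \<open>Polynomial functions\<close>

lemma sum_fun_apply: "(\<Sum>i\<in>I. f i) x = (\<Sum>i\<in>I. f i x)"
  by (induction I rule: infinite_finite_induct) auto

lemma power_fun_apply: "((f :: 'a \<Rightarrow> 'b::comm_ring_1) ^ n) x = f x ^ n"
  by (induction n) auto

lemma poly_fun_apply:
  fixes p :: "('a \<Rightarrow> 'b::comm_ring_1) poly"
  shows "poly p t x = (\<Sum>j\<le>degree p. coeff p j x * t x ^ j)"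
  by (simp add: poly_altdef sum_fun_apply power_fun_apply)

definition const_funs :: "('a \<Rightarrow> 'k::field) set" where
  "const_funs = range (\<lambda>c _. c)"

definition coord :: "nat \<Rightarrow> (nat \<Rightarrow> 'k) \<Rightarrow> 'k" where
  "coord i x = x i"

text \<open>The polynomial functions in the first \<open>n\<close> coordinates, as functions on all
  sequences. Building them by iterated adjunction makes the basis theorem and the extension of
  homomorphisms applicable without a detour through \<open>mpoly\<close>.\<close>

definition PF :: "nat \<Rightarrow> ((nat \<Rightarrow> 'k::field) \<Rightarrow> 'k) set" where
  "PF n = adjoin_list const_funs coord n"

lemma const_funsI: "(\<lambda>_. c) \<in> const_funs"
  by (simp add: const_funs_def)

lemma subring_const_funs: "subring_set (const_funs :: ('a \<Rightarrow> 'k::field) set)"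
  unfolding subring_set_def
proof (intro conjI ballI)
  show "1 \<in> (const_funs :: ('a \<Rightarrow> 'k::field) set)"
    using const_funsI [of 1] by (simp add: one_fun_def)
  fix a b :: "'a \<Rightarrow> 'k" assume "a \<in> const_funs" "b \<in> const_funs"
  then obtain c d where cd: "a = (\<lambda>_. c)" "b = (\<lambda>_. d)" by (auto simp: const_funs_def)
  show "a - b \<in> const_funs" using const_funsI [of "c - d"] by (simp add: cd fun_diff_def)
  show "a * b \<in> const_funs" using const_funsI [of "c * d"] by (simp add: cd times_fun_def)
qed

lemma noeth_const_funs: "noeth (const_funs :: ('a \<Rightarrow> 'k::field) set)"
  unfolding noeth_def
proof (intro allI impI)
  fix f :: "nat \<Rightarrow> 'a \<Rightarrow> 'k" assume f: "\<forall>i. f i \<in> const_funs"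
  then have "\<forall>i. \<exists>c. f i = (\<lambda>_. c)" unfolding const_funs_def by blast
  then obtain c where c: "\<And>i. f i = (\<lambda>_. c i)" using choice by force
  show "\<exists>m d. (\<forall>i<m. d i \<in> const_funs) \<and> f m = (\<Sum>i<m. d i * f i)"
  proof (cases "c 0 = 0")
    case True
    then show ?thesis by (intro exI [of _ 0]) (simp add: c zero_fun_def)
  next
    case False
    then show ?thesis
      by (intro exI [of _ 1] exI [of _ "\<lambda>_ _. c 1 / c 0"]) (simp add: c times_fun_def const_funsI)
  qed
qed

lemma subring_PF: "subring_set (PF n)"
  unfolding PF_def by (rule subring_set_adjoin_list [OF subring_const_funs])

lemma PF_const: "(\<lambda>_. c) \<in> PF n"
  unfolding PF_def using adjoin_list_superset [OF subring_const_funs] const_funsI by blast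

lemma PF_coord: "i < n \<Longrightarrow> coord i \<in> PF n"
  unfolding PF_def by (rule adjoin_list_generator [OF subring_const_funs])

lemma PF_diff: "f \<in> PF n \<Longrightarrow> g \<in> PF n \<Longrightarrow> (\<lambda>x. f x - g x) \<in> PF n"
  using subring_set_diff [OF subring_PF, of f n g] by (simp add: fun_diff_def)

lemma PF_add: "f \<in> PF n \<Longrightarrow> g \<in> PF n \<Longrightarrow> (\<lambda>x. f x + g x) \<in> PF n"
  using subring_set_add [OF subring_PF, of f n g] by (simp add: plus_fun_def)

lemma PF_mult: "f \<in> PF n \<Longrightarrow> g \<in> PF n \<Longrightarrow> (\<lambda>x. f x * g x) \<in> PF n"
  using subring_set_mult [OF subring_PF, of f n g] by (simp add: times_fun_def)

lemma PF_power: "f \<in> PF n \<Longrightarrow> (\<lambda>x. f x ^ j) \<in> PF n"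
  by (induction j) (auto intro: PF_mult PF_const)

lemma PF_sum: "(\<And>i. i \<in> I \<Longrightarrow> f i \<in> PF n) \<Longrightarrow> (\<lambda>x. \<Sum>i\<in>I. f i x) \<in> PF n"
  by (induction I rule: infinite_finite_induct) (auto intro: PF_add PF_const)

lemma PF_prod: "(\<And>i. i \<in> I \<Longrightarrow> f i \<in> PF n) \<Longrightarrow> (\<lambda>x. \<Prod>i\<in>I. f i x) \<in> PF n"
  by (induction I rule: infinite_finite_induct) (auto intro: PF_mult PF_const)

lemma PF_mono: "m \<le> n \<Longrightarrow> PF m \<subseteq> PF n"
  unfolding PF_def by (rule adjoin_list_mono [OF subring_const_funs])

text \<open>Differences and products suffice, since \<open>Q\<close> then cuts out a subring
  containing the generators.\<close>

lemma PF_induct [consumes 1, case_names const coord diff mult]: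
  assumes f: "f \<in> PF n"
    and "\<And>c. Q (\<lambda>_. c)" "\<And>i. i < n \<Longrightarrow> Q (coord i)"
    and diff: "\<And>f g. Q f \<Longrightarrow> Q g \<Longrightarrow> Q (\<lambda>x. f x - g x)"
    and mult: "\<And>f g. Q f \<Longrightarrow> Q g \<Longrightarrow> Q (\<lambda>x. f x * g x)"
  shows "Q f"
proof -
  have "subring_set {f. Q f}"
    unfolding subring_set_def using assms(2) [of 1] diff mult
    by (auto simp: one_fun_def fun_diff_def times_fun_def)
  then have "PF n \<subseteq> {f. Q f}"
    unfolding PF_def using assms(2,3) by (intro adjoin_list_least) (auto simp: const_funs_def)
  then show ?thesis using f by blast
qed

lemma PF_cong_coord:
  assumes "f \<in> PF n" "\<And>i. i < n \<Longrightarrow> x i = y i"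
  shows "f x = f y"
  using assms(1) by (induction rule: PF_induct) (simp_all add: coord_def assms(2))

lemma PF_SucE:
  assumes "f \<in> PF (Suc n)"
  obtains p where "p \<in> polys (PF n)" "\<And>x. f x = (\<Sum>j\<le>degree p. coeff p j x * x n ^ j)"
proof -
  obtain p where "p \<in> polys (PF n)" "f = poly p (coord n)"
    using assms by (auto simp: PF_def adjoin_def)
  then show ?thesis using that [of p] by (simp add: poly_fun_apply coord_def)
qed

lemma PF_to_mpoly:
  fixes f :: "(nat \<Rightarrow> 'k::field) \<Rightarrow> 'k"
  assumes "f \<in> PF n" shows "\<exists>p :: 'k mpoly. \<forall>x. peval p x = f x"
  using assms
proof (induction rule: PF_induct)
  case (const c)
  show ?case
    by (rule exI [of _ "Poly_Mapping.single 0 c"]) (simp add: peval_single mono_eval_def)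
next
  case (coord i)
  show ?case
    by (rule exI [of _ "Poly_Mapping.single (Poly_Mapping.single i 1) 1"])
      (simp add: peval_single mono_eval_def coord_def)
next
  case (diff f g)
  then obtain p q :: "'k mpoly" where "\<forall>x. peval p x = f x" "\<forall>x. peval q x = g x" by blast
  then show ?case
    by (intro exI [of _ "p + Poly_Mapping.single 0 (- 1) * q"])
      (simp add: peval_add peval_mult peval_single mono_eval_def)
next
  case (mult f g)
  then obtain p q :: "'k mpoly" where "\<forall>x. peval p x = f x" "\<forall>x. peval q x = g x" by blast
  then show ?case by (intro exI [of _ "p * q"]) (simp add: peval_mult)
qed

text \<open>The equality is confined to \<open>affine_points n\<close>: there a monomial involving a
  variable of index at least \<open>n\<close> vanishes and can be replaced by
  \<open>0\<close>.\<close>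

lemma mpoly_to_PF:
  fixes p :: "'k::field mpoly"
  shows "\<exists>f\<in>PF n. \<forall>x\<in>affine_points n. f x = peval p x"
proof (induction p rule: mpoly_induct)
  case zero
  show ?case by (rule bexI [of _ "\<lambda>_. 0"]) (auto intro: PF_const)
next
  case (add p m c)
  obtain f where f: "f \<in> PF n" "\<forall>x\<in>affine_points n. f x = peval p x" using add by blast
  have "\<exists>g\<in>PF n. \<forall>x\<in>affine_points n. g x = mono_eval m (x :: nat \<Rightarrow> 'k)"
  proof (cases "Poly_Mapping.keys m \<subseteq> {..<n}")
    case True
    have "(\<lambda>x. mono_eval m x) \<in> PF n"
      unfolding mono_eval_def
    proof (intro PF_prod)
      fix i assume "i \<in> Poly_Mapping.keys m"
      then have "coord i \<in> PF n" using True by (intro PF_coord) auto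
      then show "(\<lambda>x. x i ^ Poly_Mapping.lookup m i) \<in> PF n"
        using PF_power [of "coord i" n "Poly_Mapping.lookup m i"] by (simp add: coord_def)
    qed
    then show ?thesis by blast
  next
    case False
    then obtain i where "i \<in> Poly_Mapping.keys m" "\<not> i < n" by auto
    then have i: "i \<in> Poly_Mapping.keys m" "i \<ge> n" by simp_all
    then have "mono_eval m x = 0" if "x \<in> affine_points n" for x
      using that unfolding mono_eval_def
      by (intro prod_zero) (auto simp: affine_points_def in_keys_iff)
    then show ?thesis using PF_const [of 0 n] by (intro bexI [of _ "\<lambda>_. 0"]) auto
  qed
  then obtain g :: "(nat \<Rightarrow> 'k) \<Rightarrow> 'k"
    where "g \<in> PF n" "\<forall>x\<in>affine_points n. g x = mono_eval m x" by blast
  then show ?case using f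
    by (intro bexI [of _ "\<lambda>x. f x + c * g x"])
      (use PF_add [OF _ PF_mult [OF PF_const], of f n g c] in \<open>auto simp: peval_add peval_single\<close>)
qed

section \<open>Zariski-closed sets as zero sets of polynomial functions\<close>

definition PF_zeros :: "nat \<Rightarrow> ((nat \<Rightarrow> 'k::field) \<Rightarrow> 'k) set \<Rightarrow> (nat \<Rightarrow> 'k) set" where
  "PF_zeros n S = {x \<in> affine_points n. \<forall>f\<in>S. f x = 0}"

lemma closedin_affine_PF:
  "closedin (zar (affine_space n)) C \<longleftrightarrow> (\<exists>S\<subseteq>PF n. C = PF_zeros n (S :: ((nat \<Rightarrow> 'k::field) \<Rightarrow> 'k) set))"
proof
  assume "closedin (zar (affine_space n)) C"
  then obtain S :: "'k mpoly set" where S: "C = affine_zeros n S"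
    using closedin_affine_space by blast
  obtain F :: "'k mpoly \<Rightarrow> (nat \<Rightarrow> 'k) \<Rightarrow> 'k"
    where F: "\<And>p. F p \<in> PF n" "\<And>p x. x \<in> affine_points n \<Longrightarrow> F p x = peval p x"
    using mpoly_to_PF [of n] by metis
  then have "C = PF_zeros n (F ` S)"
    unfolding S affine_zeros_def PF_zeros_def by auto
  then show "\<exists>S\<subseteq>PF n. C = PF_zeros n S" using F(1) by (intro exI [of _ "F ` S"]) auto
next
  assume "\<exists>S\<subseteq>PF n. C = PF_zeros n S"
  then obtain S where S: "S \<subseteq> PF n" "C = PF_zeros n S" by blast
  obtain p :: "((nat \<Rightarrow> 'k) \<Rightarrow> 'k) \<Rightarrow> 'k mpoly"
    where p: "\<And>f x. f \<in> PF n \<Longrightarrow> peval (p f) x = f x"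
    using PF_to_mpoly [of _ n] by metis
  have "PF_zeros n S = affine_zeros n (p ` S)"
    using p S(1) unfolding affine_zeros_def PF_zeros_def by (auto simp: subset_iff)
  then show "closedin (zar (affine_space n)) C"
    unfolding closedin_affine_space S(2) by blast
qed

lemma pts_affine_space: "pts (affine_space n) = (affine_points n :: (nat \<Rightarrow> 'k::field) set)"
proof -
  have "PF_zeros n {} = (affine_points n :: (nat \<Rightarrow> 'k) set)" by (simp add: PF_zeros_def)
  then have "closedin (zar (affine_space n)) (affine_points n :: (nat \<Rightarrow> 'k) set)"
    using closedin_affine_PF by blast
  moreover have "pts (affine_space n) \<subseteq> (affine_points n :: (nat \<Rightarrow> 'k) set)"
    using closedin_topspace [of "zar (affine_space n :: (nat \<Rightarrow> 'k, 'k) fspace)"]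
    unfolding closedin_affine_PF PF_zeros_def by auto
  ultimately show ?thesis using closedin_subset by blast
qed

lemma closedin_zeros: "S \<subseteq> PF n \<Longrightarrow> closedin (zar (affine_space n)) (PF_zeros n S)"
  using closedin_affine_PF by blast

lemma closedin_zeros1: "f \<in> PF n \<Longrightarrow> closedin (zar (affine_space n)) {x \<in> affine_points n. f x = 0}"
  using closedin_zeros [of "{f}" n] by (simp add: PF_zeros_def)

lemma openin_nonzeros:
  assumes "f \<in> PF n" shows "openin (zar (affine_space n)) {x \<in> affine_points n. f x \<noteq> 0}"
proof -
  have "{x \<in> affine_points n. f x \<noteq> 0} = pts (affine_space n) - {x \<in> affine_points n. f x = 0}"
    by (auto simp: pts_affine_space)
  then show ?thesis using closedin_zeros1 [OF assms] by (simp add: openin_diff)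
qed

lemma not_in_closed_affine:
  assumes "closedin (zar (affine_space n)) C" "x \<in> affine_points n" "x \<notin> C"
  shows "\<exists>f\<in>PF n. f x \<noteq> 0 \<and> (\<forall>y\<in>C. f y = 0)"
proof -
  obtain S where "S \<subseteq> PF n" "C = PF_zeros n S" using assms(1) closedin_affine_PF by blast
  then show ?thesis using assms by (auto simp: PF_zeros_def)
qed

lemma basic_open_affine:
  assumes "openin (zar (affine_space n)) U" "x \<in> U"
  shows "\<exists>f\<in>PF n. f x \<noteq> 0 \<and> (\<forall>y\<in>affine_points n. f y \<noteq> 0 \<longrightarrow> y \<in> U)"
proof -
  have sub: "U \<subseteq> affine_points n" using openin_subset [OF assms(1)] pts_affine_space by metis
  have "closedin (zar (affine_space n)) (affine_points n - U)"
    using assms(1) by (metis closedin_diff closedin_topspace pts_affine_space)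
  then obtain f where "f \<in> PF n" "f x \<noteq> 0" "\<forall>y\<in>affine_points n - U. f y = 0"
    using not_in_closed_affine [of n "affine_points n - U" x] assms(2) sub by blast
  then show ?thesis by blast
qed

text \<open>A strictly descending chain provides functions \<open>f i\<close> that vanish on
  \<open>C (Suc i)\<close> but not at some \<open>x i\<close> in \<open>C i\<close>. By the basis
  theorem some \<open>f m\<close> is a combination of the earlier ones, all of which vanish at
  \<open>x m\<close>, a contradiction.\<close>

lemma noetherian_affine_space: "noetherian_space (zar (affine_space n :: (nat \<Rightarrow> 'k::field, 'k) fspace))"
proof (rule noetherian_spaceI)
  fix C :: "nat \<Rightarrow> (nat \<Rightarrow> 'k) set"
  assume C: "\<And>i. closedin (zar (affine_space n)) (C i)" and dec: "\<And>i. C (Suc i) \<subset> C i"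
  have "\<exists>f x. f \<in> PF n \<and> x \<in> C i \<and> f x \<noteq> 0 \<and> (\<forall>y\<in>C (Suc i). f y = 0)" for i
  proof -
    obtain x where x: "x \<in> C i" "x \<notin> C (Suc i)" using dec [of i] by blast
    then have "x \<in> affine_points n"
      using closedin_subset [OF C [of i]] pts_affine_space by blast
    then show ?thesis using not_in_closed_affine [OF C [of "Suc i"]] x by blast
  qed
  then have "\<exists>f x. \<forall>i. f i \<in> PF n \<and> x i \<in> C i \<and> f i (x i) \<noteq> 0 \<and> (\<forall>y\<in>C (Suc i). f i y = 0)"
    by metis
  then obtain f x where f: "\<And>i. f i \<in> PF n" "\<And>i. x i \<in> C i" "\<And>i. f i (x i) \<noteq> 0"
    "\<And>i y. y \<in> C (Suc i) \<Longrightarrow> f i y = 0" by blast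
  have "noeth (PF n :: ((nat \<Rightarrow> 'k) \<Rightarrow> 'k) set)"
    unfolding PF_def by (rule noeth_adjoin_list [OF subring_const_funs noeth_const_funs])
  then obtain m c where c: "f m = (\<Sum>i<m. c i * f i)"
    using noethD [of "PF n" f] f(1) by blast
  have "f i (x m) = 0" if "i < m" for i
  proof -
    have "C m \<subseteq> C (Suc i)"
      using \<open>i < m\<close> dec by (intro lift_Suc_antimono_le [of C "Suc i" m]) auto
    then show ?thesis using f(2,4) by blast
  qed
  then have "f m (x m) = 0" unfolding c by (simp add: sum_fun_apply)
  then show False using f(3) by blast
qed

section \<open>Restriction of polynomial functions to lines\<close>

lemma PF_line:
  fixes f :: "(nat \<Rightarrow> 'k::field) \<Rightarrow> 'k"
  assumes "f \<in> PF n"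
  shows "\<exists>P. \<forall>s. f (\<lambda>i. a i + s * (b i - a i)) = poly P s"
  using assms
proof (induction rule: PF_induct)
  case (const c)
  show ?case by (rule exI [of _ "[:c:]"]) simp
next
  case (coord i)
  show ?case by (rule exI [of _ "[:a i, b i - a i:]"]) (simp add: coord_def)
next
  case (diff f g)
  then obtain P Q where "\<forall>s. f (\<lambda>i. a i + s * (b i - a i)) = poly P s"
    "\<forall>s. g (\<lambda>i. a i + s * (b i - a i)) = poly Q s" by blast
  then show ?case by (intro exI [of _ "P - Q"]) simp
next
  case (mult f g)
  then obtain P Q where "\<forall>s. f (\<lambda>i. a i + s * (b i - a i)) = poly P s"
    "\<forall>s. g (\<lambda>i. a i + s * (b i - a i)) = poly Q s" by blast
  then show ?case by (intro exI [of _ "P * Q"]) simp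
qed

text \<open>On the line through \<open>a\<close> and \<open>b\<close>, with \<open>a\<close> at
  parameter \<open>0\<close> and \<open>b\<close> at parameter \<open>1\<close>, both functions
  become nonzero polynomials in one variable. Their product has a non-root because the field is
  infinite.\<close>

lemma PF_mult_nonzero:
  fixes f g :: "(nat \<Rightarrow> 'k::field_char_0) \<Rightarrow> 'k"
  assumes "f \<in> PF n" "g \<in> PF n" "a \<in> affine_points n" "b \<in> affine_points n" "f a \<noteq> 0" "g b \<noteq> 0"
  shows "\<exists>c\<in>affine_points n. f c * g c \<noteq> 0"
proof -
  obtain P Q where P: "\<forall>s. f (\<lambda>i. a i + s * (b i - a i)) = poly P s"
    and Q: "\<forall>s. g (\<lambda>i. a i + s * (b i - a i)) = poly Q s"
    using PF_line [OF assms(1)] PF_line [OF assms(2)] by metis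
  have "poly P 0 \<noteq> 0" "poly Q 1 \<noteq> 0" using P [rule_format, of 0] Q [rule_format, of 1] assms by auto
  then have "P * Q \<noteq> 0" by auto
  then obtain s where s: "poly (P * Q) s \<noteq> 0" using poly_all_0_iff_0 by blast
  let ?c = "\<lambda>i. a i + s * (b i - a i)"
  have "?c \<in> affine_points n" using assms(3,4) by (simp add: affine_points_def)
  moreover have "f ?c * g ?c \<noteq> 0" using s P Q by simp
  ultimately show ?thesis by blast
qed

lemma PF_prod_nonzero:
  fixes f :: "'i \<Rightarrow> (nat \<Rightarrow> 'k::field_char_0) \<Rightarrow> 'k"
  assumes "finite I" "\<And>i. i \<in> I \<Longrightarrow> f i \<in> PF n" "\<And>i. i \<in> I \<Longrightarrow> \<exists>a\<in>affine_points n. f i a \<noteq> 0"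
  shows "\<exists>a\<in>affine_points n. (\<Prod>i\<in>I. f i a) \<noteq> 0"
  using assms
proof (induction I)
  case empty
  have "(\<lambda>_. 0 :: 'k) \<in> affine_points n" by (simp add: affine_points_def)
  then show ?case by auto
next
  case (insert j I)
  obtain a where a: "a \<in> affine_points n" "f j a \<noteq> 0" using insert.prems by blast
  obtain b where b: "b \<in> affine_points n" "(\<Prod>i\<in>I. f i b) \<noteq> 0" using insert by auto
  have "(\<lambda>x. \<Prod>i\<in>I. f i x) \<in> PF n" using insert.prems by (intro PF_prod) auto
  then have "\<exists>c\<in>affine_points n. f j c * (\<Prod>i\<in>I. f i c) \<noteq> 0"
    using a b insert.prems by (intro PF_mult_nonzero) auto
  then show ?case using insert.hyps by simp
qed

lemma irreducible_vanishing_prime: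
  fixes V :: "(nat \<Rightarrow> 'k::field) set"
  assumes V: "irreducible_in (zar (affine_space n)) V"
  shows "prime_ideal_on (PF n) {f. \<forall>x\<in>V. f x = 0}"
  unfolding prime_ideal_on_def
proof (intro conjI ballI impI allI)
  obtain x where "x \<in> V" using irreducible_in_nonempty [OF V] by blast
  then show "1 \<notin> {f :: (nat \<Rightarrow> 'k) \<Rightarrow> 'k. \<forall>x\<in>V. f x = 0}" by auto
  fix a b :: "(nat \<Rightarrow> 'k) \<Rightarrow> 'k"
  assume ab: "a \<in> PF n" "b \<in> PF n" "a * b \<in> {f. \<forall>x\<in>V. f x = 0}"
  have "V \<subseteq> {x \<in> affine_points n. a x = 0} \<union> {x \<in> affine_points n. b x = 0}"
    using ab(3) irreducible_in_subset [OF V] by (auto simp: pts_affine_space)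
  then have "V \<subseteq> {x \<in> affine_points n. a x = 0} \<or> V \<subseteq> {x \<in> affine_points n. b x = 0}"
    by (intro irreducible_in_closedD [OF V] closedin_zeros1 ab)
  then show "a \<in> {f. \<forall>x\<in>V. f x = 0} \<or> b \<in> {f. \<forall>x\<in>V. f x = 0}" by blast
qed auto


subsection \<open>Dominant maps to affine space\<close>

definition tuple :: "nat \<Rightarrow> (nat \<Rightarrow> 'a \<Rightarrow> 'k::field) \<Rightarrow> 'a \<Rightarrow> nat \<Rightarrow> 'k" where
  "tuple d f x = (\<lambda>i. if i < d then f i x else 0)"

text \<open>Density of the image of \<open>V\<close> in affine \<open>d\<close>-space, equivalently
  algebraic independence of the \<open>f i\<close> on \<open>V\<close>. The conclusion refers to
  \<open>affine_points d\<close> because elements of \<open>PF d\<close> are functions on all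
  sequences.\<close>

definition dominant :: "nat \<Rightarrow> (nat \<Rightarrow> 'k::field) set \<Rightarrow> nat \<Rightarrow> (nat \<Rightarrow> (nat \<Rightarrow> 'k) \<Rightarrow> 'k) \<Rightarrow> bool" where
  "dominant n V d f \<longleftrightarrow> (\<forall>i<d. f i \<in> PF n) \<and>
     (\<forall>q\<in>PF d. (\<forall>x\<in>V. q (tuple d f x) = 0) \<longrightarrow> (\<forall>a\<in>affine_points d. q a = 0))"

lemma tuple_affine: "tuple d f x \<in> affine_points d"
  by (simp add: tuple_def affine_points_def)

lemma PF_tuple:
  assumes "\<And>i. i < d \<Longrightarrow> f i \<in> PF n" "q \<in> PF d"
  shows "(\<lambda>x. q (tuple d f x)) \<in> PF n"
  using assms(2)
  by (induction rule: PF_induct) (auto simp: coord_def tuple_def assms(1) intro: PF_const PF_diff PF_mult)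

lemma dominantD:
  "dominant n V d f \<Longrightarrow> q \<in> PF d \<Longrightarrow> (\<And>x. x \<in> V \<Longrightarrow> q (tuple d f x) = 0) \<Longrightarrow>
    a \<in> affine_points d \<Longrightarrow> q a = 0"
  by (simp add: dominant_def)

lemma dominant_mono: "dominant n V d f \<Longrightarrow> V \<subseteq> W \<Longrightarrow> dominant n W d f"
  unfolding dominant_def by (meson subsetD)

lemma dominant_zero:
  assumes "V \<noteq> {}" shows "dominant n V 0 f"
  unfolding dominant_def
proof (intro conjI ballI impI)
  fix q :: "(nat \<Rightarrow> 'a) \<Rightarrow> 'a" and a :: "nat \<Rightarrow> 'a"
  assume q: "q \<in> PF 0" "\<forall>x\<in>V. q (tuple 0 f x) = 0"
  obtain x where "x \<in> V" using assms by blast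
  then have "q (tuple 0 f x) = 0" using q by blast
  moreover have "q a = q (tuple 0 f x)" by (rule PF_cong_coord [OF q(1)]) simp
  ultimately show "q a = 0" by simp
qed simp

text \<open>Adding a function that vanishes on the smaller set raises the dimension of the target:
  a nontrivial relation could be divided by a power of the new variable
  and then restricted to the smaller set.\<close>

lemma dominant_extend:
  fixes W :: "(nat \<Rightarrow> 'k::field) set"
  assumes Z: "closedin (zar (affine_space n)) Z" and W: "irreducible_in (zar (affine_space n)) W"
    and ZW: "Z \<subset> W" and dom: "dominant n Z d f"
  shows "\<exists>g. dominant n W (Suc d) (f(d := g))"
proof -
  obtain x where x: "x \<in> W" "x \<notin> Z" using ZW by blast
  then have "x \<in> affine_points n" using irreducible_in_subset [OF W] pts_affine_space by blast
  then obtain g where g: "g \<in> PF n" "g x \<noteq> 0" "\<forall>y\<in>Z. g y = 0"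
    using not_in_closed_affine [OF Z] x by blast
  let ?f = "f(d := g)"
  define P where "P = {h :: (nat \<Rightarrow> 'k) \<Rightarrow> 'k. \<forall>x\<in>W. h x = 0}"
  have P: "prime_ideal_on (PF n) P"
    unfolding P_def by (rule irreducible_vanishing_prime [OF W])
  have f: "f i \<in> PF n" if "i < d" for i using dom that by (simp add: dominant_def)
  have "dominant n W (Suc d) ?f"
    unfolding dominant_def
  proof (intro conjI allI impI ballI)
    fix i show "?f i \<in> PF n" if "i < Suc d" using that f g by auto
  next
    fix q and a :: "nat \<Rightarrow> 'k" assume q: "q \<in> PF (Suc d)" "\<forall>x\<in>W. q (tuple (Suc d) ?f x) = 0" and a: "a \<in> affine_points (Suc d)"
    obtain p where p: "p \<in> polys (PF d)" "\<And>x. q x = (\<Sum>j\<le>degree p. coeff p j x * x d ^ j)"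
      using PF_SucE [OF q(1)] by blast
    have pPF: "coeff p j \<in> PF d" for j using p(1) by (rule coeff_polys)
    have q_eq: "q (tuple (Suc d) ?f x) = (\<Sum>j\<le>degree p. coeff p j (tuple d f x) * g x ^ j)" for x
    proof -
      have "coeff p j (tuple (Suc d) ?f x) = coeff p j (tuple d f x)" for j
        by (rule PF_cong_coord [OF pPF]) (simp add: tuple_def)
      then show ?thesis by (simp add: p(2) tuple_def)
    qed
    have zero: "coeff p j b = 0" if "b \<in> affine_points d" for j b
    proof (rule ccontr)
      assume "coeff p j b \<noteq> 0"
      then have ex: "\<exists>j. \<exists>b\<in>affine_points d. coeff p j b \<noteq> 0" using \<open>b \<in> affine_points d\<close> by blast
      define k where "k = (LEAST j. \<exists>b\<in>affine_points d. coeff p j b \<noteq> 0)"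
      have k: "\<exists>b\<in>affine_points d. coeff p k b \<noteq> 0"
        unfolding k_def by (rule LeastI_ex [OF ex])
      have less: "coeff p j b = 0" if "j < k" "b \<in> affine_points d" for j b
        using not_less_Least [of j "\<lambda>j. \<exists>b\<in>affine_points d. coeff p j b \<noteq> 0"] that unfolding k_def by blast
      have "k \<le> degree p"
      proof (rule ccontr)
        assume "\<not> k \<le> degree p"
        then have "coeff p k = 0" by (simp add: coeff_eq_0)
        then show False using k by simp
      qed
      \<comment> \<open>By the choice of \<open>k\<close> the relation becomes
        \<open>g ^ k * s\<close> on \<open>W\<close>. Since \<open>g\<close> is not in the prime
        ideal, \<open>s\<close> vanishes on \<open>W\<close>; on \<open>Z\<close>, where
        \<open>g\<close> is zero, only the term \<open>j = k\<close> of \<open>s\<close>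
        survives.\<close>
      define s where "s x = (\<Sum>j\<in>{k..degree p}. coeff p j (tuple d f x) * g x ^ (j - k))" for x
      have "(\<lambda>x. coeff p j (tuple d f x) * g x ^ (j - k)) \<in> PF n" for j
        by (intro PF_mult PF_power g PF_tuple f pPF)
      then have sPF: "s \<in> PF n" unfolding s_def by (intro PF_sum)
      have "q (tuple (Suc d) ?f x) = g x ^ k * s x" for x
      proof -
        have low: "coeff p j (tuple d f x) = 0" if "j < k" for j
          by (rule less [OF that tuple_affine])
        have "(\<Sum>j\<le>degree p. coeff p j (tuple d f x) * g x ^ j) =
            (\<Sum>j\<in>{k..degree p}. coeff p j (tuple d f x) * g x ^ j)"
          by (intro sum.mono_neutral_right) (auto simp: not_le low)
        also have "\<dots> = (\<Sum>j\<in>{k..degree p}. g x ^ k * (coeff p j (tuple d f x) * g x ^ (j - k)))"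
        proof (intro sum.cong refl)
          fix j assume "j \<in> {k..degree p}"
          then have "g x ^ j = g x ^ k * g x ^ (j - k)" by (simp flip: power_add)
          then show "coeff p j (tuple d f x) * g x ^ j = g x ^ k * (coeff p j (tuple d f x) * g x ^ (j - k))"
            by simp
        qed
        finally show ?thesis by (simp add: q_eq s_def sum_distrib_left)
      qed
      then have "g ^ k * s \<in> P"
        using q(2) by (simp add: P_def power_fun_apply)
      moreover have "g \<notin> P" using g x by (auto simp: P_def)
      then have "g ^ k \<notin> P" by (rule pideal_power [OF P subring_PF g(1)])
      ultimately have "s \<in> P"
        using pideal_prime [OF P subring_set_power [OF subring_PF g(1)] sPF] by blast
      then have s0: "s x = 0" if "x \<in> Z" for x using that ZW by (auto simp: P_def)
      have "coeff p k (tuple d f x) = 0" if "x \<in> Z" for x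
      proof -
        have "s x = (\<Sum>j\<in>{k..degree p}. if j = k then coeff p j (tuple d f x) else 0)"
          unfolding s_def using g(3) \<open>x \<in> Z\<close> by (intro sum.cong) auto
        also have "\<dots> = coeff p k (tuple d f x)" using \<open>k \<le> degree p\<close> by simp
        finally show ?thesis using s0 [OF \<open>x \<in> Z\<close>] by simp
      qed
      then have "\<forall>b\<in>affine_points d. coeff p k b = 0"
        using dom [unfolded dominant_def, THEN conjunct2, THEN bspec [OF _ pPF [of k]], THEN mp] by simp
      then show False using k by blast
    qed
    \<comment> \<open>The coefficients ignore coordinate \<open>d\<close>, so it may be reset to
      \<open>0\<close>, which moves \<open>a\<close> into \<open>affine_points d\<close>.\<close>
    have "coeff p j a = 0" for j
    proof -
      have "coeff p j a = coeff p j (a(d := 0))" by (rule PF_cong_coord [OF pPF]) simp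
      also have "a(d := 0) \<in> affine_points d" using a by (auto simp: affine_points_def)
      then have "coeff p j (a(d := 0)) = 0" by (rule zero)
      finally show ?thesis .
    qed
    then show "q a = 0" by (simp add: p(2))
  qed
  then show ?thesis by blast
qed

text \<open>Points correspond to homomorphisms to the field. A point \<open>a\<close> of the target
  is a homomorphism on the pulled-back coordinate ring \<open>A\<close>; the extension theorem
  continues it to the coordinate ring of \<open>V\<close> without killing \<open>v\<close>, and the
  result is evaluation at a preimage of \<open>a\<close>. The function \<open>q\<close> expresses
  the element \<open>u\<close> of that theorem in target coordinates.\<close>

lemma dominant_image:
  fixes V :: "(nat \<Rightarrow> 'k::{alg_closed_field, field_char_0}) set"
  assumes V: "closedin (zar (affine_space n)) V" "irreducible_in (zar (affine_space n)) V"
    and dom: "dominant n V d f" and v: "v \<in> PF n" "x0 \<in> V" "v x0 \<noteq> 0"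
  shows "\<exists>q\<in>PF d. (\<exists>a\<in>affine_points d. q a \<noteq> 0) \<and>
    (\<forall>a\<in>affine_points d. q a \<noteq> 0 \<longrightarrow> (\<exists>x\<in>V. v x \<noteq> 0 \<and> tuple d f x = a))"
proof -
  define P where "P = {h :: (nat \<Rightarrow> 'k) \<Rightarrow> 'k. \<forall>x\<in>V. h x = 0}"
  have P: "prime_ideal_on (PF n) P"
    unfolding P_def by (rule irreducible_vanishing_prime [OF V(2)])
  have f: "f i \<in> PF n" if "i < d" for i using dom that by (simp add: dominant_def)
  have dom': "q a = 0" if "q \<in> PF d" "\<forall>x\<in>V. q (tuple d f x) = 0" "a \<in> affine_points d" for q a
    using dom that unfolding dominant_def by blast
  define A where "A = (\<lambda>q x. q (tuple d f x)) ` PF d"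
  have A_PF: "A \<subseteq> PF n" unfolding A_def using PF_tuple f by blast
  have A_const: "const_funs \<subseteq> A"
    unfolding A_def const_funs_def using PF_const by force
  have A: "subring_set A"
    unfolding subring_set_def
  proof (intro conjI ballI)
    show "1 \<in> A" using A_const subring_set_1 [OF subring_const_funs] by blast
    fix a b assume "a \<in> A" "b \<in> A"
    then obtain p q where pq: "p \<in> PF d" "q \<in> PF d" "a = (\<lambda>x. p (tuple d f x))" "b = (\<lambda>x. q (tuple d f x))"
      by (auto simp: A_def)
    show "a - b \<in> A"
      unfolding A_def by (rule image_eqI [OF _ PF_diff [OF pq(1,2)]]) (auto simp: pq(3,4))
    show "a * b \<in> A"
      unfolding A_def by (rule image_eqI [OF _ PF_mult [OF pq(1,2)]]) (auto simp: pq(3,4))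
  qed
  let ?B = "adjoin_list A coord n"
  have B: "subring_set ?B" by (rule subring_set_adjoin_list [OF A])
  have "?B \<subseteq> PF n" by (intro adjoin_list_least subring_PF A_PF PF_coord)
  then have PB: "prime_ideal_on ?B P" by (rule prime_ideal_on_mono [OF P])
  have PF_B: "PF n \<subseteq> ?B"
    unfolding PF_def using A_const adjoin_list_superset [OF A] adjoin_list_generator [OF A]
    by (intro adjoin_list_least B) blast+
  have "v \<notin> P" using v by (auto simp: P_def)
  then obtain u where u: "u \<in> A - P" "\<forall>\<phi> :: ((nat \<Rightarrow> 'k) \<Rightarrow> 'k) \<Rightarrow> 'k.
    ring_hom_on A \<phi> \<and> (\<forall>a\<in>A \<inter> P. \<phi> a = 0) \<and> \<phi> u \<noteq> 0 \<longrightarrow>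
    (\<exists>\<psi>. ring_hom_on ?B \<psi> \<and> (\<forall>a\<in>A. \<psi> a = \<phi> a) \<and> (\<forall>b\<in>?B \<inter> P. \<psi> b = 0) \<and> \<psi> v \<noteq> 0)"
    using hom_extension [OF A PB, of v] v PF_B by auto
  obtain q where q: "q \<in> PF d" "u = (\<lambda>x. q (tuple d f x))" using u(1) by (auto simp: A_def)
  show ?thesis
  proof (intro bexI [OF _ q(1)] conjI ballI impI)
    obtain x where "x \<in> V" "u x \<noteq> 0" using u(1) by (auto simp: P_def)
    then have "q (tuple d f x) \<noteq> 0" using q(2) by simp
    then show "\<exists>a\<in>affine_points d. q a \<noteq> 0" by (rule bexI [OF _ tuple_affine])
  next
    fix a :: "nat \<Rightarrow> 'k" assume a: "a \<in> affine_points d" "q a \<noteq> 0"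
    \<comment> \<open>Evaluation at \<open>a\<close>, transported to \<open>A\<close>. A function in
      \<open>A\<close> may come from several polynomial functions on the target; dominance makes
      their values at \<open>a\<close> agree.\<close>
    define \<phi> where "\<phi> h = (SOME p. p \<in> PF d \<and> h = (\<lambda>x. p (tuple d f x))) a" for h
    have \<phi>: "\<phi> (\<lambda>x. p (tuple d f x)) = p a" if p: "p \<in> PF d" for p
    proof -
      define r where "r = (SOME r. r \<in> PF d \<and> (\<lambda>x. p (tuple d f x)) = (\<lambda>x. r (tuple d f x)))"
      have r: "r \<in> PF d \<and> (\<lambda>x. p (tuple d f x)) = (\<lambda>x. r (tuple d f x))"
        unfolding r_def by (rule someI [of _ p]) (simp add: p)
      have "r (tuple d f x) = p (tuple d f x)" for x
        using fun_cong [OF conjunct2 [OF r], of x] by simp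
      then have "r a - p a = 0"
        using r p a by (intro dom' [of "\<lambda>y. r y - p y"] PF_diff) auto
      then show ?thesis by (simp add: \<phi>_def r_def)
    qed
    have "ring_hom_on A \<phi>"
      unfolding ring_hom_on_def
    proof (intro conjI ballI)
      show "\<phi> 1 = 1" using \<phi> [OF PF_const [of 1]] by (simp add: one_fun_def)
      fix b c assume "b \<in> A" "c \<in> A"
      then obtain p r where pr: "p \<in> PF d" "r \<in> PF d" "b = (\<lambda>x. p (tuple d f x))" "c = (\<lambda>x. r (tuple d f x))"
        by (auto simp: A_def)
      show "\<phi> (b + c) = \<phi> b + \<phi> c" "\<phi> (b * c) = \<phi> b * \<phi> c"
        using \<phi> [OF PF_add [OF pr(1,2)]] \<phi> [OF PF_mult [OF pr(1,2)]] \<phi> [OF pr(1)] \<phi> [OF pr(2)]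
        by (simp_all add: pr(3,4) plus_fun_def times_fun_def)
    qed
    moreover have "\<forall>b\<in>A \<inter> P. \<phi> b = 0"
    proof
      fix b assume b: "b \<in> A \<inter> P"
      then obtain p where p: "p \<in> PF d" "b = (\<lambda>x. p (tuple d f x))" by (auto simp: A_def)
      then have "p a = 0" using b a(1) by (intro dom') (auto simp: P_def)
      then show "\<phi> b = 0" using \<phi> [OF p(1)] p(2) by simp
    qed
    moreover have "\<phi> u \<noteq> 0" using \<phi> [OF q(1)] q(2) a(2) by simp
    ultimately obtain \<psi> where \<psi>: "ring_hom_on ?B \<psi>" "\<forall>b\<in>A. \<psi> b = \<phi> b" "\<forall>b\<in>?B \<inter> P. \<psi> b = 0" "\<psi> v \<noteq> 0"
      using u(2) by blast
    \<comment> \<open>The extended homomorphism is evaluation at the point whose coordinates are its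
      values on the coordinate functions; killing \<open>P\<close> places this point on
      \<open>V\<close>.\<close>
    define x where "x i = (if i < n then \<psi> (coord i) else 0)" for i
    have x: "x \<in> affine_points n" by (simp add: x_def affine_points_def)
    \<comment> \<open>Membership in \<open>PF n\<close> is carried through the induction because
      \<open>\<psi>\<close> respects the operations only on \<open>?B\<close>.\<close>
    have \<psi>_eval: "h \<in> PF n \<and> \<psi> h = h x" if "h \<in> PF n" for h
      using that
    proof (induction rule: PF_induct)
      case (const c)
      have "(\<lambda>_. c) \<in> A" using A_const const_funsI by blast
      then show ?case using \<psi>(2) \<phi> [OF PF_const [of c]] PF_const [of c] by simp
    next
      case (coord i)
      have "coord i x = \<psi> (coord i)" using coord by (simp add: coord_def [of i x] x_def [of i])
      then show ?case using PF_coord [OF coord] by simp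
    next
      case (diff h k)
      then show ?case
        using ring_hom_on_diff [OF B \<psi>(1), of h k] PF_B PF_diff by (auto simp: fun_diff_def)
    next
      case (mult h k)
      then have "\<psi> (h * k) = \<psi> h * \<psi> k" using \<psi>(1) PF_B unfolding ring_hom_on_def by blast
      then show ?case using mult PF_mult by (auto simp: times_fun_def)
    qed
    have "x \<in> V"
    proof (rule ccontr)
      assume "x \<notin> V"
      then obtain h where h: "h \<in> PF n" "h x \<noteq> 0" "\<forall>y\<in>V. h y = 0"
        using not_in_closed_affine [OF V(1) x] by blast
      then have "\<psi> h = 0" using \<psi>(3) PF_B by (auto simp: P_def)
      then show False using \<psi>_eval h by auto
    qed
    moreover have "v x \<noteq> 0" using \<psi>_eval [OF v(1)] \<psi>(4) by simp
    moreover have "tuple d f x = a"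
    proof
      fix i show "tuple d f x i = a i"
      proof (cases "i < d")
        case True
        have "(\<lambda>y. coord i (tuple d f y)) = f i" using True by (auto simp: coord_def tuple_def)
        then have "\<phi> (f i) = a i" "f i \<in> A"
          using \<phi> [OF PF_coord [OF True]] imageI [OF PF_coord [OF True], of "\<lambda>q x. q (tuple d f x)"]
          by (auto simp: coord_def A_def)
        then show ?thesis using True \<psi>(2) \<psi>_eval [OF f [OF True]] by (simp add: tuple_def)
      next
        case False
        then show ?thesis using a(1) by (simp add: tuple_def affine_points_def)
      qed
    qed
    ultimately show "\<exists>x\<in>V. v x \<noteq> 0 \<and> tuple d f x = a" by blast
  qed
qed

text \<open>Cutting with a hyperplane in the target lowers the dimension by at most one, and some component
  of the section that meets \<open>U\<close> still dominates.\<close>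

lemma dominant_chain:
  fixes V :: "(nat \<Rightarrow> 'k::{alg_closed_field, field_char_0}) set"
  assumes "closedin (zar (affine_space n)) V" "irreducible_in (zar (affine_space n)) V"
    and "dominant n V d f" and "openin (zar (affine_space n)) U" "V \<inter> U \<noteq> {}"
  shows "\<exists>Z. irr_chain (zar (affine_space n)) d Z \<and> Z d = V \<and> Z 0 \<inter> U \<noteq> {}"
  using assms
proof (induction d arbitrary: V)
  case 0
  then show ?case by (intro exI [of _ "\<lambda>_. V"]) (auto simp: irr_chain_def)
next
  case (Suc d)
  note V = Suc.prems(1,2) and dom = Suc.prems(3) and U = Suc.prems(4,5)
  have f: "f i \<in> PF n" if "i < Suc d" for i using dom that by (simp add: dominant_def)
  obtain x0 where x0: "x0 \<in> V" "x0 \<in> U" using U(2) by blast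
  obtain v where v: "v \<in> PF n" "v x0 \<noteq> 0" "\<forall>y\<in>affine_points n. v y \<noteq> 0 \<longrightarrow> y \<in> U"
    using basic_open_affine [OF U(1) x0(2)] by blast
  obtain q a where q: "q \<in> PF (Suc d)" and a: "a \<in> affine_points (Suc d)" "q a \<noteq> 0"
    and lift: "\<And>b. b \<in> affine_points (Suc d) \<Longrightarrow> q b \<noteq> 0 \<Longrightarrow> \<exists>x\<in>V. v x \<noteq> 0 \<and> tuple (Suc d) f x = b"
    using dominant_image [OF V dom v(1) x0(1) v(2)] by blast
  \<comment> \<open>The hyperplane passes through the point \<open>a\<close> with
    \<open>q a \<noteq> 0\<close>, so \<open>q\<close> does not vanish identically on it and points
    of the hyperplane can still be lifted.\<close>
  define c where "c = a d"
  define W where "W = V \<inter> {x \<in> affine_points n. f d x - c = 0}"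
  have "(\<lambda>x. f d x - c) \<in> PF n" using f [of d] by (intro PF_diff PF_const) simp
  then have "closedin (zar (affine_space n)) W"
    unfolding W_def by (intro closedin_Int V closedin_zeros1)
  then obtain F where F: "finite F" "W = \<Union>F"
    "\<And>Z. Z \<in> F \<Longrightarrow> closedin (zar (affine_space n)) Z \<and> irreducible_in (zar (affine_space n)) Z"
    using noetherian_closed_Union_irreducible [OF noetherian_affine_space] by metis
  have "\<exists>Z\<in>F. Z \<inter> U \<noteq> {} \<and> dominant n Z d f"
  proof (rule ccontr)
    \<comment> \<open>Otherwise every component meeting \<open>U\<close> carries a relation
      \<open>p Z\<close>. A point \<open>e\<close> where \<open>q'\<close> and all these relations
      are nonzero lifts to a point of \<open>W\<close> in \<open>U\<close>; this point lies on one
      of the components, whose relation must vanish at \<open>e\<close>.\<close>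
    assume no: "\<not> (\<exists>Z\<in>F. Z \<inter> U \<noteq> {} \<and> dominant n Z d f)"
    let ?F = "{Z \<in> F. Z \<inter> U \<noteq> {}}"
    have ex: "\<forall>Z\<in>?F. \<exists>p. p \<in> PF d \<and> (\<forall>x\<in>Z. p (tuple d f x) = 0) \<and> (\<exists>b\<in>affine_points d. p b \<noteq> 0)"
    proof
      fix Z assume "Z \<in> ?F"
      then have "\<not> dominant n Z d f" using no by blast
      then show "\<exists>p. p \<in> PF d \<and> (\<forall>x\<in>Z. p (tuple d f x) = 0) \<and> (\<exists>b\<in>affine_points d. p b \<noteq> 0)"
        unfolding dominant_def using f by auto
    qed
    from bchoice [OF ex] obtain p where p': "\<forall>Z\<in>?F. p Z \<in> PF d \<and> (\<forall>x\<in>Z. p Z (tuple d f x) = 0) \<and>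
      (\<exists>b\<in>affine_points d. p Z b \<noteq> 0)"
      by (rule exE)
    have p: "\<And>Z. Z \<in> ?F \<Longrightarrow> p Z \<in> PF d" "\<And>Z x. Z \<in> ?F \<Longrightarrow> x \<in> Z \<Longrightarrow> p Z (tuple d f x) = 0"
      "\<And>Z. Z \<in> ?F \<Longrightarrow> \<exists>b\<in>affine_points d. p Z b \<noteq> 0"
      using p' by simp_all
    define q' where "q' b = q (b(d := c))" for b
    have "q' \<in> PF d"
    proof -
      obtain r where r: "r \<in> polys (PF d)" "\<And>x. q x = (\<Sum>j\<le>degree r. coeff r j x * x d ^ j)"
        using PF_SucE [OF q] by blast
      have rPF: "coeff r j \<in> PF d" for j using r(1) by (rule coeff_polys)
      have "coeff r j (b(d := c)) = coeff r j b" for j b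
        by (rule PF_cong_coord [OF rPF]) simp
      then have "q' = (\<lambda>b. \<Sum>j\<le>degree r. coeff r j b * c ^ j)"
        by (auto simp: q'_def r(2))
      then show ?thesis using PF_sum [of "{..degree r}" "\<lambda>j b. coeff r j b * c ^ j" d]
          PF_mult [OF rPF PF_const] by simp
    qed
    moreover have "a(d := 0) \<in> affine_points d" using a by (auto simp: affine_points_def)
    moreover have "q' (a(d := 0)) \<noteq> 0" using a by (simp add: q'_def c_def)
    moreover obtain b where "b \<in> affine_points d" "(\<Prod>Z\<in>?F. p Z b) \<noteq> 0"
      using PF_prod_nonzero [of ?F p d] F(1) p(1,3) by auto
    moreover have "(\<lambda>b. \<Prod>Z\<in>?F. p Z b) \<in> PF d" using p(1) by (rule PF_prod)
    ultimately obtain e where e: "e \<in> affine_points d" "q' e * (\<Prod>Z\<in>?F. p Z e) \<noteq> 0"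
      using PF_mult_nonzero [of q' d "\<lambda>b. \<Prod>Z\<in>?F. p Z b"] by blast
    have e': "e(d := c) \<in> affine_points (Suc d)" using e(1) by (auto simp: affine_points_def)
    obtain x where x: "x \<in> V" "v x \<noteq> 0" "tuple (Suc d) f x = e(d := c)"
      using lift [OF e'] e(2) by (auto simp: q'_def)
    have xn: "x \<in> affine_points n"
      using x(1) closedin_subset [OF V(1)] pts_affine_space by blast
    have "f d x = c" using fun_cong [OF x(3), of d] by (simp add: tuple_def)
    then have "x \<in> W" using x(1) xn by (simp add: W_def)
    then obtain Z where Z: "Z \<in> F" "x \<in> Z" using F(2) by blast
    have "x \<in> U" using v(3) xn x(2) by blast
    then have ZF: "Z \<in> ?F" using Z by blast
    have "tuple d f x = e"
    proof
      fix i show "tuple d f x i = e i"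
        using fun_cong [OF x(3), of i] e(1) by (auto simp: tuple_def affine_points_def split: if_splits)
    qed
    then have "p Z e = 0" using p(2) [OF ZF Z(2)] by simp
    then have "(\<Prod>Z\<in>?F. p Z e) = 0" using ZF F(1) by (intro prod_zero) auto
    then show False using e(2) by simp
  qed
  then obtain Z where Z: "Z \<in> F" "Z \<inter> U \<noteq> {}" "dominant n Z d f" by blast
  then have Zc: "closedin (zar (affine_space n)) Z" "irreducible_in (zar (affine_space n)) Z" using F(3) by auto
  obtain Y where Y: "irr_chain (zar (affine_space n)) d Y" "Y d = Z" "Y 0 \<inter> U \<noteq> {}"
    using Suc.IH [OF Zc Z(3) U(1) Z(2)] by blast
  have "Z \<subseteq> W" using Z(1) F(2) by blast
  \<comment> \<open>Otherwise the last target coordinate would be constantly \<open>c\<close>; a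
    point with last coordinate \<open>c + 1\<close> contradicts dominance.\<close>
  moreover have "\<not> V \<subseteq> W"
  proof
    assume "V \<subseteq> W"
    then have "\<forall>x\<in>V. f d x - c = 0" by (auto simp: W_def)
    then have *: "coord d (tuple (Suc d) f x) - c = 0" if "x \<in> V" for x
      using that by (simp add: coord_def tuple_def)
    have "(\<lambda>y. coord d y - c) \<in> PF (Suc d)" by (intro PF_diff PF_coord PF_const) simp
    moreover have "(\<lambda>_. 0)(d := c + 1) \<in> affine_points (Suc d)" by (auto simp: affine_points_def)
    ultimately have "coord d ((\<lambda>_. 0)(d := c + 1)) - c = 0"
      using dominantD [OF dom, of "\<lambda>y. coord d y - c"] * by blast
    then show False by (simp add: coord_def)
  qed
  ultimately have "Z \<subset> V" by (auto simp: W_def)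
  then have "irr_chain (zar (affine_space n)) (Suc d) (\<lambda>i. if i \<le> d then Y i else V)"
    using Y V by (auto simp: irr_chain_def le_Suc_eq less_Suc_eq)
  then show ?case using Y by (intro exI [of _ "\<lambda>i. if i \<le> d then Y i else V"]) auto
qed

text \<open>The given chain may avoid \<open>U\<close> entirely. Only its length enters: it yields a
  dominant map from \<open>V\<close> to affine space of that dimension, from which a new chain of
  the same length meeting \<open>U\<close> is cut out.\<close>

lemma krull_dim_affine_open:
  fixes V :: "(nat \<Rightarrow> 'k::{alg_closed_field, field_char_0}) set"
  assumes V: "closedin (zar (affine_space n)) V" "irreducible_in (zar (affine_space n)) V"
    and U: "openin (zar (affine_space n)) U" "V \<inter> U \<noteq> {}"
  shows "krull_dim (subtopology (zar (affine_space n)) V) \<le>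
    krull_dim (subtopology (zar (affine_space n)) (V \<inter> U))"
proof (rule krull_dim_le)
  let ?T = "zar (affine_space n) :: (nat \<Rightarrow> 'k) topology"
  fix m Z assume "irr_chain (subtopology ?T V) m Z"
  then have Z: "irr_chain ?T m Z" "Z m \<subseteq> V" using V(1) by (auto simp: irr_chain_closed_subspace)
  have "\<exists>f. dominant n (Z j) j f" if "j \<le> m" for j
    using that
  proof (induction j)
    case 0
    have "Z 0 \<noteq> {}" using Z(1) irreducible_in_nonempty unfolding irr_chain_def by blast
    then show ?case using dominant_zero by blast
  next
    case (Suc j)
    then obtain f where "dominant n (Z j) j f" by auto
    then show ?case
      using Suc.prems Z(1) dominant_extend [of n "Z j" "Z (Suc j)" j f] unfolding irr_chain_def by auto
  qed
  then obtain f where "dominant n (Z m) m f" by blast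
  then have "dominant n V m f" using Z(2) by (rule dominant_mono)
  then obtain Y where Y: "irr_chain ?T m Y" "Y m = V" "Y 0 \<inter> U \<noteq> {}"
    using dominant_chain [OF V _ U] by blast
  have YV: "irr_chain (subtopology ?T V) m Y" using Y V(1) by (simp add: irr_chain_closed_subspace)
  have "Y 0 \<subseteq> V" using irr_chain_mono [OF Y(1), of 0 m] Y(2) by simp
  then have "irr_chain (subtopology (subtopology ?T V) (V \<inter> U)) m (\<lambda>i. Y i \<inter> (V \<inter> U))"
    using Y(3) U(1) by (intro irr_chain_Int_open [OF YV]) (auto simp: openin_subtopology)
  then have "irr_chain (subtopology ?T (V \<inter> U)) m (\<lambda>i. Y i \<inter> (V \<inter> U))"
    by (simp add: subtopology_subtopology inf.assoc [symmetric])
  then show "enat m \<le> krull_dim (subtopology ?T (V \<inter> U))" by (rule krull_dim_ge)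
qed


section \<open>Prevarieties\<close>

subsection \<open>Morphisms and subspaces\<close>

lemma zar_sub: "zar (sub X Z) = subtopology (zar X) Z"
  by (simp add: sub_def)

lemma pts_sub: "pts (sub X Z) = pts X \<inter> Z"
  by (simp add: sub_def)

lemma reg_sub_iff: "f \<in> reg (sub X Z) U \<longleftrightarrow>
    (\<forall>x\<in>U. \<exists>V h. openin (zar X) V \<and> x \<in> V \<and> h \<in> reg X V \<and> (\<forall>y\<in>U \<inter> V. f y = h y))"
  by (simp add: sub_def)

lemma function_sheaf_iff:
  "function_sheaf X \<Longrightarrow> openin (zar X) U \<Longrightarrow> f \<in> reg X U \<longleftrightarrow>
    (\<forall>x\<in>U. \<exists>V h. openin (zar X) V \<and> x \<in> V \<and> h \<in> reg X V \<and> (\<forall>y\<in>U \<inter> V. f y = h y))"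
  unfolding function_sheaf_def by simp

lemma reg_restrict:
  assumes "function_sheaf X" "openin (zar X) U" "openin (zar X) V" "U \<subseteq> V" "h \<in> reg X V"
    and "\<And>y. y \<in> U \<Longrightarrow> f y = h y"
  shows "f \<in> reg X U"
  unfolding function_sheaf_iff [OF assms(1,2)]
  using assms by (intro ballI exI [of _ V] exI [of _ h]) auto

lemma function_sheaf_sub:
  assumes X: "function_sheaf X" shows "function_sheaf (sub X Z)"
  unfolding function_sheaf_def
proof (intro allI impI iffI ballI)
  fix U f x assume "openin (zar (sub X Z)) U" "f \<in> reg (sub X Z) U" "x \<in> U"
  then show "\<exists>V h. openin (zar (sub X Z)) V \<and> x \<in> V \<and> h \<in> reg (sub X Z) V \<and> (\<forall>y\<in>U \<inter> V. f y = h y)"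
    by (intro exI [of _ U] exI [of _ f]) auto
next
  fix U f assume U: "openin (zar (sub X Z)) U"
    and loc: "\<forall>x\<in>U. \<exists>V h. openin (zar (sub X Z)) V \<and> x \<in> V \<and> h \<in> reg (sub X Z) V \<and> (\<forall>y\<in>U \<inter> V. f y = h y)"
  show "f \<in> reg (sub X Z) U"
    unfolding reg_sub_iff
  proof
    fix x assume x: "x \<in> U"
    then obtain V h where V: "openin (zar (sub X Z)) V" "x \<in> V" "h \<in> reg (sub X Z) V" "\<forall>y\<in>U \<inter> V. f y = h y"
      using loc by blast
    obtain V0 where V0: "openin (zar X) V0" "V = V0 \<inter> Z"
      using V(1) by (auto simp: zar_sub openin_subtopology)
    obtain V' h' where V': "openin (zar X) V'" "x \<in> V'" "h' \<in> reg X V'" "\<forall>y\<in>V \<inter> V'. h y = h' y"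
      using V(2,3) by (auto simp: reg_sub_iff)
    have "U \<subseteq> Z" using U openin_subset by (fastforce simp: zar_sub)
    have op: "openin (zar X) (V0 \<inter> V')" using V0 V' by auto
    moreover have "h' \<in> reg X (V0 \<inter> V')"
      by (rule reg_restrict [OF X op V'(1) _ V'(3)]) auto
    moreover have "\<forall>y\<in>U \<inter> (V0 \<inter> V'). f y = h' y"
      using V(4) V'(4) V0(2) \<open>U \<subseteq> Z\<close> by auto
    ultimately show "\<exists>V h. openin (zar X) V \<and> x \<in> V \<and> h \<in> reg X V \<and> (\<forall>y\<in>U \<inter> V. f y = h y)"
      using V(2) V0(2) V'(2) by blast
  qed
qed

lemma morphism_continuous: "morphism X Y f \<Longrightarrow> continuous_map (zar X) (zar Y) f"
  by (simp add: morphism_def)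

lemma morphism_pullback:
  "morphism X Y f \<Longrightarrow> openin (zar Y) V \<Longrightarrow> h \<in> reg Y V \<Longrightarrow> (\<lambda>x. h (f x)) \<in> reg X {x \<in> pts X. f x \<in> V}"
  by (simp add: morphism_def)

lemma morphism_into: "morphism X Y f \<Longrightarrow> x \<in> pts X \<Longrightarrow> f x \<in> pts Y"
  using morphism_continuous by (fastforce simp: continuous_map_def)

lemma morphism_compose:
  assumes f: "morphism X Y f" and g: "morphism Y W g"
  shows "morphism X W (\<lambda>x. g (f x))"
  unfolding morphism_def
proof (intro conjI allI impI)
  show "continuous_map (zar X) (zar W) (\<lambda>x. g (f x))"
    using continuous_map_compose [OF morphism_continuous [OF f] morphism_continuous [OF g]]
    by (simp add: o_def)
  fix V h assume V: "openin (zar W) V \<and> h \<in> reg W V"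
  have "openin (zar Y) {y \<in> pts Y. g y \<in> V}"
    using V morphism_continuous [OF g] by (simp add: continuous_map_def)
  moreover have "(\<lambda>y. h (g y)) \<in> reg Y {y \<in> pts Y. g y \<in> V}"
    using V by (intro morphism_pullback [OF g]) auto
  ultimately have "(\<lambda>x. h (g (f x))) \<in> reg X {x \<in> pts X. f x \<in> {y \<in> pts Y. g y \<in> V}}"
    by (rule morphism_pullback [OF f])
  moreover have "{x \<in> pts X. f x \<in> {y \<in> pts Y. g y \<in> V}} = {x \<in> pts X. g (f x) \<in> V}"
    using morphism_into [OF f] by blast
  ultimately show "(\<lambda>x. h (g (f x))) \<in> reg X {x \<in> pts X. g (f x) \<in> V}" by simp
qed

lemma morphism_cong:
  assumes X: "function_sheaf X" and f: "morphism X Y f" and eq: "\<And>x. x \<in> pts X \<Longrightarrow> f x = g x"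
  shows "morphism X Y g"
  unfolding morphism_def
proof (intro conjI allI impI)
  show "continuous_map (zar X) (zar Y) g"
    by (rule continuous_map_eq [OF morphism_continuous [OF f]]) (rule eq)
  fix V h assume V: "openin (zar Y) V \<and> h \<in> reg Y V"
  have "{x \<in> pts X. g x \<in> V} = {x \<in> pts X. f x \<in> V}" using eq by auto
  moreover have op: "openin (zar X) {x \<in> pts X. f x \<in> V}"
    using V morphism_continuous [OF f] by (simp add: continuous_map_def)
  moreover have "(\<lambda>x. h (g x)) \<in> reg X {x \<in> pts X. f x \<in> V}"
    by (rule reg_restrict [OF X op op order_refl morphism_pullback [OF f]]) (use V eq in auto)
  ultimately show "(\<lambda>x. h (g x)) \<in> reg X {x \<in> pts X. g x \<in> V}" by simp
qed

lemma morphism_inclusion: "morphism (sub X A) X (\<lambda>x. x)"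
  unfolding morphism_def
proof (intro conjI allI impI)
  show "continuous_map (zar (sub X A)) (zar X) (\<lambda>x. x)"
    by (simp add: zar_sub continuous_map_from_subtopology)
  fix V h assume V: "openin (zar X) V \<and> h \<in> reg X V"
  then show "(\<lambda>x. h x) \<in> reg (sub X A) {x \<in> pts (sub X A). x \<in> V}"
    unfolding reg_sub_iff by blast
qed

lemma morphism_restrict: "morphism X Y f \<Longrightarrow> morphism (sub X A) Y f"
  using morphism_compose [OF morphism_inclusion] by blast

lemma morphism_into_sub:
  assumes X: "function_sheaf X" and f: "morphism X Y f" and B: "\<And>x. x \<in> pts X \<Longrightarrow> f x \<in> B"
  shows "morphism X (sub Y B) f"
  unfolding morphism_def
proof (intro conjI allI impI)
  show "continuous_map (zar X) (zar (sub Y B)) f"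
    using morphism_continuous [OF f] B by (auto simp: zar_sub continuous_map_in_subtopology)
  fix V h assume V: "openin (zar (sub Y B)) V \<and> h \<in> reg (sub Y B) V"
  then obtain V0 where V0: "openin (zar Y) V0" "V = V0 \<inter> B"
    by (auto simp: zar_sub openin_subtopology)
  have eq: "{x \<in> pts X. f x \<in> V} = {x \<in> pts X. f x \<in> V0}" using V0(2) B by auto
  have pre: "openin (zar X) {x \<in> pts X. f x \<in> W}" if "openin (zar Y) W" for W
    using that morphism_continuous [OF f] by (simp add: continuous_map_def)
  have op: "openin (zar X) {x \<in> pts X. f x \<in> V}" unfolding eq by (rule pre [OF V0(1)])
  show "(\<lambda>x. h (f x)) \<in> reg X {x \<in> pts X. f x \<in> V}"
    unfolding function_sheaf_iff [OF X op]
  proof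
    fix x assume x: "x \<in> {x \<in> pts X. f x \<in> V}"
    then obtain V' h' where V': "openin (zar Y) V'" "f x \<in> V'" "h' \<in> reg Y V'" "\<forall>y\<in>V \<inter> V'. h y = h' y"
      using V by (auto simp: reg_sub_iff)
    show "\<exists>U k. openin (zar X) U \<and> x \<in> U \<and> k \<in> reg X U \<and> (\<forall>y\<in>{x \<in> pts X. f x \<in> V} \<inter> U. h (f y) = k y)"
      using x V' pre [OF V'(1)] morphism_pullback [OF f V'(1,3)]
      by (intro exI [of _ "{x \<in> pts X. f x \<in> V'}"] exI [of _ "\<lambda>x. h' (f x)"]) auto
  qed
qed

lemma morphism_out_sub: "morphism X (sub Y B) f \<Longrightarrow> morphism X Y f"
  using morphism_compose [OF _ morphism_inclusion] by blast

lemma morphism_sub_mono: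
  assumes X: "function_sheaf X" and f: "morphism (sub X A) Y f" and "A' \<subseteq> A"
  shows "morphism (sub X A') Y f"
proof -
  have "morphism (sub X A') (sub X A) (\<lambda>x. x)"
    by (rule morphism_into_sub [OF function_sheaf_sub [OF X] morphism_inclusion])
      (use \<open>A' \<subseteq> A\<close> in \<open>auto simp: pts_sub\<close>)
  then show ?thesis using f by (rule morphism_compose)
qed

text \<open>The two induced structures on \<open>A\<close> are compared through the identity map, a
  morphism in both directions, and not as records.\<close>

lemma morphism_sub_sub:
  assumes X: "function_sheaf X" and f: "morphism (sub X A) Y f" and "A \<subseteq> Z"
  shows "morphism (sub (sub X Z) A) Y f"
proof -
  have "morphism (sub (sub X Z) A) X (\<lambda>x. x)"
    by (rule morphism_restrict [OF morphism_inclusion])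
  then have "morphism (sub (sub X Z) A) (sub X A) (\<lambda>x. x)"
    by (rule morphism_into_sub [OF function_sheaf_sub [OF function_sheaf_sub [OF X]]])
      (simp add: pts_sub)
  then show ?thesis using f by (rule morphism_compose)
qed

lemma morphism_sub_sub':
  assumes X: "function_sheaf X" and f: "morphism (sub (sub X Z) A) Y f" and "A \<subseteq> Z"
  shows "morphism (sub X A) Y f"
proof -
  have "morphism (sub X A) (sub X Z) (\<lambda>x. x)"
    by (rule morphism_into_sub [OF function_sheaf_sub [OF X] morphism_inclusion])
      (use \<open>A \<subseteq> Z\<close> in \<open>auto simp: pts_sub\<close>)
  then have "morphism (sub X A) (sub (sub X Z) A) (\<lambda>x. x)"
    by (rule morphism_into_sub [OF function_sheaf_sub [OF X]]) (simp add: pts_sub)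
  then show ?thesis using f by (rule morphism_compose)
qed

lemma morphism_sub_local:
  assumes X: "function_sheaf X" and A: "A \<subseteq> pts X"
    and loc: "\<And>x. x \<in> A \<Longrightarrow> \<exists>W. openin (zar X) W \<and> x \<in> W \<and> W \<subseteq> A \<and> morphism (sub X W) Y f"
  shows "morphism (sub X A) Y f"
  unfolding morphism_def
proof (intro conjI allI impI)
  have "openin (subtopology (zar X) A) {x \<in> pts X \<inter> A. f x \<in> V}" if V: "openin (zar Y) V" for V
  proof (subst openin_subopen, intro ballI)
    fix x assume x: "x \<in> {x \<in> pts X \<inter> A. f x \<in> V}"
    then obtain W where W: "openin (zar X) W" "x \<in> W" "W \<subseteq> A" "morphism (sub X W) Y f" using loc by blast
    have "openin (zar (sub X W)) {y \<in> pts (sub X W). f y \<in> V}"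
      using morphism_continuous [OF W(4)] V by (simp add: continuous_map_def)
    then have "openin (zar X) {y \<in> pts (sub X W). f y \<in> V}"
      using W(1) by (simp add: zar_sub openin_open_subtopology)
    then have "openin (subtopology (zar X) A) {y \<in> pts (sub X W). f y \<in> V}"
      using W(3) by (auto simp: openin_subtopology pts_sub)
    then show "\<exists>T. openin (subtopology (zar X) A) T \<and> x \<in> T \<and> T \<subseteq> {x \<in> pts X \<inter> A. f x \<in> V}"
      using x W(2,3) by (intro exI [of _ "{y \<in> pts (sub X W). f y \<in> V}"]) (auto simp: pts_sub)
  qed
  moreover have "f x \<in> pts Y" if "x \<in> A" for x
  proof -
    obtain W where W: "x \<in> W" "morphism (sub X W) Y f" using loc [OF \<open>x \<in> A\<close>] by blast
    then show ?thesis using morphism_into [OF W(2), of x] that A by (auto simp: pts_sub)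
  qed
  ultimately show "continuous_map (zar (sub X A)) (zar Y) f"
    by (simp add: continuous_map_def zar_sub Pi_iff)
  fix V h assume V: "openin (zar Y) V \<and> h \<in> reg Y V"
  show "(\<lambda>x. h (f x)) \<in> reg (sub X A) {x \<in> pts (sub X A). f x \<in> V}"
    unfolding reg_sub_iff
  proof
    fix x assume x: "x \<in> {x \<in> pts (sub X A). f x \<in> V}"
    then obtain W where W: "openin (zar X) W" "x \<in> W" "W \<subseteq> A" "morphism (sub X W) Y f"
      using loc by (auto simp: pts_sub)
    have "(\<lambda>x. h (f x)) \<in> reg (sub X W) {x \<in> pts (sub X W). f x \<in> V}"
      using V by (intro morphism_pullback [OF W(4)]) auto
    then obtain V' h' where V': "openin (zar X) V'" "x \<in> V'" "h' \<in> reg X V'"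
      "\<forall>y\<in>{x \<in> pts (sub X W). f x \<in> V} \<inter> V'. h (f y) = h' y"
      using x W(2) unfolding reg_sub_iff by (auto simp: pts_sub)
    have op: "openin (zar X) (W \<inter> V')" using W V' by auto
    have "h' \<in> reg X (W \<inter> V')" by (rule reg_restrict [OF X op V'(1) _ V'(3)]) auto
    then show "\<exists>U k. openin (zar X) U \<and> x \<in> U \<and> k \<in> reg X U \<and>
        (\<forall>y\<in>{x \<in> pts (sub X A). f x \<in> V} \<inter> U. h (f y) = k y)"
      using op V'(2,4) W(2) by (intro exI [of _ "W \<inter> V'"] exI [of _ h']) (auto simp: pts_sub)
  qed
qed


subsection \<open>Isomorphisms between subsets\<close>

text \<open>An isomorphism between the subsets \<open>A\<close> and \<open>B\<close> with an
  explicit inverse. Since both maps are total and have the ambient spaces as targets, inversion,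
  restriction and composition need neither \<open>inv_into\<close> nor nested subspaces.\<close>

definition biso :: "('a, 'k) fspace \<Rightarrow> ('b, 'k) fspace \<Rightarrow> 'a set \<Rightarrow> 'b set \<Rightarrow> ('a \<Rightarrow> 'b) \<Rightarrow> ('b \<Rightarrow> 'a) \<Rightarrow> bool" where
  "biso X Y A B f g \<longleftrightarrow> A \<subseteq> pts X \<and> B \<subseteq> pts Y \<and> (\<forall>x\<in>A. f x \<in> B \<and> g (f x) = x) \<and>
     (\<forall>y\<in>B. g y \<in> A \<and> f (g y) = y) \<and> morphism (sub X A) Y f \<and> morphism (sub Y B) X g"

lemma biso_sym: "biso X Y A B f g \<Longrightarrow> biso Y X B A g f"
  by (auto simp: biso_def)

lemma biso_image: "biso X Y A B f g \<Longrightarrow> f ` A = B"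
  unfolding biso_def by force

lemma biso_inj: "biso X Y A B f g \<Longrightarrow> inj_on f A"
  unfolding biso_def inj_on_def by metis

lemma biso_restrict:
  assumes "function_sheaf X" "function_sheaf Y" "biso X Y A B f g" "A' \<subseteq> A"
  shows "biso X Y A' (f ` A') f g"
proof -
  have "f ` A' \<subseteq> B" using assms(3,4) by (auto simp: biso_def)
  then show ?thesis
    using assms morphism_sub_mono [of X A Y f A'] morphism_sub_mono [of Y B X g "f ` A'"]
    unfolding biso_def by auto
qed

lemma biso_compose:
  assumes X: "function_sheaf X" and W: "function_sheaf W"
    and f: "biso X Y A B f g" and f': "biso Y W B C f' g'"
  shows "biso X W A C (\<lambda>x. f' (f x)) (\<lambda>z. g (g' z))"
proof -
  have "morphism (sub X A) (sub Y B) f"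
    using f by (intro morphism_into_sub [OF function_sheaf_sub [OF X]]) (auto simp: biso_def pts_sub)
  moreover have "morphism (sub Y B) W f'" using f' by (simp add: biso_def)
  ultimately have 1: "morphism (sub X A) W (\<lambda>x. f' (f x))" by (rule morphism_compose)
  have "morphism (sub W C) (sub Y B) g'"
    using f' by (intro morphism_into_sub [OF function_sheaf_sub [OF W]]) (auto simp: biso_def pts_sub)
  moreover have "morphism (sub Y B) X g" using f by (simp add: biso_def)
  ultimately have "morphism (sub W C) X (\<lambda>x. g (g' x))" by (rule morphism_compose)
  then show ?thesis using 1 f f' by (auto simp: biso_def)
qed

lemma biso_sub:
  assumes X: "function_sheaf X" and Y: "function_sheaf Y" and AB: "A \<subseteq> Z" "B \<subseteq> W"
  shows "biso (sub X Z) (sub Y W) A B f g \<longleftrightarrow> biso X Y A B f g"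
proof
  assume b: "biso (sub X Z) (sub Y W) A B f g"
  then have "morphism (sub X A) Y f" "morphism (sub Y B) X g"
    using morphism_sub_sub' [OF X _ AB(1), of "sub Y W" f] morphism_sub_sub' [OF Y _ AB(2), of "sub X Z" g]
      morphism_out_sub unfolding biso_def by blast+
  then show "biso X Y A B f g" using b by (auto simp: biso_def pts_sub)
next
  assume b: "biso X Y A B f g"
  have "morphism (sub (sub X Z) A) (sub Y W) f"
    using b AB by (intro morphism_into_sub function_sheaf_sub X morphism_sub_sub) (auto simp: biso_def pts_sub)
  moreover have "morphism (sub (sub Y W) B) (sub X Z) g"
    using b AB by (intro morphism_into_sub function_sheaf_sub Y morphism_sub_sub) (auto simp: biso_def pts_sub)
  ultimately show "biso (sub X Z) (sub Y W) A B f g" using b AB by (auto simp: biso_def pts_sub)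
qed

lemma biso_sub_left:
  assumes X: "function_sheaf X" and Y: "function_sheaf Y" and A: "A \<subseteq> Z" and b: "biso X Y A B f g"
  shows "biso (sub X Z) Y A B f g"
proof -
  have "morphism (sub (sub X Z) A) Y f"
    using b A by (intro morphism_sub_sub X) (auto simp: biso_def)
  moreover have "morphism (sub Y B) (sub X Z) g"
    using b A by (intro morphism_into_sub function_sheaf_sub Y) (auto simp: biso_def pts_sub)
  ultimately show ?thesis using b A by (auto simp: biso_def pts_sub)
qed

lemma biso_homeomorphic_maps:
  assumes "function_sheaf X" "function_sheaf Y" "biso X Y A B f g"
  shows "homeomorphic_maps (subtopology (zar X) A) (subtopology (zar Y) B) f g"
proof -
  have "continuous_map (subtopology (zar X) A) (zar Y) f" "continuous_map (subtopology (zar Y) B) (zar X) g"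
    using assms(3) morphism_continuous unfolding biso_def zar_sub [symmetric] by blast+
  then show ?thesis
    using assms(3) unfolding homeomorphic_maps_def biso_def
    by (auto simp: continuous_map_in_subtopology)
qed

lemma biso_homeomorphic_map:
  "function_sheaf X \<Longrightarrow> function_sheaf Y \<Longrightarrow> biso X Y A B f g \<Longrightarrow>
    homeomorphic_map (subtopology (zar X) A) (subtopology (zar Y) B) f"
  using biso_homeomorphic_maps homeomorphic_maps_imp_map by blast

lemma biso_openin_image:
  assumes "function_sheaf X" "function_sheaf Y" "biso X Y A B f g"
    and "openin (zar Y) B" "openin (zar X) W" "W \<subseteq> A"
  shows "openin (zar Y) (f ` W)"
proof -
  have "openin (subtopology (zar X) A) W" using assms(5,6) by (auto simp: openin_subtopology)
  then have "openin (subtopology (zar Y) B) (f ` W)"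
    using biso_homeomorphic_map [OF assms(1-3)] homeomorphic_map_openness_eq by metis
  then show ?thesis using assms(4) by (simp add: openin_open_subtopology)
qed

lemma isomorphism_imp_biso:
  assumes "A \<subseteq> pts X" "B \<subseteq> pts Y" "isomorphism (sub X A) (sub Y B) f"
  shows "biso X Y A B f (inv_into A f)"
proof -
  have A: "pts (sub X A) = A" and B: "pts (sub Y B) = B" using assms(1,2) by (auto simp: pts_sub)
  have bij: "bij_betw f A B" and m: "morphism (sub X A) Y f" "morphism (sub Y B) X (inv_into A f)"
    using assms(3) morphism_out_sub unfolding isomorphism_def A B by blast+
  have "\<forall>x\<in>A. f x \<in> B \<and> inv_into A f (f x) = x" "\<forall>y\<in>B. inv_into A f y \<in> A \<and> f (inv_into A f y) = y"
    using bij by (auto simp: bij_betw_def inv_into_into f_inv_into_f)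
  then show ?thesis using m assms(1,2) by (simp add: biso_def)
qed

lemma biso_imp_isomorphism:
  assumes X: "function_sheaf X" and Y: "function_sheaf Y" and b: "biso X Y A B f g"
  shows "isomorphism (sub X A) (sub Y B) f"
proof -
  have A: "pts (sub X A) = A" and B: "pts (sub Y B) = B" using b by (auto simp: pts_sub biso_def)
  have "bij_betw f A B" using biso_inj [OF b] biso_image [OF b] by (simp add: bij_betw_def)
  moreover have "morphism (sub X A) (sub Y B) f"
    using b by (intro morphism_into_sub function_sheaf_sub X) (auto simp: biso_def pts_sub)
  moreover have "morphism (sub Y B) (sub X A) (inv_into A f)"
  proof (rule morphism_cong [OF function_sheaf_sub [OF Y]])
    show "morphism (sub Y B) (sub X A) g"
      using b by (intro morphism_into_sub function_sheaf_sub Y) (auto simp: biso_def pts_sub)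
    fix y assume "y \<in> pts (sub Y B)"
    then have "y \<in> B" using B by simp
    then have "f (g y) = y" "g y \<in> A" using b by (auto simp: biso_def)
    then show "g y = inv_into A f y" using inv_into_f_f [OF biso_inj [OF b]] by metis
  qed
  ultimately show ?thesis unfolding isomorphism_def A B by blast
qed

subsection \<open>Affine charts\<close>

lemma reg_affine_iff:
  "f \<in> reg (affine_space n) U \<longleftrightarrow>
    (\<forall>x\<in>U. \<exists>p q. peval q x \<noteq> 0 \<and> (\<forall>y\<in>U. peval q y \<noteq> 0 \<longrightarrow> f y = peval p y / peval q y))"
  by (simp add: affine_space_def)

lemma function_sheaf_affine_space:
  "function_sheaf (affine_space n :: (nat \<Rightarrow> 'k::field, 'k) fspace)"
  unfolding function_sheaf_def
proof (intro allI impI iffI ballI)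
  fix U :: "(nat \<Rightarrow> 'k) set" and f x
  assume "openin (zar (affine_space n)) U" "f \<in> reg (affine_space n) U" "x \<in> U"
  then show "\<exists>V h. openin (zar (affine_space n)) V \<and> x \<in> V \<and> h \<in> reg (affine_space n) V \<and> (\<forall>y\<in>U \<inter> V. f y = h y)"
    by (intro exI [of _ U] exI [of _ f]) auto
next
  fix U :: "(nat \<Rightarrow> 'k) set" and f
  assume U: "openin (zar (affine_space n)) U" and loc: "\<forall>x\<in>U. \<exists>V h. openin (zar (affine_space n)) V \<and>
    x \<in> V \<and> h \<in> reg (affine_space n) V \<and> (\<forall>y\<in>U \<inter> V. f y = h y)"
  have Un: "U \<subseteq> affine_points n" using openin_subset [OF U] pts_affine_space by metis
  show "f \<in> reg (affine_space n) U"
    unfolding reg_affine_iff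
  proof
    fix x assume x: "x \<in> U"
    then obtain V h where V: "openin (zar (affine_space n)) V" "x \<in> V" "h \<in> reg (affine_space n) V"
      "\<forall>y\<in>U \<inter> V. f y = h y" using loc by blast
    obtain p q where pq: "peval q x \<noteq> 0" "\<forall>y\<in>V. peval q y \<noteq> 0 \<longrightarrow> h y = peval p y / peval q y"
      using V(2,3) unfolding reg_affine_iff by blast
    obtain r' where r': "r' \<in> PF n" "r' x \<noteq> 0" "\<forall>y\<in>affine_points n. r' y \<noteq> 0 \<longrightarrow> y \<in> V"
      using basic_open_affine [OF V(1,2)] by blast
    obtain r :: "'k mpoly" where r: "\<forall>y. peval r y = r' y" using PF_to_mpoly [OF r'(1)] by blast
    \<comment> \<open>A fraction valid on \<open>V\<close> only is expanded by \<open>r\<close>,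
      which vanishes off \<open>V\<close>; the expanded fraction is then correct wherever its
      denominator is nonzero on \<open>U\<close>, as \<open>reg\<close> demands.\<close>
    have "peval (q * r) x \<noteq> 0" using pq r r' by (simp add: peval_mult)
    moreover have "f y = peval (p * r) y / peval (q * r) y" if y: "y \<in> U" "peval (q * r) y \<noteq> 0" for y
    proof -
      have nz: "peval q y \<noteq> 0" "r' y \<noteq> 0" using y(2) r by (auto simp: peval_mult)
      then have "y \<in> V" using y(1) Un r'(3) by blast
      then show ?thesis using V(4) pq(2) y(1) nz r by (simp add: peval_mult)
    qed
    ultimately show "\<exists>p q. peval q x \<noteq> 0 \<and> (\<forall>y\<in>U. peval q y \<noteq> 0 \<longrightarrow> f y = peval p y / peval q y)"
      by blast
  qed
qed

lemma prevariety_function_sheaf: "prevariety X \<Longrightarrow> function_sheaf X"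
  by (simp add: prevariety_def)

lemma affine_variety_biso:
  assumes "U \<subseteq> pts X" "affine_variety (sub X U :: ('a, 'k::field) fspace)"
  shows "\<exists>n Z h g. closedin (zar (affine_space n)) Z \<and> biso X (affine_space n) U (Z :: (nat \<Rightarrow> 'k) set) h g"
proof -
  obtain n and Z :: "(nat \<Rightarrow> 'k) set" and h where "closedin (zar (affine_space n)) Z"
    "isomorphism (sub X U) (sub (affine_space n) Z) h"
    using assms(2) unfolding affine_variety_def by blast
  then show ?thesis using isomorphism_imp_biso [OF assms(1), of Z "affine_space n" h] closedin_subset by blast
qed

lemma prevariety_chart:
  assumes X: "prevariety (X :: ('a, 'k::field) fspace)" and x: "x \<in> pts X"
  shows "\<exists>U n Z h g. openin (zar X) U \<and> x \<in> U \<and> closedin (zar (affine_space n)) Z \<and>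
    biso X (affine_space n) U (Z :: (nat \<Rightarrow> 'k) set) h g"
proof -
  obtain U where U: "openin (zar X) U" "affine_variety (sub X U)" "x \<in> U"
    using X x unfolding prevariety_def by blast
  then show ?thesis using affine_variety_biso [OF openin_subset [OF U(1)] U(2)] by blast
qed

lemma noetherian_prevariety:
  assumes X: "prevariety (X :: ('a, 'k::field) fspace)"
  shows "noetherian_space (zar X)"
proof -
  obtain \<U> where \<U>: "finite \<U>" "\<Union>\<U> = pts X"
    "\<And>U. U \<in> \<U> \<Longrightarrow> openin (zar X) U \<and> affine_variety (sub X U)"
    using X unfolding prevariety_def by blast
  have "noetherian_space (subtopology (zar X) U)" if U: "U \<in> \<U>" for U
  proof -
    obtain n and Z :: "(nat \<Rightarrow> 'k) set" and h g where "biso X (affine_space n) U Z h g"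
      using affine_variety_biso \<U>(3) [OF U] openin_subset by metis
    then have "homeomorphic_map (subtopology (zar X) U) (subtopology (zar (affine_space n)) Z) h"
      by (rule biso_homeomorphic_map [OF prevariety_function_sheaf [OF X] function_sheaf_affine_space])
    then show ?thesis
      by (rule homeomorphic_map_noetherian) (rule noetherian_space_subtopology [OF noetherian_affine_space])
  qed
  then show ?thesis by (rule noetherian_space_Union [OF \<U>(1,2)])
qed

text \<open>The chart is taken around a point of the smallest member of a given chain, so that the
  chain survives in it; it varies with the chain, hence the inequality is proved for one chain
  length at a time. The affine case applies to the image \<open>V\<close> of
  \<open>D \<inter> U\<close>, and \<open>D \<inter> W \<inter> U\<close> leads back to
  \<open>D \<inter> W\<close> as an open subset.\<close>

theorem krull_dim_open_variety:
  assumes X: "prevariety (X :: ('a, 'k::{alg_closed_field, field_char_0}) fspace)"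
    and D: "closedin (zar X) D" "irreducible_in (zar X) D" and W: "openin (zar X) W" "D \<inter> W \<noteq> {}"
  shows "krull_dim (subtopology (zar X) (D \<inter> W)) = krull_dim (subtopology (zar X) D)"
proof (rule order_antisym)
  note sh = prevariety_function_sheaf [OF X] function_sheaf_affine_space
  have "openin (subtopology (zar X) D) (D \<inter> W)" using W(1) by (auto simp: openin_subtopology)
  then have "krull_dim (subtopology (subtopology (zar X) D) (D \<inter> W)) \<le> krull_dim (subtopology (zar X) D)"
    by (rule krull_dim_open_le)
  then show "krull_dim (subtopology (zar X) (D \<inter> W)) \<le> krull_dim (subtopology (zar X) D)"
    by (simp add: subtopology_subtopology)
  show "krull_dim (subtopology (zar X) D) \<le> krull_dim (subtopology (zar X) (D \<inter> W))"
  proof (rule krull_dim_le)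
    fix m Z assume "irr_chain (subtopology (zar X) D) m Z"
    then have Z: "irr_chain (zar X) m Z" "Z m \<subseteq> D" using D(1) by (auto simp: irr_chain_closed_subspace)
    have Z0: "irreducible_in (zar X) (Z 0)" using Z(1) by (auto simp: irr_chain_def)
    obtain x where x: "x \<in> Z 0" using irreducible_in_nonempty [OF Z0] by blast
    then have "x \<in> pts X" using irreducible_in_subset [OF Z0] by blast
    then obtain U n and C :: "(nat \<Rightarrow> 'k) set" and h g where U: "openin (zar X) U" "x \<in> U"
      and C: "closedin (zar (affine_space n)) C" and b: "biso X (affine_space n) U C h g"
      using prevariety_chart [OF X] by metis
    let ?A = "zar (affine_space n) :: (nat \<Rightarrow> 'k) topology"
    have hm: "homeomorphic_map (subtopology (zar X) U) (subtopology ?A C) h"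
      by (rule biso_homeomorphic_map [OF sh b])
    have Zm: "Z i \<subseteq> D" if "i \<le> m" for i using irr_chain_mono [OF Z(1), of i m] that Z(2) by auto
    have xD: "x \<in> D" using Zm [of 0] x by auto
    have "irr_chain (subtopology (zar X) U) m (\<lambda>i. Z i \<inter> U)"
      using x U by (intro irr_chain_Int_open [OF Z(1)]) auto
    moreover have "closedin (subtopology (zar X) U) (D \<inter> U)" using D(1) by (auto simp: closedin_subtopology)
    ultimately have "irr_chain (subtopology (subtopology (zar X) U) (D \<inter> U)) m (\<lambda>i. Z i \<inter> U)"
      using Z(2) by (subst irr_chain_closed_subspace) auto
    then have "enat m \<le> krull_dim (subtopology (zar X) (D \<inter> U))"
      using krull_dim_ge by (fastforce simp: subtopology_subtopology Int_commute Int_left_commute)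
    define V where "V = h ` (D \<inter> U)"
    have VC: "V \<subseteq> C" using biso_image [OF b] by (auto simp: V_def)
    have "irreducible_in (subtopology (zar X) U) (D \<inter> U)"
      using irreducible_in_Int_open(1) [OF D(2) U(1)] xD U(2) by (auto simp: irreducible_in_subtopology)
    then have "irreducible_in (subtopology ?A C) V"
      unfolding V_def by (rule irreducible_in_image [OF homeomorphic_imp_continuous_map [OF hm]])
    then have Virr: "irreducible_in ?A V" by (simp add: irreducible_in_subtopology)
    have "closedin (subtopology ?A C) V"
      unfolding V_def using \<open>closedin (subtopology (zar X) U) (D \<inter> U)\<close> hm
      by (metis homeomorphic_map_closedness_eq)
    then have Vcl: "closedin ?A V" using C by (simp add: closedin_closed_subtopology)
    have "openin (subtopology (zar X) U) (W \<inter> U)" using W(1) by (auto simp: openin_subtopology)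
    then have "openin (subtopology ?A C) (h ` (W \<inter> U))"
      using hm by (metis homeomorphic_map_openness_eq)
    then obtain O' where O': "openin ?A O'" "h ` (W \<inter> U) = O' \<inter> C" by (auto simp: openin_subtopology)
    have VO: "V \<inter> O' = h ` (D \<inter> W \<inter> U)"
    proof -
      have "V \<inter> O' = h ` (D \<inter> U) \<inter> h ` (W \<inter> U)" using O'(2) VC by (auto simp: V_def)
      also have "\<dots> = h ` ((D \<inter> U) \<inter> (W \<inter> U))"
        by (rule inj_on_image_Int [OF biso_inj [OF b], symmetric]) auto
      finally show ?thesis by (simp add: Int_ac)
    qed
    have "D \<inter> W \<inter> U \<noteq> {}"
      using irreducible_inD [OF D(2) W(1) U(1) W(2)] xD U(2) by auto
    then have "V \<inter> O' \<noteq> {}" using VO by simp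
    then have 2: "krull_dim (subtopology ?A V) \<le> krull_dim (subtopology ?A (V \<inter> O'))"
      by (rule krull_dim_affine_open [OF Vcl Virr O'(1)])
    have "biso X (affine_space n) (D \<inter> U) V h g"
      unfolding V_def by (rule biso_restrict [OF sh b]) auto
    then have 1: "krull_dim (subtopology (zar X) (D \<inter> U)) = krull_dim (subtopology ?A V)"
      using biso_homeomorphic_maps [OF sh] krull_dim_homeomorphic homeomorphic_space_def by blast
    have "biso X (affine_space n) (D \<inter> W \<inter> U) (V \<inter> O') h g"
      unfolding VO by (rule biso_restrict [OF sh b]) auto
    then have 3: "krull_dim (subtopology (zar X) (D \<inter> W \<inter> U)) = krull_dim (subtopology ?A (V \<inter> O'))"
      using biso_homeomorphic_maps [OF sh] krull_dim_homeomorphic homeomorphic_space_def by blast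
    have "openin (subtopology (zar X) (D \<inter> W)) (D \<inter> W \<inter> U)" using U(1) by (auto simp: openin_subtopology)
    then have "krull_dim (subtopology (subtopology (zar X) (D \<inter> W)) (D \<inter> W \<inter> U)) \<le>
        krull_dim (subtopology (zar X) (D \<inter> W))"
      by (rule krull_dim_open_le)
    then have 4: "krull_dim (subtopology (zar X) (D \<inter> W \<inter> U)) \<le> krull_dim (subtopology (zar X) (D \<inter> W))"
    proof -
      have "(D \<inter> W) \<inter> (D \<inter> W \<inter> U) = D \<inter> W \<inter> U" by blast
      then show ?thesis
        using \<open>krull_dim (subtopology (subtopology (zar X) (D \<inter> W)) (D \<inter> W \<inter> U)) \<le> _\<close>
        by (simp only: subtopology_subtopology)
    qed
    show "enat m \<le> krull_dim (subtopology (zar X) (D \<inter> W))"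
      using \<open>enat m \<le> krull_dim (subtopology (zar X) (D \<inter> U))\<close> 1 2 3 4 by (metis order_trans)
  qed
qed

lemma affine_closed_sub:
  assumes X: "function_sheaf X" and U: "U \<subseteq> pts X" and aff: "affine_variety (sub X U :: ('a, 'k::field) fspace)"
    and Z: "closedin (zar X) Z"
  shows "affine_variety (sub (sub X Z) (U \<inter> Z))"
proof -
  note sh = X function_sheaf_affine_space
  obtain n and C :: "(nat \<Rightarrow> 'k) set" and h g where C: "closedin (zar (affine_space n)) C"
    and b: "biso X (affine_space n) U C h g"
    using affine_variety_biso [OF U aff] by blast
  define C' where "C' = h ` (U \<inter> Z)"
  have b': "biso X (affine_space n) (U \<inter> Z) C' h g"
    unfolding C'_def by (rule biso_restrict [OF sh b]) auto
  have "closedin (subtopology (zar X) U) (U \<inter> Z)" using Z by (auto simp: closedin_subtopology)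
  then have "closedin (subtopology (zar (affine_space n)) C) C'"
    unfolding C'_def using biso_homeomorphic_map [OF sh b] by (metis homeomorphic_map_closedness_eq)
  then have "closedin (zar (affine_space n)) C'" using C by (simp add: closedin_closed_subtopology)
  moreover have "isomorphism (sub (sub X Z) (U \<inter> Z)) (sub (affine_space n) C') h"
    using biso_sub_left [OF sh _ b', of Z]
    by (intro biso_imp_isomorphism function_sheaf_sub sh) auto
  ultimately show ?thesis unfolding affine_variety_def by blast
qed

lemma variety_sub_closed:
  assumes X: "variety (X :: ('a, 'k::field) fspace)" and Z: "closedin (zar X) Z"
  shows "variety (sub X Z)"
proof -
  have X': "prevariety X" "separated X" using X by (auto simp: variety_def)
  note sh = prevariety_function_sheaf [OF X'(1)]
  obtain \<U> where \<U>: "finite \<U>" "\<Union>\<U> = pts X"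
    "\<And>U. U \<in> \<U> \<Longrightarrow> openin (zar X) U \<and> affine_variety (sub X U)"
    using X' unfolding prevariety_def by blast
  have "prevariety (sub X Z)"
    unfolding prevariety_def
  proof (intro conjI exI [of _ "(\<lambda>U. U \<inter> Z) ` \<U>"] ballI)
    show "function_sheaf (sub X Z)" by (rule function_sheaf_sub [OF sh])
    show "finite ((\<lambda>U. U \<inter> Z) ` \<U>)" using \<U>(1) by simp
    show "(\<Union>U\<in>\<U>. U \<inter> Z) = pts (sub X Z)" using \<U>(2) by (auto simp: pts_sub)
    fix V assume "V \<in> (\<lambda>U. U \<inter> Z) ` \<U>"
    then obtain U where U: "U \<in> \<U>" "V = U \<inter> Z" by blast
    then show "openin (zar (sub X Z)) V" using \<U>(3) by (auto simp: zar_sub openin_subtopology)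
    show "affine_variety (sub (sub X Z) V)"
      unfolding U(2) using \<U>(3) [OF U(1)] openin_subset by (intro affine_closed_sub sh Z) blast+
  qed
  moreover have "separated (sub X Z)"
    unfolding separated_def
  proof (intro allI impI, elim conjE)
    fix n and C :: "(nat \<Rightarrow> 'k) set" and f g
    assume "closedin (zar (affine_space n)) C" "morphism (sub (affine_space n) C) (sub X Z) f"
      "morphism (sub (affine_space n) C) (sub X Z) g"
    then show "closedin (zar (affine_space n)) {z \<in> C. f z = g z}"
      using X'(2) morphism_out_sub unfolding separated_def by blast
  qed
  ultimately show ?thesis by (simp add: variety_def)
qed


subsection \<open>Separatedness\<close>

lemma PF_truncate:
  assumes "f \<in> PF n" shows "f (z(n := c)) = f z"
  by (rule PF_cong_coord [OF assms]) simp

text \<open>On the graph of \<open>1 / p\<close>, multiplication by a high enough power of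
  \<open>p\<close> turns a polynomial function of \<open>n + 1\<close> coordinates into one of
  \<open>n\<close> coordinates without changing where it vanishes.\<close>

lemma PF_clear_denominator:
  fixes s p :: "(nat \<Rightarrow> 'k::field) \<Rightarrow> 'k"
  assumes "s \<in> PF (Suc n)" "p \<in> PF n"
  shows "\<exists>s'\<in>PF n. \<exists>m. \<forall>z. p z \<noteq> 0 \<longrightarrow> s' z = p z ^ m * s (z(n := 1 / p z))"
proof -
  obtain r where r: "r \<in> polys (PF n)" "\<And>x. s x = (\<Sum>j\<le>degree r. coeff r j x * x n ^ j)"
    using PF_SucE [OF assms(1)] by blast
  have rPF: "coeff r j \<in> PF n" for j using r(1) by (rule coeff_polys)
  define s' where "s' z = (\<Sum>j\<le>degree r. coeff r j z * p z ^ (degree r - j))" for z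
  have "(\<lambda>z. coeff r j z * p z ^ (degree r - j)) \<in> PF n" for j
    by (intro PF_mult PF_power rPF assms)
  then have "s' \<in> PF n" unfolding s'_def by (intro PF_sum)
  moreover have "s' z = p z ^ degree r * s (z(n := 1 / p z))" if nz: "p z \<noteq> 0" for z
  proof -
    have "p z ^ degree r * (coeff r j z * (1 / p z) ^ j) = coeff r j z * p z ^ (degree r - j)"
      if "j \<le> degree r" for j
    proof -
      have "p z ^ degree r = p z ^ (degree r - j) * p z ^ j" using that by (simp flip: power_add)
      then show ?thesis using nz by (simp add: power_one_over)
    qed
    then have "(\<Sum>j\<le>degree r. p z ^ degree r * (coeff r j z * (1 / p z) ^ j)) = s' z"
      unfolding s'_def by (intro sum.cong) auto
    moreover have "p z ^ degree r * s (z(n := 1 / p z)) =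
        (\<Sum>j\<le>degree r. p z ^ degree r * (coeff r j z * (1 / p z) ^ j))"
      by (simp add: r(2) PF_truncate [OF rPF] sum_distrib_left)
    ultimately show ?thesis by (simp only:)
  qed
  ultimately show ?thesis by blast
qed

lemma projection_morphism:
  "morphism (affine_space (Suc n)) (affine_space n) (\<lambda>z :: nat \<Rightarrow> 'k::field. z(n := 0))"
  unfolding morphism_def
proof (intro conjI allI impI)
  let ?\<pi> = "\<lambda>z :: nat \<Rightarrow> 'k. z(n := 0)"
  have \<pi>: "?\<pi> z \<in> affine_points n" if "z \<in> affine_points (Suc n)" for z
    using that by (auto simp: affine_points_def)
  have PF_lift: "f \<in> PF (Suc n)" if "f \<in> PF n" for f :: "(nat \<Rightarrow> 'k) \<Rightarrow> 'k"
    using that PF_mono [of n "Suc n"] by auto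
  show "continuous_map (zar (affine_space (Suc n))) (zar (affine_space n)) ?\<pi>"
    unfolding continuous_map_closedin
  proof (intro conjI allI impI)
    show "?\<pi> \<in> pts (affine_space (Suc n)) \<rightarrow> pts (affine_space n)" using \<pi> by (simp add: pts_affine_space)
  next
    fix C :: "(nat \<Rightarrow> 'k) set" assume "closedin (zar (affine_space n)) C"
    then obtain S where S: "S \<subseteq> PF n" "C = PF_zeros n S" using closedin_affine_PF by blast
    have "{z \<in> pts (affine_space (Suc n)). ?\<pi> z \<in> C} = PF_zeros (Suc n) S"
    proof -
      have eqf: "f (?\<pi> z) = f z" if "f \<in> S" for f z using S(1) that by (intro PF_truncate) auto
      have "(\<forall>f\<in>S. f (?\<pi> z) = 0) \<longleftrightarrow> (\<forall>f\<in>S. f z = 0)" for z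
        by (rule ball_cong [OF refl]) (metis eqf)
      then show ?thesis using \<pi> unfolding S(2) PF_zeros_def pts_affine_space by blast
    qed
    moreover have "closedin (zar (affine_space (Suc n))) (PF_zeros (Suc n) S)"
      using S(1) PF_lift by (intro closedin_zeros) auto
    ultimately show "closedin (zar (affine_space (Suc n))) {z \<in> pts (affine_space (Suc n)). ?\<pi> z \<in> C}"
      by simp
  qed
  fix V and h :: "(nat \<Rightarrow> 'k) \<Rightarrow> 'k" assume V: "openin (zar (affine_space n)) V \<and> h \<in> reg (affine_space n) V"
  then have Vn: "V \<subseteq> affine_points n" using openin_subset pts_affine_space by metis
  show "(\<lambda>z. h (?\<pi> z)) \<in> reg (affine_space (Suc n)) {z \<in> pts (affine_space (Suc n)). ?\<pi> z \<in> V}"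
    unfolding reg_affine_iff
  proof
    fix z assume z: "z \<in> {z \<in> pts (affine_space (Suc n)). ?\<pi> z \<in> V}"
    obtain p q where pq: "peval q (?\<pi> z) \<noteq> 0" "\<forall>y\<in>V. peval q y \<noteq> 0 \<longrightarrow> h y = peval p y / peval q y"
      using V z unfolding reg_affine_iff by blast
    obtain p' q' where p': "p' \<in> PF n" "\<forall>x\<in>affine_points n. p' x = peval p x"
      and q': "q' \<in> PF n" "\<forall>x\<in>affine_points n. q' x = peval q x"
      using mpoly_to_PF by metis
    obtain p'' q'' :: "'k mpoly" where p'': "\<forall>x. peval p'' x = p' x" and q'': "\<forall>x. peval q'' x = q' x"
      using PF_to_mpoly p'(1) q'(1) by metis
    have eq: "peval q'' y = peval q (?\<pi> y)" "peval p'' y = peval p (?\<pi> y)" if "?\<pi> y \<in> V" for y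
    proof -
      have "?\<pi> y \<in> affine_points n" using that Vn by blast
      then show "peval q'' y = peval q (?\<pi> y)" "peval p'' y = peval p (?\<pi> y)"
        using p' q' p'' q'' PF_truncate [OF p'(1), of y 0] PF_truncate [OF q'(1), of y 0] by metis+
    qed
    then show "\<exists>p q. peval q z \<noteq> 0 \<and> (\<forall>y\<in>{z \<in> pts (affine_space (Suc n)). ?\<pi> z \<in> V}.
        peval q y \<noteq> 0 \<longrightarrow> h (?\<pi> y) = peval p y / peval q y)"
      using pq z by (intro exI [of _ p''] exI [of _ q'']) auto
  qed
qed

text \<open>Separatedness is tested on affine varieties only, so a principal open subset \<open>p \<noteq> 0\<close>
  of a chart is first turned into one by adjoining the coordinate \<open>1 / p\<close>.\<close>

theorem separated_agree:
  assumes X: "prevariety (X :: ('a, 'k::field) fspace)" and Y: "separated Y"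
    and W: "openin (zar X) W" and h: "morphism (sub X W) Y h1" "morphism (sub X W) Y h2"
    and O1: "openin (zar X) O1" "O1 \<subseteq> W" "W \<subseteq> zar X closure_of O1" and eq: "\<And>x. x \<in> O1 \<Longrightarrow> h1 x = h2 x"
    and x: "x \<in> W"
  shows "h1 x = h2 x"
proof (rule ccontr)
  assume ne: "h1 x \<noteq> h2 x"
  note sh = prevariety_function_sheaf [OF X] function_sheaf_affine_space
  have "x \<in> pts X" using x openin_subset [OF W] by blast
  then obtain U n and C :: "(nat \<Rightarrow> 'k) set" and a b where U: "openin (zar X) U" "x \<in> U"
    and C: "closedin (zar (affine_space n)) C" and ab: "biso X (affine_space n) U C a b"
    using prevariety_chart [OF X] by metis
  let ?A = "zar (affine_space n) :: (nat \<Rightarrow> 'k) topology"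
  let ?A' = "zar (affine_space (Suc n)) :: (nat \<Rightarrow> 'k) topology"
  have Cn: "C \<subseteq> affine_points n" using closedin_subset [OF C] pts_affine_space by metis
  have aU: "a y \<in> C" "b (a y) = y" if "y \<in> U" for y using ab that by (auto simp: biso_def)
  have bC: "b z \<in> U" "a (b z) = z" if "z \<in> C" for z using ab that by (auto simp: biso_def)
  have hm: "homeomorphic_map (subtopology (zar X) U) (subtopology ?A C) a"
    by (rule biso_homeomorphic_map [OF sh ab])
  have "openin (subtopology (zar X) U) (W \<inter> U)" using W by (auto simp: openin_subtopology)
  then have "openin (subtopology ?A C) (a ` (W \<inter> U))" using hm by (metis homeomorphic_map_openness_eq)
  then obtain O' where O': "openin ?A O'" "a ` (W \<inter> U) = O' \<inter> C" by (auto simp: openin_subtopology)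
  have "a x \<in> O'" using O'(2) x U(2) by blast
  \<comment> \<open>The principal open set \<open>p \<noteq> 0\<close> is a neighbourhood of
    \<open>a x\<close> inside the part of the chart that corresponds to \<open>W\<close>.\<close>
  then obtain p where p: "p \<in> PF n" "p (a x) \<noteq> 0" "\<forall>y\<in>affine_points n. p y \<noteq> 0 \<longrightarrow> y \<in> O'"
    using basic_open_affine [OF O'(1)] by blast
  have bW: "b z \<in> W" if "z \<in> C" "p z \<noteq> 0" for z
  proof -
    have "z \<in> a ` (W \<inter> U)" using that p(3) Cn O'(2) by blast
    then show ?thesis using aU by auto
  qed
  let ?\<pi> = "\<lambda>z :: nat \<Rightarrow> 'k. z(n := 0)"
  \<comment> \<open>The graph of \<open>1 / p\<close> over the principal open subset of
    \<open>C\<close>: a closed subset of affine space of one dimension more, to which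
    \<open>separated\<close> applies.\<close>
  define C' where "C' = {z \<in> affine_points (Suc n). ?\<pi> z \<in> C \<and> z n * p z = 1}"
  have C': "closedin ?A' C'"
  proof -
    have "closedin ?A' {z \<in> pts (affine_space (Suc n)). ?\<pi> z \<in> C}"
      by (rule closedin_continuous_map_preimage [OF morphism_continuous [OF projection_morphism] C])
    moreover have "(\<lambda>z. coord n z * p z - 1) \<in> PF (Suc n)"
      using p(1) PF_mono [of n "Suc n"] by (intro PF_diff PF_mult PF_coord PF_const) auto
    then have "closedin ?A' {z \<in> affine_points (Suc n). coord n z * p z - 1 = 0}"
      by (rule closedin_zeros1)
    ultimately have "closedin ?A' ({z \<in> pts (affine_space (Suc n)). ?\<pi> z \<in> C} \<inter>
        {z \<in> affine_points (Suc n). coord n z * p z - 1 = 0})"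
      by (rule closedin_Int)
    moreover have "{z \<in> pts (affine_space (Suc n)). ?\<pi> z \<in> C} \<inter>
        {z \<in> affine_points (Suc n). coord n z * p z - 1 = 0} = C'"
      by (auto simp: C'_def pts_affine_space coord_def)
    ultimately show ?thesis by simp
  qed
  have C'D: "?\<pi> z \<in> C" "p (?\<pi> z) \<noteq> 0" if "z \<in> C'" for z
    using that PF_truncate [OF p(1), of z 0] by (auto simp: C'_def)
  have C'n: "C' \<subseteq> pts (affine_space (Suc n))" by (auto simp: C'_def pts_affine_space)
  have shC': "function_sheaf (sub (affine_space (Suc n)) C')"
    by (rule function_sheaf_sub [OF function_sheaf_affine_space])
  have "morphism (sub (affine_space (Suc n)) C') (sub (affine_space n) C) ?\<pi>"
    using C'D by (intro morphism_into_sub [OF shC'] morphism_restrict [OF projection_morphism]) (auto simp: pts_sub)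
  moreover have "morphism (sub (affine_space n) C) X b" using ab by (simp add: biso_def)
  ultimately have "morphism (sub (affine_space (Suc n)) C') X (\<lambda>z. b (?\<pi> z))"
    by (rule morphism_compose)
  then have mW: "morphism (sub (affine_space (Suc n)) C') (sub X W) (\<lambda>z. b (?\<pi> z))"
    using C'D bW by (intro morphism_into_sub [OF shC']) (auto simp: pts_sub)
  define E where "E = {z \<in> C'. h1 (b (?\<pi> z)) = h2 (b (?\<pi> z))}"
  have "closedin ?A' E"
    unfolding E_def using Y C' morphism_compose [OF mW h(1)] morphism_compose [OF mW h(2)]
    unfolding separated_def by blast
  define lift where "lift y = (a y)(n := 1 / p (a y))" for y
  have liftC: "lift y \<in> C'" "b (?\<pi> (lift y)) = y" if y: "y \<in> U" "p (a y) \<noteq> 0" for y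
  proof -
    have an: "a y \<in> affine_points n" using aU y Cn by blast
    have \<pi>: "?\<pi> (lift y) = a y" using an by (auto simp: lift_def affine_points_def)
    then show "b (?\<pi> (lift y)) = y" using aU y by simp
    have "p (lift y) = p (a y)" unfolding lift_def by (rule PF_truncate [OF p(1)])
    then show "lift y \<in> C'"
      using y an \<pi> aU(1) [OF y(1)] by (simp add: C'_def) (auto simp: lift_def affine_points_def)
  qed
  have "lift x \<notin> E" using liftC(2) [OF U(2) p(2)] ne by (simp add: E_def)
  moreover have "lift x \<in> affine_points (Suc n)" using liftC(1) [OF U(2) p(2)] by (simp add: C'_def)
  ultimately obtain s where s: "s \<in> PF (Suc n)" "s (lift x) \<noteq> 0" "\<forall>y\<in>E. s y = 0"
    using not_in_closed_affine [OF \<open>closedin ?A' E\<close>] by blast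
  \<comment> \<open>The function \<open>s\<close> separates \<open>lift x\<close> from the equalizer
    \<open>E\<close>. Without its denominator it describes a neighbourhood \<open>N\<close> of
    \<open>x\<close> in \<open>X\<close> whose lifts avoid \<open>E\<close>, although the dense set
    \<open>O1\<close> must meet \<open>N\<close>.\<close>
  obtain s' m where s': "s' \<in> PF n" "\<forall>z. p z \<noteq> 0 \<longrightarrow> s' z = p z ^ m * s (z(n := 1 / p z))"
    using PF_clear_denominator [OF s(1) p(1)] by blast
  define N where "N = {y \<in> U. s' (a y) * p (a y) \<noteq> 0}"
  have "openin (zar X) N"
  proof -
    have "openin ?A {z \<in> affine_points n. s' z * p z \<noteq> 0}"
      by (intro openin_nonzeros PF_mult s' p)
    then have "openin (subtopology (zar X) U) {y \<in> topspace (subtopology (zar X) U). a y \<in> {z \<in> affine_points n. s' z * p z \<noteq> 0}}"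
      using ab morphism_continuous [of "sub X U" "affine_space n" a]
      by (intro openin_continuous_map_preimage [of _ ?A]) (auto simp: biso_def zar_sub)
    moreover have "{y \<in> topspace (subtopology (zar X) U). a y \<in> {z \<in> affine_points n. s' z * p z \<noteq> 0}} = N"
      using openin_subset [OF U(1)] aU(1) Cn by (auto simp: N_def)
    ultimately show ?thesis using U(1) by (simp add: openin_open_subtopology)
  qed
  moreover have "x \<in> N"
    using U(2) p(2) s(2) s'(2) by (simp add: N_def lift_def)
  moreover have "x \<in> zar X closure_of O1" using x O1(3) by blast
  ultimately obtain y where y: "y \<in> O1" "y \<in> N" unfolding in_closure_of by blast
  then have yU: "y \<in> U" "p (a y) \<noteq> 0" "s' (a y) \<noteq> 0" by (auto simp: N_def)
  then have "lift y \<in> E" using liftC [OF yU(1,2)] eq [OF y(1)] by (simp add: E_def)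
  then have "s (lift y) = 0" using s(3) by blast
  then show False using yU s'(2) by (simp add: lift_def)
qed


section \<open>Birational maps\<close>

lemma dense_Int_open:
  assumes "T closure_of U = topspace T" "openin T W" shows "W \<subseteq> T closure_of (W \<inter> U)"
proof
  fix x assume x: "x \<in> W"
  then have xT: "x \<in> topspace T" using openin_subset [OF assms(2)] by blast
  have "\<exists>y. y \<in> W \<inter> U \<and> y \<in> V" if V: "x \<in> V" "openin T V" for V
  proof -
    have "x \<in> T closure_of U" using xT assms(1) by simp
    moreover have "x \<in> V \<inter> W" "openin T (V \<inter> W)" using x V assms(2) by auto
    ultimately show ?thesis unfolding in_closure_of by blast
  qed
  then show "x \<in> T closure_of (W \<inter> U)" using xT by (simp add: in_closure_of)
qed

lemma dense_trans:
  assumes "A \<subseteq> T closure_of B" "B \<subseteq> T closure_of C" shows "A \<subseteq> T closure_of C"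
  using assms(1) closure_of_minimal [OF assms(2) closedin_closure_of] by blast

lemma biso_dense_image:
  assumes sh: "function_sheaf X" "function_sheaf Y" and b: "biso X Y A B f g" and O1: "O1 \<subseteq> A"
    and dense: "A \<subseteq> zar X closure_of O1"
  shows "B \<subseteq> zar Y closure_of (f ` O1)"
proof -
  have A: "A \<subseteq> pts X" and B: "B \<subseteq> pts Y" using b by (auto simp: biso_def)
  have "f ` (subtopology (zar X) A closure_of O1) = subtopology (zar Y) B closure_of (f ` O1)"
    using A O1 by (intro homeomorphic_map_closure_of [OF biso_homeomorphic_map [OF sh b], symmetric]) auto
  moreover have "subtopology (zar X) A closure_of O1 = A"
    using O1 dense by (auto simp: closure_of_subtopology Int_absorb1)
  ultimately have "B = subtopology (zar Y) B closure_of (f ` O1)" using biso_image [OF b] by simp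
  also have "\<dots> \<subseteq> zar Y closure_of (f ` O1)"
    unfolding closure_of_subtopology using closure_of_mono [of "B \<inter> f ` O1" "f ` O1" "zar Y"] by blast
  finally show ?thesis .
qed

lemma variety_sheaf: "variety X \<Longrightarrow> function_sheaf X"
  by (simp add: variety_def prevariety_function_sheaf)

lemma variety_agree:
  assumes X: "variety X" and Y: "variety Y" and W: "openin (zar X) W"
    and h: "morphism (sub X W) Y h1" "morphism (sub X W) Y h2"
    and O1: "openin (zar X) O1" "O1 \<subseteq> W" "W \<subseteq> zar X closure_of O1" and eq: "\<And>x. x \<in> O1 \<Longrightarrow> h1 x = h2 x"
    and x: "x \<in> W"
  shows "h1 x = h2 x"
  using separated_agree [OF _ _ W h O1 eq x] X Y by (simp add: variety_def)


subsection \<open>Extension of birational maps\<close>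

text \<open>A local extension of the rational map as an open immersion, with its inverse as part of
  the data. The union of all such \<open>W\<close> is the complement of the exceptional
  locus.\<close>

definition chart :: "('a, 'k::field) fspace \<Rightarrow> ('b, 'k) fspace \<Rightarrow> 'a set \<Rightarrow> ('a \<Rightarrow> 'b) \<Rightarrow>
    'a set \<Rightarrow> ('a \<Rightarrow> 'b) \<Rightarrow> ('b \<Rightarrow> 'a) \<Rightarrow> bool" where
  "chart X Y U f W h h' \<longleftrightarrow> openin (zar X) W \<and> openin (zar Y) (h ` W) \<and> biso X Y W (h ` W) h h' \<and>
     (\<forall>x\<in>U \<inter> W. h x = f x)"

definition ext_dom :: "('a, 'k::field) fspace \<Rightarrow> ('b, 'k) fspace \<Rightarrow> 'a set \<Rightarrow> ('a \<Rightarrow> 'b) \<Rightarrow> 'a set" where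
  "ext_dom X Y U f = \<Union>{W. \<exists>h h'. chart X Y U f W h h'}"

definition ext_map :: "('a, 'k::field) fspace \<Rightarrow> ('b, 'k) fspace \<Rightarrow> 'a set \<Rightarrow> ('a \<Rightarrow> 'b) \<Rightarrow> 'a \<Rightarrow> 'b" where
  "ext_map X Y U f x = (SOME v. \<exists>W h h'. chart X Y U f W h h' \<and> x \<in> W \<and> v = h x)"

lemma chartD:
  assumes "chart X Y U f W h h'"
  shows "openin (zar X) W" "openin (zar Y) (h ` W)" "biso X Y W (h ` W) h h'"
    "\<And>x. x \<in> U \<Longrightarrow> x \<in> W \<Longrightarrow> h x = f x" "morphism (sub X W) Y h" "morphism (sub Y (h ` W)) X h'"
    "\<And>x. x \<in> W \<Longrightarrow> h' (h x) = x"
  using assms unfolding chart_def biso_def by blast+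

lemma open_immersion_iff_biso:
  assumes sh: "function_sheaf X" "function_sheaf Y" and W: "openin (zar X) W"
  shows "open_immersion (sub X W) Y h \<longleftrightarrow> openin (zar Y) (h ` W) \<and> (\<exists>h'. biso X Y W (h ` W) h h')"
proof -
  have W': "W \<subseteq> pts X" using openin_subset [OF W] .
  then have p: "pts (sub X W) = W" by (auto simp: pts_sub)
  show ?thesis
  proof
    assume "open_immersion (sub X W) Y h"
    then have o: "openin (zar Y) (h ` W)" and i: "isomorphism (sub X W) (sub Y (h ` W)) h"
      unfolding open_immersion_def p by blast+
    show "openin (zar Y) (h ` W) \<and> (\<exists>h'. biso X Y W (h ` W) h h')"
      using isomorphism_imp_biso [OF W' openin_subset [OF o] i] o by blast
  next
    assume "openin (zar Y) (h ` W) \<and> (\<exists>h'. biso X Y W (h ` W) h h')"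
    then show "open_immersion (sub X W) Y h"
      unfolding open_immersion_def p using biso_imp_isomorphism [OF sh] by blast
  qed
qed

lemma exceptional_locus_eq:
  assumes "function_sheaf X" "function_sheaf Y"
  shows "exceptional_locus X Y (U, f) = pts X - ext_dom X Y U f"
proof -
  have "{W. openin (zar X) W \<and> (\<exists>h. open_immersion (sub X W) Y h \<and> (\<forall>x\<in>fst (U, f) \<inter> W. h x = snd (U, f) x))} =
    {W. \<exists>h h'. chart X Y U f W h h'}"
    unfolding chart_def using open_immersion_iff_biso [OF assms] by auto
  then show ?thesis unfolding exceptional_locus_def ext_dom_def by simp
qed

context
  fixes X :: "('a, 'k::field) fspace" and Y :: "('b, 'k) fspace" and U V f f'
  assumes X: "variety X" and Y: "variety Y" and b: "biso X Y U V f f'"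
    and U: "openin (zar X) U" "zar X closure_of U = pts X"
    and V: "openin (zar Y) V" "zar Y closure_of V = pts Y"
begin

lemma chart_agree:
  assumes "chart X Y U f W1 h1 h1'" "chart X Y U f W2 h2 h2'" "x \<in> W1" "x \<in> W2"
  shows "h1 x = h2 x"
proof (rule variety_agree [OF X Y, of "W1 \<inter> W2"])
  note c1 = chartD [OF assms(1)] and c2 = chartD [OF assms(2)]
  show op: "openin (zar X) (W1 \<inter> W2)" using c1 c2 by auto
  then show "openin (zar X) (W1 \<inter> W2 \<inter> U)" using U by auto
  show "morphism (sub X (W1 \<inter> W2)) Y h1"
    by (rule morphism_sub_mono [OF variety_sheaf [OF X] c1(5)]) blast
  show "morphism (sub X (W1 \<inter> W2)) Y h2"
    by (rule morphism_sub_mono [OF variety_sheaf [OF X] c2(5)]) blast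
  show "W1 \<inter> W2 \<subseteq> zar X closure_of (W1 \<inter> W2 \<inter> U)" by (rule dense_Int_open [OF U(2) op])
  show "h1 y = h2 y" if "y \<in> W1 \<inter> W2 \<inter> U" for y using that c1(4) c2(4) by auto
qed (use assms in auto)

text \<open>Agreement with \<open>f\<close> on a dense open part of \<open>W\<close> is enough: on
  \<open>U \<inter> W\<close> the maps \<open>h\<close> and \<open>f\<close> are two morphisms to a
  separated space.\<close>

lemma chartI_dense:
  assumes W: "openin (zar X) W" "openin (zar Y) (h ` W)" "biso X Y W (h ` W) h h'"
    and O1: "openin (zar X) O1" "O1 \<subseteq> W \<inter> U" "W \<subseteq> zar X closure_of O1" "\<And>x. x \<in> O1 \<Longrightarrow> h x = f x"
  shows "chart X Y U f W h h'"
  unfolding chart_def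
proof (intro conjI ballI W)
  fix x assume x: "x \<in> U \<inter> W"
  have op: "openin (zar X) (U \<inter> W)" using W U by auto
  show "h x = f x"
  proof (rule variety_agree [OF X Y op _ _ O1(1) _ _ O1(4) x])
    have "morphism (sub X W) Y h" "morphism (sub X U) Y f" using W(3) b by (simp_all add: biso_def)
    then show "morphism (sub X (U \<inter> W)) Y h" "morphism (sub X (U \<inter> W)) Y f"
      by (auto intro: morphism_sub_mono [OF variety_sheaf [OF X]])
    show "O1 \<subseteq> U \<inter> W" "U \<inter> W \<subseteq> zar X closure_of O1" using O1(2,3) by auto
  qed
qed

lemma chart_self: "chart X Y U f U f f'"
  unfolding chart_def biso_image [OF b] using U(1) V(1) b by blast

lemma chart_inverse:
  assumes c: "chart X Y U f W h h'" shows "chart Y X V f' (h ` W) h' h"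
proof -
  note sh = variety_sheaf [OF X] variety_sheaf [OF Y]
  note c' = chartD [OF c]
  have im: "h' ` h ` W = W" using c'(7) by force
  have b': "biso Y X (h ` W) (h' ` h ` W) h' h" unfolding im by (rule biso_sym [OF c'(3)])
  have op: "openin (zar Y) (V \<inter> h ` W)" using V c'(2) by auto
  have eq: "h x = f x" if "x \<in> W \<inter> U" for x using c'(4) that by auto
  have "h' y = f' y" if y: "y \<in> V \<inter> h ` W" for y
  proof (rule variety_agree [OF Y X op])
    show "morphism (sub Y (V \<inter> h ` W)) X h'"
      by (rule morphism_sub_mono [OF sh(2) c'(6)]) blast
    have "morphism (sub Y V) X f'" using b by (simp add: biso_def)
    then show "morphism (sub Y (V \<inter> h ` W)) X f'"
      by (rule morphism_sub_mono [OF sh(2)]) blast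
    show "openin (zar Y) (h ` (W \<inter> U))"
      by (rule biso_openin_image [OF sh c'(3,2)]) (use c'(1) U(1) in auto)
    show "h ` (W \<inter> U) \<subseteq> V \<inter> h ` W" using eq biso_image [OF b] by force
    have "h ` W \<subseteq> zar Y closure_of (h ` (W \<inter> U))"
      by (rule biso_dense_image [OF sh c'(3) _ dense_Int_open [OF U(2) c'(1)]]) simp
    then show "V \<inter> h ` W \<subseteq> zar Y closure_of (h ` (W \<inter> U))" by blast
    show "h' z = f' z" if z: "z \<in> h ` (W \<inter> U)" for z
    proof -
      obtain x where x: "x \<in> W \<inter> U" "z = h x" using z by blast
      then have "h' z = x" using c'(7) by simp
      moreover have "f' z = x" using x eq b by (auto simp: biso_def)
      ultimately show ?thesis by simp
    qed
  qed (rule y)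
  then show ?thesis unfolding chart_def im using c'(1,2) b' im by auto
qed

lemma ext_map_eq:
  assumes "chart X Y U f W h h'" "x \<in> W" shows "ext_map X Y U f x = h x"
proof -
  have "\<exists>W h h'. chart X Y U f W h h' \<and> x \<in> W \<and> ext_map X Y U f x = h x"
    unfolding ext_map_def by (rule someI_ex) (use assms in blast)
  then show ?thesis using chart_agree assms by metis
qed

lemma ext_domE:
  assumes "x \<in> ext_dom X Y U f" obtains W h h' where "chart X Y U f W h h'" "x \<in> W"
  using assms unfolding ext_dom_def by blast

lemma ext_domI: "chart X Y U f W h h' \<Longrightarrow> W \<subseteq> ext_dom X Y U f"
  unfolding ext_dom_def by blast

lemma openin_ext_dom: "openin (zar X) (ext_dom X Y U f)"
  unfolding ext_dom_def using chartD(1) by (intro openin_Union) blast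

lemma dense_ext_dom: "zar X closure_of (ext_dom X Y U f) = pts X"
  using closure_of_mono [OF ext_domI [OF chart_self], of "zar X"] U(2) closure_of_subset_topspace by fast

lemma ext_map_morphism: "morphism (sub X (ext_dom X Y U f)) Y (ext_map X Y U f)"
proof (rule morphism_sub_local [OF variety_sheaf [OF X] openin_subset [OF openin_ext_dom]])
  fix x assume "x \<in> ext_dom X Y U f"
  then obtain W h h' where c: "chart X Y U f W h h'" "x \<in> W" by (rule ext_domE)
  have "morphism (sub X W) Y (ext_map X Y U f)"
    by (rule morphism_cong [OF function_sheaf_sub [OF variety_sheaf [OF X]] chartD(5) [OF c(1)]])
      (use ext_map_eq [OF c(1)] in \<open>simp add: pts_sub\<close>)
  then show "\<exists>W. openin (zar X) W \<and> x \<in> W \<and> W \<subseteq> ext_dom X Y U f \<and> morphism (sub X W) Y (ext_map X Y U f)"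
    by (intro exI [of _ W] conjI chartD(1) [OF c(1)] c(2) ext_domI [OF c(1)])
qed

end

text \<open>Local open immersions may glue to a map that is not injective. Here each chart of
  \<open>f\<close> inverts to a chart of \<open>f'\<close> and conversely, so the two glued maps are
  mutually inverse.\<close>

lemma ext_map_biso:
  assumes X: "variety X" and Y: "variety Y" and b: "biso X Y U V f f'"
    and U: "openin (zar X) U" "zar X closure_of U = pts X"
    and V: "openin (zar Y) V" "zar Y closure_of V = pts Y"
  shows "biso X Y (ext_dom X Y U f) (ext_dom Y X V f') (ext_map X Y U f) (ext_map Y X V f')"
proof -
  note XY = X Y b U V and YX = Y X biso_sym [OF b] V U
  have "ext_map X Y U f x \<in> ext_dom Y X V f' \<and> ext_map Y X V f' (ext_map X Y U f x) = x"
    if x: "x \<in> ext_dom X Y U f" for x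
  proof -
    obtain W h h' where c: "chart X Y U f W h h'" "x \<in> W" using x by (rule ext_domE [OF XY])
    have 1: "ext_map X Y U f x = h x" by (rule ext_map_eq [OF XY c])
    note c' = chart_inverse [OF XY c(1)]
    have hx: "h x \<in> h ` W" using c(2) by blast
    have "ext_map Y X V f' (h x) = h' (h x)" by (rule ext_map_eq [OF YX c' hx])
    then show ?thesis using 1 chartD(7) [OF c] ext_domI [OF YX c'] hx by auto
  qed
  moreover have "ext_map Y X V f' y \<in> ext_dom X Y U f \<and> ext_map X Y U f (ext_map Y X V f' y) = y"
    if y: "y \<in> ext_dom Y X V f'" for y
  proof -
    obtain W h h' where c: "chart Y X V f' W h h'" "y \<in> W" using y by (rule ext_domE [OF YX])
    have 1: "ext_map Y X V f' y = h y" by (rule ext_map_eq [OF YX c])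
    note c' = chart_inverse [OF YX c(1)]
    have hx: "h y \<in> h ` W" using c(2) by blast
    have "ext_map X Y U f (h y) = h' (h y)" by (rule ext_map_eq [OF XY c' hx])
    then show ?thesis using 1 chartD(7) [OF c] ext_domI [OF XY c'] hx by auto
  qed
  ultimately show ?thesis
    unfolding biso_def
    using ext_map_morphism [OF XY] ext_map_morphism [OF YX] openin_subset [OF openin_ext_dom [OF XY]]
      openin_subset [OF openin_ext_dom [OF YX]] by simp
qed


subsection \<open>Equivariance\<close>

definition G_var :: "('g, 'm) monoid_scheme \<Rightarrow> ('a, 'k::field) fspace \<Rightarrow> ('g \<Rightarrow> 'a \<Rightarrow> 'a) \<Rightarrow> bool" where
  "G_var G X \<alpha> \<longleftrightarrow> variety X \<and> group_action G (pts X) \<alpha> \<and> (\<forall>g\<in>carrier G. morphism X X (\<alpha> g))"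

lemma G_var_variety: "G_var G X \<alpha> \<Longrightarrow> variety X"
  by (simp add: G_var_def)

lemma G_var_sheaf: "G_var G X \<alpha> \<Longrightarrow> function_sheaf X"
  by (simp add: G_var_def variety_sheaf)

lemma G_var_group: "G_var G X \<alpha> \<Longrightarrow> group G"
  by (simp add: G_var_def group_action_def group_hom_def)

lemma G_var_inv:
  assumes "G_var G X \<alpha>" "g \<in> carrier G" "x \<in> pts X"
  shows "\<alpha> g x \<in> pts X" "\<alpha> (inv\<^bsub>G\<^esub> g) (\<alpha> g x) = x" "\<alpha> g (\<alpha> (inv\<^bsub>G\<^esub> g) x) = x" "\<alpha> (inv\<^bsub>G\<^esub> g) x \<in> pts X"
proof -
  interpret group G by (rule G_var_group [OF assms(1)])
  have act: "group_action G (pts X) \<alpha>" using assms(1) by (simp add: G_var_def)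
  have m: "\<alpha> h y \<in> pts X" if "h \<in> carrier G" "y \<in> pts X" for h y
    using group_action.element_image [OF act that refl] .
  have i: "inv\<^bsub>G\<^esub> g \<in> carrier G" using assms(2) by simp
  show "\<alpha> g x \<in> pts X" "\<alpha> (inv\<^bsub>G\<^esub> g) x \<in> pts X" using m assms i by blast+
  show "\<alpha> (inv\<^bsub>G\<^esub> g) (\<alpha> g x) = x"
    using group_action.orbit_sym_aux [OF act assms(2,3) refl] .
  have "\<alpha> (inv\<^bsub>G\<^esub> (inv\<^bsub>G\<^esub> g)) (\<alpha> (inv\<^bsub>G\<^esub> g) x) = x"
    using group_action.orbit_sym_aux [OF act i assms(3) refl] .
  then show "\<alpha> g (\<alpha> (inv\<^bsub>G\<^esub> g) x) = x" using assms(2) by simp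
qed

lemma G_var_mult:
  assumes "G_var G X \<alpha>" "g \<in> carrier G" "h \<in> carrier G" "x \<in> pts X"
  shows "\<alpha> (g \<otimes>\<^bsub>G\<^esub> h) x = \<alpha> g (\<alpha> h x)"
  using assms group_action.composition_rule [of G "pts X" \<alpha>] by (simp add: G_var_def)

lemma G_var_one:
  assumes "G_var G X \<alpha>" "x \<in> pts X" shows "\<alpha> \<one>\<^bsub>G\<^esub> x = x"
proof -
  have act: "group_action G (pts X) \<alpha>" using assms(1) by (simp add: G_var_def)
  show ?thesis using fun_cong [OF group_action.id_eq_one [OF act], of x] assms(2) by simp
qed

lemma G_var_biso:
  assumes "G_var G X \<alpha>" "g \<in> carrier G"
  shows "biso X X (pts X) (pts X) (\<alpha> g) (\<alpha> (inv\<^bsub>G\<^esub> g))"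
proof -
  interpret group G by (rule G_var_group [OF assms(1)])
  show ?thesis
    using assms G_var_inv [OF assms] unfolding biso_def G_var_def by (auto intro: morphism_restrict)
qed

lemma G_var_biso_sub:
  assumes "G_var G X \<alpha>" "g \<in> carrier G" "A \<subseteq> pts X"
  shows "biso X X A (\<alpha> g ` A) (\<alpha> g) (\<alpha> (inv\<^bsub>G\<^esub> g))"
  by (rule biso_restrict [OF G_var_sheaf [OF assms(1)] G_var_sheaf [OF assms(1)] G_var_biso [OF assms(1,2)] assms(3)])

lemma G_var_homeomorphic:
  assumes "G_var G X \<alpha>" "g \<in> carrier G" shows "homeomorphic_map (zar X) (zar X) (\<alpha> g)"
  using biso_homeomorphic_map [OF G_var_sheaf [OF assms(1)] G_var_sheaf [OF assms(1)] G_var_biso [OF assms]]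
  by simp

lemma G_var_openin:
  assumes "G_var G X \<alpha>" "g \<in> carrier G" "openin (zar X) A" shows "openin (zar X) (\<alpha> g ` A)"
  using G_var_homeomorphic [OF assms(1,2)] assms(3) homeomorphic_map_openness_eq by metis

text \<open>\<open>equivariant_birational\<close> with both open sets and both maps made explicit.
  Stability of \<open>B\<close> and equivariance of \<open>g\<close> follow, see
  \<open>eqbir_sym\<close>.\<close>

definition eqbir :: "('g, 'm) monoid_scheme \<Rightarrow> ('a, 'k::field) fspace \<Rightarrow> ('g \<Rightarrow> 'a \<Rightarrow> 'a) \<Rightarrow>
    ('b, 'k) fspace \<Rightarrow> ('g \<Rightarrow> 'b \<Rightarrow> 'b) \<Rightarrow> 'a set \<Rightarrow> 'b set \<Rightarrow> ('a \<Rightarrow> 'b) \<Rightarrow> ('b \<Rightarrow> 'a) \<Rightarrow> bool" where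
  "eqbir G X \<alpha> Y \<beta> A B f g \<longleftrightarrow> biso X Y A B f g \<and> openin (zar X) A \<and> zar X closure_of A = pts X \<and>
     openin (zar Y) B \<and> zar Y closure_of B = pts Y \<and>
     (\<forall>\<gamma>\<in>carrier G. \<alpha> \<gamma> ` A = A \<and> (\<forall>x\<in>A. f (\<alpha> \<gamma> x) = \<beta> \<gamma> (f x)))"

lemma eqbirD:
  assumes "eqbir G X \<alpha> Y \<beta> A B f g"
  shows "biso X Y A B f g" "openin (zar X) A" "zar X closure_of A = pts X"
     "openin (zar Y) B" "zar Y closure_of B = pts Y"
     "\<And>\<gamma>. \<gamma> \<in> carrier G \<Longrightarrow> \<alpha> \<gamma> ` A = A" "\<And>\<gamma> x. \<gamma> \<in> carrier G \<Longrightarrow> x \<in> A \<Longrightarrow> f (\<alpha> \<gamma> x) = \<beta> \<gamma> (f x)"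
     "A \<subseteq> pts X" "B \<subseteq> pts Y" "f ` A = B" "g ` B = A"
     "\<And>x. x \<in> A \<Longrightarrow> f x \<in> B" "\<And>y. y \<in> B \<Longrightarrow> g y \<in> A" "\<And>x. x \<in> A \<Longrightarrow> g (f x) = x" "\<And>y. y \<in> B \<Longrightarrow> f (g y) = y"
proof -
  show b: "biso X Y A B f g" using assms by (simp add: eqbir_def)
  show "openin (zar X) A" "zar X closure_of A = pts X" "openin (zar Y) B" "zar Y closure_of B = pts Y"
    "\<And>\<gamma>. \<gamma> \<in> carrier G \<Longrightarrow> \<alpha> \<gamma> ` A = A" "\<And>\<gamma> x. \<gamma> \<in> carrier G \<Longrightarrow> x \<in> A \<Longrightarrow> f (\<alpha> \<gamma> x) = \<beta> \<gamma> (f x)"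
    using assms by (simp_all add: eqbir_def)
  show "f ` A = B" "g ` B = A" using biso_image [OF b] biso_image [OF biso_sym [OF b]] .
  show "A \<subseteq> pts X" "B \<subseteq> pts Y" "\<And>x. x \<in> A \<Longrightarrow> f x \<in> B" "\<And>y. y \<in> B \<Longrightarrow> g y \<in> A"
    "\<And>x. x \<in> A \<Longrightarrow> g (f x) = x" "\<And>y. y \<in> B \<Longrightarrow> f (g y) = y"
    using b by (simp_all add: biso_def)
qed

lemma eqbir_sym:
  assumes e: "eqbir G X \<alpha> Y \<beta> A B f g" shows "eqbir G Y \<beta> X \<alpha> B A g f"
proof -
  note d = eqbirD [OF e]
  have "\<beta> \<gamma> ` B = B" if \<gamma>: "\<gamma> \<in> carrier G" for \<gamma>
  proof -
    have "\<beta> \<gamma> ` f ` A = f ` \<alpha> \<gamma> ` A" using d(7) [OF \<gamma>] by force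
    then show ?thesis using d(6) [OF \<gamma>] d(10) by simp
  qed
  moreover have "g (\<beta> \<gamma> y) = \<alpha> \<gamma> (g y)" if \<gamma>: "\<gamma> \<in> carrier G" and y: "y \<in> B" for \<gamma> y
  proof -
    have gy: "g y \<in> A" using d(13) y by blast
    then have "\<alpha> \<gamma> (g y) \<in> A" using d(6) [OF \<gamma>] by blast
    moreover have "\<beta> \<gamma> y = f (\<alpha> \<gamma> (g y))" using d(7) [OF \<gamma> gy] d(15) y by simp
    ultimately show ?thesis using d(14) by simp
  qed
  ultimately show ?thesis using d biso_sym [OF d(1)] unfolding eqbir_def by blast
qed

lemma eqbir_imp_equivariant_birational:
  assumes "function_sheaf X" "function_sheaf Y" "eqbir G X \<alpha> Y \<beta> A B f g"
  shows "equivariant_birational G X \<alpha> Y \<beta> (A, f)"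
proof -
  note d = eqbirD [OF assms(3)] and d' = eqbirD [OF eqbir_sym [OF assms(3)]]
  show ?thesis
    unfolding equivariant_birational_def
    using d d'(6) biso_imp_isomorphism [OF assms(1,2) d(1)] by auto
qed

lemma equivariant_birational_imp_eqbir:
  assumes "function_sheaf X" "function_sheaf Y" "equivariant_birational G X \<alpha> Y \<beta> \<phi>"
  shows "eqbir G X \<alpha> Y \<beta> (fst \<phi>) (snd \<phi> ` fst \<phi>) (snd \<phi>) (inv_into (fst \<phi>) (snd \<phi>))"
proof -
  obtain U f where \<phi>: "\<phi> = (U, f)" by (cases \<phi>)
  have e: "openin (zar X) U" "zar X closure_of U = pts X" "openin (zar Y) (f ` U)" "zar Y closure_of (f ` U) = pts Y"
    "isomorphism (sub X U) (sub Y (f ` U)) f"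
    "\<forall>g\<in>carrier G. \<alpha> g ` U = U \<and> \<beta> g ` f ` U = f ` U \<and> (\<forall>x\<in>U. f (\<alpha> g x) = \<beta> g (f x))"
    using assms(3) by (auto simp: equivariant_birational_def \<phi>)
  have "biso X Y U (f ` U) f (inv_into U f)"
    by (rule isomorphism_imp_biso [OF openin_subset [OF e(1)] openin_subset [OF e(3)] e(5)])
  then show ?thesis using e by (simp add: eqbir_def \<phi>)
qed

lemma eqbir_compose:
  assumes sh: "function_sheaf X" "function_sheaf Y" "function_sheaf Z" and Y: "G_var G Y \<beta>"
    and e1: "eqbir G X \<alpha> Y \<beta> A1 B1 f1 g1" and e2: "eqbir G Y \<beta> Z \<gamma> A2 B2 f2 g2"
  shows "eqbir G X \<alpha> Z \<gamma> {x \<in> A1. f1 x \<in> A2} (f2 ` (B1 \<inter> A2)) (\<lambda>x. f2 (f1 x)) (\<lambda>z. g1 (g2 z))"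
proof -
  note d1 = eqbirD [OF e1] and d2 = eqbirD [OF e2]
  note s1 = eqbirD [OF eqbir_sym [OF e1]]
  let ?W = "{x \<in> A1. f1 x \<in> A2}"
  \<comment> \<open>As the image of an open dense subset of \<open>B1\<close> under an isomorphism,
    the domain of the composite is open and dense.\<close>
  have W: "?W = g1 ` (B1 \<inter> A2)"
  proof
    show "?W \<subseteq> g1 ` (B1 \<inter> A2)"
    proof
      fix x assume "x \<in> ?W"
      then show "x \<in> g1 ` (B1 \<inter> A2)" using d1(12,14) by (intro image_eqI [of _ _ "f1 x"]) auto
    qed
    show "g1 ` (B1 \<inter> A2) \<subseteq> ?W" using d1(13,15) by auto
  qed
  have fW: "f1 ` ?W = B1 \<inter> A2"
  proof -
    have "f1 ` g1 ` (B1 \<inter> A2) = B1 \<inter> A2" using d1(15) by force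
    then show ?thesis by (simp add: W)
  qed
  have BA: "openin (zar Y) (B1 \<inter> A2)" using d1 d2 by auto
  have b1: "biso X Y ?W (B1 \<inter> A2) f1 g1"
    using biso_restrict [OF sh(1,2) d1(1), of ?W] unfolding fW by auto
  have b2: "biso Y Z (B1 \<inter> A2) (f2 ` (B1 \<inter> A2)) f2 g2"
    by (rule biso_restrict [OF sh(2,3) d2(1)]) simp
  have oW: "openin (zar X) ?W"
    unfolding W by (rule biso_openin_image [OF sh(2,1) biso_sym [OF d1(1)] d1(2) BA]) simp
  have oZ: "openin (zar Z) (f2 ` (B1 \<inter> A2))"
    by (rule biso_openin_image [OF sh(2,3) d2(1,4) BA]) simp
  have "A1 \<subseteq> zar X closure_of ?W"
    unfolding W
    by (rule biso_dense_image [OF sh(2,1) biso_sym [OF d1(1)] _ dense_Int_open [OF d2(3) d1(4)]]) simp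
  then have "zar X closure_of A1 \<subseteq> zar X closure_of ?W" by (rule closure_of_minimal) simp
  then have cW: "zar X closure_of ?W = pts X" using d1(3) closure_of_subset_topspace by fast
  have "A2 \<subseteq> zar Y closure_of (A2 \<inter> B1)" by (rule dense_Int_open [OF d1(5) d2(2)])
  then have "B2 \<subseteq> zar Z closure_of (f2 ` (B1 \<inter> A2))"
    by (intro biso_dense_image [OF sh(2,3) d2(1)]) (auto simp: Int_commute)
  then have "zar Z closure_of B2 \<subseteq> zar Z closure_of (f2 ` (B1 \<inter> A2))" by (rule closure_of_minimal) simp
  then have cZ: "zar Z closure_of (f2 ` (B1 \<inter> A2)) = pts Z" using d2(5) closure_of_subset_topspace by fast
  have "\<alpha> h ` ?W = ?W" if h: "h \<in> carrier G" for h
  proof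
    show "\<alpha> h ` ?W \<subseteq> ?W"
    proof
      fix x assume "x \<in> \<alpha> h ` ?W"
      then obtain w where w: "w \<in> A1" "f1 w \<in> A2" "x = \<alpha> h w" by blast
      then have "x \<in> A1" "f1 x \<in> A2" using d1(6,7) [OF h] d2(6) [OF h] by auto
      then show "x \<in> ?W" by simp
    qed
    show "?W \<subseteq> \<alpha> h ` ?W"
    proof
      fix x assume x: "x \<in> ?W"
      then obtain x' where x': "x' \<in> A1" "x = \<alpha> h x'" using d1(6) [OF h] by auto
      obtain z where z: "z \<in> A2" "f1 x = \<beta> h z" using x d2(6) [OF h] by auto
      have "\<beta> h z = \<beta> h (f1 x')" using d1(7) [OF h x'(1)] x'(2) z(2) by simp
      moreover have "z \<in> pts Y" "f1 x' \<in> pts Y" using z(1) x'(1) d1(9,12) d2(8) by auto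
      ultimately have "z = f1 x'" using G_var_inv(2) [OF Y h] by metis
      then show "x \<in> \<alpha> h ` ?W" using x' z(1) by blast
    qed
  qed
  then show ?thesis
    unfolding eqbir_def using biso_compose [OF sh(1,3) b1 b2] oW oZ cW cZ d1(7) d2(7) by auto
qed

text \<open>The last clause says that \<open>f\<close> cannot be extended to a larger open set as a local open immersion.\<close>

definition maxbir :: "('g, 'm) monoid_scheme \<Rightarrow> ('a, 'k::field) fspace \<Rightarrow> ('g \<Rightarrow> 'a \<Rightarrow> 'a) \<Rightarrow>
    ('b, 'k) fspace \<Rightarrow> ('g \<Rightarrow> 'b \<Rightarrow> 'b) \<Rightarrow> 'a set \<Rightarrow> 'b set \<Rightarrow> ('a \<Rightarrow> 'b) \<Rightarrow> ('b \<Rightarrow> 'a) \<Rightarrow> bool" where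
  "maxbir G X \<alpha> Y \<beta> A B f g \<longleftrightarrow> eqbir G X \<alpha> Y \<beta> A B f g \<and>
     (\<forall>W h h' O1. openin (zar X) W \<and> openin (zar Y) (h ` W) \<and> biso X Y W (h ` W) h h' \<and>
        openin (zar X) O1 \<and> O1 \<subseteq> W \<inter> A \<and> W \<subseteq> zar X closure_of O1 \<and> (\<forall>x\<in>O1. h x = f x) \<longrightarrow>
        W \<subseteq> A \<and> (\<forall>x\<in>W. h x = f x))"

lemma maxbir_eqbir: "maxbir G X \<alpha> Y \<beta> A B f g \<Longrightarrow> eqbir G X \<alpha> Y \<beta> A B f g"
  by (simp add: maxbir_def)

lemma maxbirD:
  assumes "maxbir G X \<alpha> Y \<beta> A B f g"
    and "openin (zar X) W" "openin (zar Y) (h ` W)" "biso X Y W (h ` W) h h'"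
    and "openin (zar X) O1" "O1 \<subseteq> W \<inter> A" "W \<subseteq> zar X closure_of O1" "\<And>x. x \<in> O1 \<Longrightarrow> h x = f x"
  shows "W \<subseteq> A" "\<And>x. x \<in> W \<Longrightarrow> h x = f x"
proof -
  have "W \<subseteq> A \<and> (\<forall>x\<in>W. h x = f x)"
    using assms(1) [unfolded maxbir_def, THEN conjunct2, THEN spec [of _ W], THEN spec [of _ h],
        THEN spec [of _ h'], THEN spec [of _ O1], THEN mp] assms(2-) by simp
  then show "W \<subseteq> A" "\<And>x. x \<in> W \<Longrightarrow> h x = f x" by blast+
qed

text \<open>Conjugating a chart by a group element gives a chart, because \<open>f\<close> itself is
  equivariant. The domain of the extension is therefore stable under the group and the extension
  equivariant.\<close>

lemma chart_translate:
  assumes X: "G_var G X \<alpha>" and Y: "G_var G Y \<beta>" and e: "eqbir G X \<alpha> Y \<beta> U V f f'"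
    and c: "chart X Y U f W h h'" and \<gamma>: "\<gamma> \<in> carrier G"
  shows "\<exists>k k'. chart X Y U f (\<alpha> \<gamma> ` W) k k' \<and> (\<forall>x\<in>W. k (\<alpha> \<gamma> x) = \<beta> \<gamma> (h x))"
proof -
  note sh = G_var_sheaf [OF X] G_var_sheaf [OF Y]
  note d = eqbirD [OF e] and c' = chartD [OF c]
  have Wp: "W \<subseteq> pts X" and hWp: "h ` W \<subseteq> pts Y" using openin_subset c'(1,2) by blast+
  define k where "k x = \<beta> \<gamma> (h (\<alpha> (inv\<^bsub>G\<^esub> \<gamma>) x))" for x
  have k: "k (\<alpha> \<gamma> x) = \<beta> \<gamma> (h x)" if "x \<in> W" for x
    using G_var_inv(2) [OF X \<gamma>, of x] that Wp by (auto simp: k_def)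
  have im: "k ` \<alpha> \<gamma> ` W = \<beta> \<gamma> ` h ` W" using k by force
  have "biso X X (\<alpha> \<gamma> ` W) W (\<alpha> (inv\<^bsub>G\<^esub> \<gamma>)) (\<alpha> \<gamma>)"
    by (rule biso_sym [OF G_var_biso_sub [OF X \<gamma> Wp]])
  then have "biso X Y (\<alpha> \<gamma> ` W) (h ` W) (\<lambda>x. h (\<alpha> (inv\<^bsub>G\<^esub> \<gamma>) x)) (\<lambda>y. \<alpha> \<gamma> (h' y))"
    by (rule biso_compose [OF sh _ c'(3)])
  then have "biso X Y (\<alpha> \<gamma> ` W) (\<beta> \<gamma> ` h ` W) (\<lambda>x. \<beta> \<gamma> (h (\<alpha> (inv\<^bsub>G\<^esub> \<gamma>) x))) (\<lambda>y. \<alpha> \<gamma> (h' (\<beta> (inv\<^bsub>G\<^esub> \<gamma>) y)))"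
    by (rule biso_compose [OF sh _ G_var_biso_sub [OF Y \<gamma> hWp]])
  then have b: "biso X Y (\<alpha> \<gamma> ` W) (k ` \<alpha> \<gamma> ` W) k (\<lambda>y. \<alpha> \<gamma> (h' (\<beta> (inv\<^bsub>G\<^esub> \<gamma>) y)))"
    unfolding im k_def .
  have "k x = f x" if x: "x \<in> U \<inter> \<alpha> \<gamma> ` W" for x
  proof -
    obtain w where w: "w \<in> W" "x = \<alpha> \<gamma> w" using x by blast
    obtain u where u: "u \<in> U" "x = \<alpha> \<gamma> u" using x d(6) [OF \<gamma>] by auto
    have "u = w" using G_var_inv(2) [OF X \<gamma>] u w Wp d(8) by (metis subsetD)
    then show ?thesis using k [OF w(1)] c'(4) [of w] d(7) [OF \<gamma> u(1)] u w by simp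
  qed
  then have "chart X Y U f (\<alpha> \<gamma> ` W) k (\<lambda>y. \<alpha> \<gamma> (h' (\<beta> (inv\<^bsub>G\<^esub> \<gamma>) y)))"
    unfolding chart_def im using b [unfolded im] G_var_openin [OF X \<gamma> c'(1)] G_var_openin [OF Y \<gamma> c'(2)] by blast
  then show ?thesis using k by blast
qed

theorem maxbir_exists:
  assumes X: "G_var G X \<alpha>" and Y: "G_var G Y \<beta>" and e: "eqbir G X \<alpha> Y \<beta> U V f f'"
  shows "maxbir G X \<alpha> Y \<beta> (ext_dom X Y U f) (ext_dom Y X V f') (ext_map X Y U f) (ext_map Y X V f')"
    and "U \<subseteq> ext_dom X Y U f" and "\<And>x. x \<in> U \<Longrightarrow> ext_map X Y U f x = f x"
proof -
  note d = eqbirD [OF e] and vX = G_var_variety [OF X] and vY = G_var_variety [OF Y]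
  note XY = vX vY d(1-5) and YX = vY vX biso_sym [OF d(1)] d(4,5,2,3)
  let ?A = "ext_dom X Y U f" and ?H = "ext_map X Y U f"
  show U: "U \<subseteq> ?A" by (rule ext_domI [OF XY chart_self [OF XY]])
  show HU: "?H x = f x" if "x \<in> U" for x by (rule ext_map_eq [OF XY chart_self [OF XY] that])
  have A: "?A \<subseteq> pts X" by (rule openin_subset [OF openin_ext_dom [OF XY]])
  have stable: "\<alpha> \<gamma> x \<in> ?A \<and> ?H (\<alpha> \<gamma> x) = \<beta> \<gamma> (?H x)" if \<gamma>: "\<gamma> \<in> carrier G" and x: "x \<in> ?A" for \<gamma> x
  proof -
    obtain W h h' where c: "chart X Y U f W h h'" "x \<in> W" using x by (rule ext_domE [OF XY])
    obtain k k' where k: "chart X Y U f (\<alpha> \<gamma> ` W) k k'" "\<forall>x\<in>W. k (\<alpha> \<gamma> x) = \<beta> \<gamma> (h x)"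
      using chart_translate [OF X Y e c(1) \<gamma>] by blast
    have "\<alpha> \<gamma> x \<in> \<alpha> \<gamma> ` W" using c(2) by blast
    then show ?thesis
      using ext_map_eq [OF XY k(1)] ext_map_eq [OF XY c] k(2) c(2) ext_domI [OF XY k(1)] by auto
  qed
  have "\<alpha> \<gamma> ` ?A = ?A" if \<gamma>: "\<gamma> \<in> carrier G" for \<gamma>
  proof
    show "\<alpha> \<gamma> ` ?A \<subseteq> ?A" using stable [OF \<gamma>] by blast
    show "?A \<subseteq> \<alpha> \<gamma> ` ?A"
    proof
      fix x assume x: "x \<in> ?A"
      interpret group G by (rule G_var_group [OF X])
      have "\<alpha> (inv\<^bsub>G\<^esub> \<gamma>) x \<in> ?A" using stable [of "inv\<^bsub>G\<^esub> \<gamma>"] \<gamma> x by simp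
      moreover have "x = \<alpha> \<gamma> (\<alpha> (inv\<^bsub>G\<^esub> \<gamma>) x)" using G_var_inv(3) [OF X \<gamma>] x A by auto
      ultimately show "x \<in> \<alpha> \<gamma> ` ?A" by blast
    qed
  qed
  then have eq: "eqbir G X \<alpha> Y \<beta> ?A (ext_dom Y X V f') ?H (ext_map Y X V f')"
    unfolding eqbir_def
    using ext_map_biso [OF XY] openin_ext_dom [OF XY] openin_ext_dom [OF YX]
      dense_ext_dom [OF XY] dense_ext_dom [OF YX] stable by blast
  show "maxbir G X \<alpha> Y \<beta> ?A (ext_dom Y X V f') ?H (ext_map Y X V f')"
    unfolding maxbir_def
  proof (rule conjI, rule eq, intro allI impI)
    fix W h h' O1
    assume "openin (zar X) W \<and> openin (zar Y) (h ` W) \<and> biso X Y W (h ` W) h h' \<and>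
        openin (zar X) O1 \<and> O1 \<subseteq> W \<inter> ?A \<and> W \<subseteq> zar X closure_of O1 \<and> (\<forall>x\<in>O1. h x = ?H x)"
    then have W: "openin (zar X) W" "openin (zar Y) (h ` W)" "biso X Y W (h ` W) h h'"
      and O1: "openin (zar X) O1" "O1 \<subseteq> W \<inter> ?A" "W \<subseteq> zar X closure_of O1" "\<And>x. x \<in> O1 \<Longrightarrow> h x = ?H x"
      by blast+
    \<comment> \<open>A map that agrees with the extension on \<open>O1\<close> agrees with
      \<open>f\<close> on the still dense part \<open>O1 \<inter> U\<close>, so it is a chart
      already included in the union.\<close>
    have "W \<subseteq> zar X closure_of (O1 \<inter> U)"
      by (rule dense_trans [OF O1(3) dense_Int_open [OF d(3) O1(1)]])
    then have c: "chart X Y U f W h h'"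
      using O1 HU d(2) by (intro chartI_dense [OF XY W, of "O1 \<inter> U"]) auto
    show "W \<subseteq> ?A \<and> (\<forall>x\<in>W. h x = ?H x)"
      using ext_domI [OF XY c] ext_map_eq [OF XY c] by simp
  qed
qed


subsection \<open>Composition\<close>

text \<open>\<open>f3 = f2 \<circ> f1\<close> as rational maps. The identity is witnessed on some
  dense open set, which leaves the relation between the maximal domains open.\<close>

definition triangle :: "('a, 'k) fspace \<Rightarrow> 'a set \<Rightarrow> ('a \<Rightarrow> 'b) \<Rightarrow> 'b set \<Rightarrow> ('b \<Rightarrow> 'c) \<Rightarrow> 'a set \<Rightarrow> ('a \<Rightarrow> 'c) \<Rightarrow> bool" where
  "triangle X A1 f1 A2 f2 A3 f3 \<longleftrightarrow> (\<exists>O1. openin (zar X) O1 \<and> zar X closure_of O1 = pts X \<and>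
     O1 \<subseteq> A1 \<inter> A3 \<and> f1 ` O1 \<subseteq> A2 \<and> (\<forall>x\<in>O1. f3 x = f2 (f1 x)))"

text \<open>The same commuting triangle seen from \<open>Y\<close>, as
  \<open>f2 = f3 \<circ> g1\<close>; together with \<open>triangle_rotate_right\<close> it makes the
  roles of the three maps interchangeable.\<close>

lemma triangle_rotate_left:
  assumes sh: "function_sheaf X" "function_sheaf Y" and e: "eqbir G X \<alpha> Y \<beta> A1 B1 f1 g1"
    and t: "triangle X A1 f1 A2 f2 A3 f3"
  shows "triangle Y B1 g1 A3 f3 A2 f2"
proof -
  note d = eqbirD [OF e]
  obtain O1 where O1: "openin (zar X) O1" "zar X closure_of O1 = pts X" "O1 \<subseteq> A1 \<inter> A3" "f1 ` O1 \<subseteq> A2"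
    "\<And>x. x \<in> O1 \<Longrightarrow> f3 x = f2 (f1 x)"
    using t unfolding triangle_def by blast
  have gf: "g1 (f1 x) = x" if "x \<in> O1" for x using d(14) O1(3) that by blast
  have "B1 \<subseteq> zar Y closure_of (f1 ` O1)"
    using O1 d(8) by (intro biso_dense_image [OF sh d(1)]) auto
  then have "zar Y closure_of B1 \<subseteq> zar Y closure_of (f1 ` O1)" by (rule closure_of_minimal) simp
  then have "zar Y closure_of (f1 ` O1) = pts Y" using d(5) closure_of_subset_topspace by fast
  moreover have "openin (zar Y) (f1 ` O1)"
    using O1 by (intro biso_openin_image [OF sh d(1,4)]) auto
  moreover have "f1 ` O1 \<subseteq> B1 \<inter> A2" using O1 d(12) by blast
  moreover have "g1 ` f1 ` O1 \<subseteq> A3" using gf O1(3) by auto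
  moreover have "\<forall>y\<in>f1 ` O1. f2 y = f3 (g1 y)" using gf O1(5) by auto
  ultimately show ?thesis unfolding triangle_def by blast
qed

lemma triangle_rotate_right:
  assumes e: "eqbir G Y \<beta> Z \<gamma> A2 B2 f2 g2" and t: "triangle X A1 f1 A2 f2 A3 f3"
  shows "triangle X A3 f3 B2 g2 A1 f1"
proof -
  note d = eqbirD [OF e]
  obtain O1 where O1: "openin (zar X) O1" "zar X closure_of O1 = pts X" "O1 \<subseteq> A1 \<inter> A3" "f1 ` O1 \<subseteq> A2"
    "\<And>x. x \<in> O1 \<Longrightarrow> f3 x = f2 (f1 x)"
    using t unfolding triangle_def by blast
  have "f3 ` O1 \<subseteq> B2"
  proof
    fix z assume "z \<in> f3 ` O1"
    then obtain x where "x \<in> O1" "z = f2 (f1 x)" using O1(5) by auto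
    then show "z \<in> B2" using O1(4) d(12) by blast
  qed
  moreover have "\<forall>x\<in>O1. f1 x = g2 (f3 x)"
  proof
    fix x assume x: "x \<in> O1"
    then have "f1 x \<in> A2" using O1(4) by blast
    then show "f1 x = g2 (f3 x)" using O1(5) [OF x] d(14) by simp
  qed
  ultimately show ?thesis unfolding triangle_def using O1(1-3) by blast
qed

text \<open>The composite of the open immersions \<open>f1\<close> and \<open>f2\<close> is an open
  immersion on its natural domain and agrees with \<open>f3\<close> on a dense open subset;
  maximality of \<open>f3\<close> absorbs it.\<close>

lemma triangle_compose:
  assumes X: "G_var G X \<alpha>" and Y: "G_var G Y \<beta>" and Z: "G_var G Z \<gamma>"
    and e1: "eqbir G X \<alpha> Y \<beta> A1 B1 f1 g1" and e2: "eqbir G Y \<beta> Z \<gamma> A2 B2 f2 g2"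
    and m3: "maxbir G X \<alpha> Z \<gamma> A3 B3 f3 g3" and t: "triangle X A1 f1 A2 f2 A3 f3"
    and x: "x \<in> A1" "f1 x \<in> A2"
  shows "x \<in> A3" "f3 x = f2 (f1 x)"
proof -
  note sh = G_var_sheaf [OF X] G_var_sheaf [OF Y] G_var_sheaf [OF Z]
  let ?W = "{x \<in> A1. f1 x \<in> A2}" and ?h = "\<lambda>x. f2 (f1 x)"
  note e = eqbir_compose [OF sh Y e1 e2]
  note d = eqbirD [OF e]
  obtain O1 where O1: "openin (zar X) O1" "zar X closure_of O1 = pts X" "O1 \<subseteq> A1 \<inter> A3" "f1 ` O1 \<subseteq> A2"
    "\<And>x. x \<in> O1 \<Longrightarrow> f3 x = f2 (f1 x)"
    using t unfolding triangle_def by blast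
  have o: "openin (zar Z) (?h ` ?W)" unfolding d(10) by (rule d(4))
  have b: "biso X Z ?W (?h ` ?W) ?h (\<lambda>z. g1 (g2 z))" unfolding d(10) by (rule d(1))
  have s: "O1 \<subseteq> ?W \<inter> A3" using O1(3,4) by blast
  have c: "?W \<subseteq> zar X closure_of O1" unfolding O1(2) by (rule d(8))
  note res = maxbirD [OF m3 d(2) o b O1(1) s c O1(5) [symmetric]]
  have "x \<in> ?W" using x by simp
  then show "x \<in> A3" "f3 x = f2 (f1 x)" using res(1) res(2) [of x] by auto
qed


subsection \<open>Transfer of divisors\<close>

definition prime_div :: "('a, 'k) fspace \<Rightarrow> 'a set \<Rightarrow> bool" where
  "prime_div X S \<longleftrightarrow> closedin (zar X) S \<and> irreducible_in (zar X) S \<and>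
     krull_dim (subtopology (zar X) S) + 1 = krull_dim (zar X)"

text \<open>The strict transform of \<open>S\<close> if \<open>S\<close> meets \<open>A\<close>;
  otherwise the empty set, as a default value.\<close>

definition transfer :: "('b, 'k) fspace \<Rightarrow> 'a set \<Rightarrow> ('a \<Rightarrow> 'b) \<Rightarrow> 'a set \<Rightarrow> 'b set" where
  "transfer Y A f S = zar Y closure_of (f ` (S \<inter> A))"

lemma transfer_Int:
  assumes sh: "function_sheaf X" "function_sheaf Y" and b: "biso X Y A B f g"
    and S: "closedin (zar X) S"
  shows "transfer Y A f S \<inter> B = f ` (S \<inter> A)"
proof -
  have fS: "f ` (S \<inter> A) \<subseteq> B" using biso_image [OF b] by blast
  have "closedin (subtopology (zar X) A) (S \<inter> A)" using S by (auto simp: closedin_subtopology)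
  then have "closedin (subtopology (zar Y) B) (f ` (S \<inter> A))"
    using biso_homeomorphic_map [OF sh b] homeomorphic_map_closedness_eq by metis
  then have "subtopology (zar Y) B closure_of (f ` (S \<inter> A)) = f ` (S \<inter> A)"
    by (rule closure_of_closedin)
  then show ?thesis
    using fS unfolding transfer_def closure_of_subtopology by (simp add: Int_absorb1 Int_commute)
qed

text \<open>The trace of an irreducible \<open>S\<close> on a smaller open set is dense in its trace
  on \<open>A\<close>. Strict transforms along maps with different domains can thus be compared on a
  common open set.\<close>

lemma transfer_open:
  assumes sh: "function_sheaf X" "function_sheaf Y" and b: "biso X Y A B f g" and A: "openin (zar X) A"
    and S: "irreducible_in (zar X) S" and O1: "openin (zar X) O1" "O1 \<subseteq> A" "S \<inter> O1 \<noteq> {}"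
  shows "transfer Y A f S = zar Y closure_of (f ` (S \<inter> O1))"
proof
  have SA: "S \<inter> A \<inter> O1 = S \<inter> O1" using O1(2) by blast
  have "irreducible_in (zar X) (S \<inter> A)" by (rule irreducible_in_Int_open(1) [OF S A]) (use O1 in blast)
  then have d: "S \<inter> A \<subseteq> zar X closure_of (S \<inter> O1)"
    using irreducible_in_Int_open(2) [of "zar X" "S \<inter> A" O1] O1 SA by simp
  have "f ` (S \<inter> A) \<subseteq> zar Y closure_of (f ` (S \<inter> O1))"
    by (rule biso_dense_image [OF sh biso_restrict [OF sh b] _ d]) (use O1 in auto)
  then show "transfer Y A f S \<subseteq> zar Y closure_of (f ` (S \<inter> O1))"
    unfolding transfer_def by (rule closure_of_minimal) simp
  show "zar Y closure_of (f ` (S \<inter> O1)) \<subseteq> transfer Y A f S"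
    unfolding transfer_def by (rule closure_of_mono) (use O1 in blast)
qed

text \<open>\<open>S\<close>, its trace on \<open>A\<close>, the trace of the transform on
  \<open>B\<close> and the transform itself have the same dimension: the outer equalities by
  \<open>krull_dim_open_variety\<close>, the middle one because \<open>f\<close> is a homeomorphism
  between the traces.\<close>

lemma transfer_prime_div:
  fixes X :: "('a, 'k::{alg_closed_field, field_char_0}) fspace" and Y :: "('b, 'k) fspace"
  assumes X: "prevariety X" and Y: "prevariety Y" and b: "biso X Y A B f g"
    and A: "openin (zar X) A" and B: "openin (zar Y) B" and dim: "krull_dim (zar X) = krull_dim (zar Y)"
    and S: "prime_div X S" "S \<inter> A \<noteq> {}"
  shows "prime_div Y (transfer Y A f S)" "transfer Y A f S \<inter> B \<noteq> {}"
    "transfer X B g (transfer Y A f S) = S"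
proof -
  note sh = prevariety_function_sheaf [OF X] prevariety_function_sheaf [OF Y]
  let ?S = "transfer Y A f S"
  have Sc: "closedin (zar X) S" "irreducible_in (zar X) S" using S(1) by (auto simp: prime_div_def)
  have int: "?S \<inter> B = f ` (S \<inter> A)" by (rule transfer_Int [OF sh b Sc(1)])
  then show ne: "?S \<inter> B \<noteq> {}" using S(2) by simp
  have "irreducible_in (subtopology (zar X) A) (S \<inter> A)"
    using irreducible_in_Int_open(1) [OF Sc(2) A S(2)] by (simp add: irreducible_in_subtopology)
  then have "irreducible_in (subtopology (zar Y) B) (f ` (S \<inter> A))"
    by (rule irreducible_in_image [OF homeomorphic_imp_continuous_map [OF biso_homeomorphic_map [OF sh b]]])
  then have "irreducible_in (zar Y) (f ` (S \<inter> A))" by (simp add: irreducible_in_subtopology)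
  then have irr: "irreducible_in (zar Y) ?S" unfolding transfer_def by (rule irreducible_in_closure_of)
  have cl: "closedin (zar Y) ?S" by (simp add: transfer_def)
  have "biso X Y (S \<inter> A) (f ` (S \<inter> A)) f g" by (rule biso_restrict [OF sh b]) simp
  then have "subtopology (zar X) (S \<inter> A) homeomorphic_space subtopology (zar Y) (f ` (S \<inter> A))"
    using biso_homeomorphic_maps [OF sh] unfolding homeomorphic_space_def by blast
  then have "krull_dim (subtopology (zar X) (S \<inter> A)) = krull_dim (subtopology (zar Y) (?S \<inter> B))"
    unfolding int by (rule krull_dim_homeomorphic)
  then have "krull_dim (subtopology (zar Y) ?S) = krull_dim (subtopology (zar X) S)"
    using krull_dim_open_variety [OF X Sc A S(2)] krull_dim_open_variety [OF Y cl irr B ne] by simp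
  then show "prime_div Y ?S" using S(1) cl irr dim by (simp add: prime_div_def)
  have "(\<lambda>x. g (f x)) ` (S \<inter> A) = (\<lambda>x. x) ` (S \<inter> A)"
    using b by (intro image_cong) (simp_all add: biso_def)
  then have "g ` (?S \<inter> B) = S \<inter> A" unfolding int by (simp add: image_image)
  then show "transfer X B g ?S = S"
    using irreducible_closed_eq_closure_of_Int_open [OF Sc(2,1) A S(2)] by (simp add: transfer_def)
qed

text \<open>The irreducible transform of \<open>S\<close> in \<open>Y\<close> meets both
  \<open>B1\<close> and \<open>A2\<close>, hence their intersection, so \<open>S\<close> meets the
  domain \<open>?W\<close> of the composite. There \<open>f3\<close> is
  \<open>f2 \<circ> f1\<close>, and the strict transforms may be computed on \<open>?W\<close> and
  its image.\<close>

lemma transfer_compose: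
  fixes X :: "('a, 'k::{alg_closed_field, field_char_0}) fspace"
  assumes X: "G_var G X \<alpha>" and Y: "G_var G Y \<beta>" and Z: "G_var G Z \<gamma>"
    and e1: "eqbir G X \<alpha> Y \<beta> A1 B1 f1 g1" and e2: "eqbir G Y \<beta> Z \<gamma> A2 B2 f2 g2"
    and m3: "maxbir G X \<alpha> Z \<gamma> A3 B3 f3 g3" and t: "triangle X A1 f1 A2 f2 A3 f3"
    and dim: "krull_dim (zar X) = krull_dim (zar Y)"
    and S: "prime_div X S" "S \<inter> A1 \<noteq> {}" "transfer Y A1 f1 S \<inter> A2 \<noteq> {}"
  shows "S \<inter> A3 \<noteq> {}" "transfer Z A3 f3 S = transfer Z A2 f2 (transfer Y A1 f1 S)"
proof -
  note sh = G_var_sheaf [OF X] G_var_sheaf [OF Y] G_var_sheaf [OF Z]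
  have pX: "prevariety X" and pY: "prevariety Y" using X Y by (auto simp: G_var_def variety_def)
  note d1 = eqbirD [OF e1] and d2 = eqbirD [OF e2] and d3 = eqbirD [OF maxbir_eqbir [OF m3]]
  let ?W = "{x \<in> A1. f1 x \<in> A2}" and ?S = "transfer Y A1 f1 S"
  note dW = eqbirD [OF eqbir_compose [OF sh Y e1 e2]]
  note tr = transfer_prime_div [OF pX pY d1(1,2,4) dim S(1,2)]
  have irrS: "irreducible_in (zar X) S" "closedin (zar X) S" and irr': "irreducible_in (zar Y) ?S"
    using S(1) tr(1) by (auto simp: prime_div_def)
  have int: "?S \<inter> B1 = f1 ` (S \<inter> A1)" by (rule transfer_Int [OF sh(1,2) d1(1) irrS(2)])
  have ne: "?S \<inter> (B1 \<inter> A2) \<noteq> {}"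
    using irreducible_inD [OF irr' d1(4) d2(2) tr(2) S(3)] by (simp add: Int_assoc)
  then obtain y where y: "y \<in> ?S \<inter> B1" "y \<in> A2" by blast
  then obtain x where "x \<in> S \<inter> A1" "y = f1 x" unfolding int by blast
  then have SW: "S \<inter> ?W \<noteq> {}" using y(2) by blast
  have WA3: "?W \<subseteq> A3" and eq: "\<And>x. x \<in> ?W \<Longrightarrow> f3 x = f2 (f1 x)"
    using triangle_compose [OF X Y Z e1 e2 m3 t] by auto
  show "S \<inter> A3 \<noteq> {}" using SW WA3 by blast
  have "transfer Z A3 f3 S = zar Z closure_of (f3 ` (S \<inter> ?W))"
    by (rule transfer_open [OF sh(1,3) d3(1,2) irrS(1) dW(2) WA3 SW])
  also have "f3 ` (S \<inter> ?W) = f2 ` (?S \<inter> (B1 \<inter> A2))"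
  proof -
    have "f3 ` (S \<inter> ?W) = (\<lambda>x. f2 (f1 x)) ` (S \<inter> ?W)" using eq by (intro image_cong) auto
    also have "\<dots> = f2 ` (f1 ` (S \<inter> A1) \<inter> A2)" by auto
    finally show ?thesis unfolding int [symmetric] by (simp add: Int_assoc)
  qed
  also have "zar Z closure_of (f2 ` (?S \<inter> (B1 \<inter> A2))) = transfer Z A2 f2 ?S"
    by (rule transfer_open [OF sh(2,3) d2(1,2) irr' _ _ ne, symmetric]) (use d1(4) d2(2) in auto)
  finally show "transfer Z A3 f3 S = transfer Z A2 f2 ?S" .
qed

lemma transfer_equivariant:
  assumes X: "G_var G X \<alpha>" and Y: "G_var G Y \<beta>" and e: "eqbir G X \<alpha> Y \<beta> A B f g"
    and \<gamma>: "\<gamma> \<in> carrier G" and S: "S \<subseteq> pts X"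
  shows "transfer Y A f (\<alpha> \<gamma> ` S) = \<beta> \<gamma> ` transfer Y A f S" "\<alpha> \<gamma> ` S \<inter> A = \<alpha> \<gamma> ` (S \<inter> A)"
proof -
  note d = eqbirD [OF e]
  have "inj_on (\<alpha> \<gamma>) (pts X)" by (rule biso_inj [OF G_var_biso [OF X \<gamma>]])
  then have "\<alpha> \<gamma> ` (S \<inter> A) = \<alpha> \<gamma> ` S \<inter> \<alpha> \<gamma> ` A" using S d(8) by (rule inj_on_image_Int)
  then show eq: "\<alpha> \<gamma> ` S \<inter> A = \<alpha> \<gamma> ` (S \<inter> A)" using d(6) [OF \<gamma>] by simp
  have "f ` \<alpha> \<gamma> ` (S \<inter> A) = \<beta> \<gamma> ` f ` (S \<inter> A)" using d(7) [OF \<gamma>] by force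
  moreover have "f ` (S \<inter> A) \<subseteq> pts Y" using d(9,12) by blast
  ultimately show "transfer Y A f (\<alpha> \<gamma> ` S) = \<beta> \<gamma> ` transfer Y A f S"
    unfolding transfer_def eq using homeomorphic_map_closure_of [OF G_var_homeomorphic [OF Y \<gamma>]] by metis
qed


section \<open>The invariant\<close>

subsection \<open>Orbits of divisors\<close>

lemma G_variety_G_var: "G_variety G n X \<alpha> \<Longrightarrow> G_var G X \<alpha>"
  by (simp add: G_variety_def G_var_def)

lemma prime_div_act:
  assumes X: "G_var G X \<alpha>" and g: "g \<in> carrier G" and S: "prime_div X S"
  shows "prime_div X (\<alpha> g ` S)"
proof -
  note hm = G_var_homeomorphic [OF X g]
  have Sc: "closedin (zar X) S" "irreducible_in (zar X) S" using S by (auto simp: prime_div_def)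
  have "closedin (zar X) (\<alpha> g ` S)" using hm Sc(1) homeomorphic_map_closedness_eq by metis
  moreover have "irreducible_in (zar X) (\<alpha> g ` S)"
    by (rule irreducible_in_image [OF homeomorphic_imp_continuous_map [OF hm] Sc(2)])
  moreover have "biso X X S (\<alpha> g ` S) (\<alpha> g) (\<alpha> (inv\<^bsub>G\<^esub> g))"
    by (rule G_var_biso_sub [OF X g irreducible_in_subset [OF Sc(2)]])
  then have "subtopology (zar X) S homeomorphic_space subtopology (zar X) (\<alpha> g ` S)"
    using biso_homeomorphic_maps [OF G_var_sheaf [OF X] G_var_sheaf [OF X]] unfolding homeomorphic_space_def by blast
  then have "krull_dim (subtopology (zar X) S) = krull_dim (subtopology (zar X) (\<alpha> g ` S))"
    by (rule krull_dim_homeomorphic)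
  ultimately show ?thesis using S by (simp add: prime_div_def)
qed

definition div_orbit :: "('g, 'm) monoid_scheme \<Rightarrow> ('g \<Rightarrow> 'a \<Rightarrow> 'a) \<Rightarrow> 'a set \<Rightarrow> 'a set set" where
  "div_orbit G \<alpha> S = {\<alpha> g ` S | g. g \<in> carrier G}"

text \<open>Orbits of all prime divisors, exceptional or not: the ambient set in which the
  exceptional orbits form a complement.\<close>

definition div_orbits :: "('g, 'm) monoid_scheme \<Rightarrow> ('a, 'k) fspace \<Rightarrow> ('g \<Rightarrow> 'a \<Rightarrow> 'a) \<Rightarrow> 'a set set set" where
  "div_orbits G X \<alpha> = {div_orbit G \<alpha> S | S. prime_div X S}"

lemma orbits_eq_div_orbit: "orbits G \<D> (\<lambda>g. image (\<alpha> g)) = {div_orbit G \<alpha> S | S. S \<in> \<D>}"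
  by (simp add: orbits_def orbit_def div_orbit_def)

lemma div_orbit_self:
  assumes X: "G_var G X \<alpha>" and S: "S \<subseteq> pts X" shows "S \<in> div_orbit G \<alpha> S"
proof -
  interpret group G by (rule G_var_group [OF X])
  have "\<alpha> \<one>\<^bsub>G\<^esub> ` S = S" using G_var_one [OF X] S by force
  then show ?thesis unfolding div_orbit_def using one_closed by blast
qed

lemma div_orbit_act:
  assumes X: "G_var G X \<alpha>" and S: "S \<subseteq> pts X" and g: "g \<in> carrier G" and D: "D \<in> div_orbit G \<alpha> S"
  shows "\<alpha> g ` D \<in> div_orbit G \<alpha> S"
proof -
  interpret group G by (rule G_var_group [OF X])
  obtain h where h: "h \<in> carrier G" "D = \<alpha> h ` S" using D by (auto simp: div_orbit_def)
  have "\<alpha> g ` D = \<alpha> (g \<otimes>\<^bsub>G\<^esub> h) ` S"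
    unfolding h(2) image_image using G_var_mult [OF X g h(1)] S by (intro image_cong) auto
  then show ?thesis unfolding div_orbit_def using m_closed [OF g h(1)] by blast
qed

lemma div_orbit_transitive:
  assumes X: "G_var G X \<alpha>" and S: "S \<subseteq> pts X" and D: "D \<in> div_orbit G \<alpha> S" "E \<in> div_orbit G \<alpha> S"
  shows "\<exists>g\<in>carrier G. \<alpha> g ` D = E"
proof -
  interpret group G by (rule G_var_group [OF X])
  obtain h k where h: "h \<in> carrier G" "D = \<alpha> h ` S" and k: "k \<in> carrier G" "E = \<alpha> k ` S"
    using D by (auto simp: div_orbit_def)
  let ?g = "k \<otimes>\<^bsub>G\<^esub> inv\<^bsub>G\<^esub> h"
  have g: "?g \<in> carrier G" using h k by simp
  have "?g \<otimes>\<^bsub>G\<^esub> h = k" using h(1) k(1) by (simp add: m_assoc)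
  then have "\<alpha> k x = \<alpha> ?g (\<alpha> h x)" if "x \<in> S" for x
    using G_var_mult [OF X g h(1), of x] S that by auto
  then have "\<alpha> ?g ` D = E" unfolding h(2) k(2) image_image by (intro image_cong) auto
  then show ?thesis using g by blast
qed

lemma div_orbits_cases:
  assumes X: "G_var G X \<alpha>" and "\<D> \<in> div_orbits G X \<alpha>"
  shows "\<D> \<noteq> {}" "\<And>D. D \<in> \<D> \<Longrightarrow> prime_div X D" "\<And>g D. g \<in> carrier G \<Longrightarrow> D \<in> \<D> \<Longrightarrow> \<alpha> g ` D \<in> \<D>"
    "\<And>D E. D \<in> \<D> \<Longrightarrow> E \<in> \<D> \<Longrightarrow> \<exists>g\<in>carrier G. \<alpha> g ` D = E" "finite (carrier G) \<Longrightarrow> finite \<D>"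
proof -
  obtain S where S: "\<D> = div_orbit G \<alpha> S" "prime_div X S" using assms(2) by (auto simp: div_orbits_def)
  have Sp: "S \<subseteq> pts X" using S(2) irreducible_in_subset unfolding prime_div_def by blast
  show "\<D> \<noteq> {}" using div_orbit_self [OF X Sp] S(1) by blast
  show "prime_div X D" if "D \<in> \<D>" for D
    using that S prime_div_act [OF X _ S(2)] by (auto simp: div_orbit_def)
  show "\<alpha> g ` D \<in> \<D>" if "g \<in> carrier G" "D \<in> \<D>" for g D
    using div_orbit_act [OF X Sp] that S(1) by blast
  show "\<exists>g\<in>carrier G. \<alpha> g ` D = E" if "D \<in> \<D>" "E \<in> \<D>" for D E
    using div_orbit_transitive [OF X Sp] that S(1) by blast
  show "finite \<D>" if "finite (carrier G)"
    unfolding S(1) div_orbit_def using that by (simp add: setcompr_eq_image)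
qed

lemma prime_div_subset: "prime_div X D \<Longrightarrow> D \<subseteq> pts X"
  using irreducible_in_subset unfolding prime_div_def by blast

lemma div_orbits_generate:
  assumes X: "G_var G X \<alpha>" and D: "\<D> \<in> div_orbits G X \<alpha>" "D \<in> \<D>"
  shows "\<D> = div_orbit G \<alpha> D"
proof
  note c = div_orbits_cases [OF X D(1)]
  show "\<D> \<subseteq> div_orbit G \<alpha> D" using c(4) [OF D(2)] unfolding div_orbit_def by blast
  show "div_orbit G \<alpha> D \<subseteq> \<D>" using c(3) [OF _ D(2)] unfolding div_orbit_def by blast
qed


subsection \<open>Orbits of divisors as varieties\<close>

lemma Union_orbit_stable:
  assumes X: "G_var G X \<alpha>" and D: "\<D> \<in> div_orbits G X \<alpha>" and g: "g \<in> carrier G"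
  shows "\<alpha> g ` \<Union>\<D> = \<Union>\<D>"
proof
  note c = div_orbits_cases [OF X D]
  interpret group G by (rule G_var_group [OF X])
  show "\<alpha> g ` \<Union>\<D> \<subseteq> \<Union>\<D>" using c(3) [OF g] by blast
  show "\<Union>\<D> \<subseteq> \<alpha> g ` \<Union>\<D>"
  proof
    fix x assume "x \<in> \<Union>\<D>"
    then obtain D where D: "D \<in> \<D>" "x \<in> D" by blast
    then have xp: "x \<in> pts X" using c(2) prime_div_subset by blast
    have "\<alpha> (inv\<^bsub>G\<^esub> g) x \<in> \<Union>\<D>" using c(3) [of "inv\<^bsub>G\<^esub> g" D] D g by auto
    moreover have "x = \<alpha> g (\<alpha> (inv\<^bsub>G\<^esub> g) x)" using G_var_inv(3) [OF X g xp] by simp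
    ultimately show "x \<in> \<alpha> g ` \<Union>\<D>" by blast
  qed
qed

lemma closedin_Union_orbit:
  assumes X: "G_var G X \<alpha>" and D: "\<D> \<in> div_orbits G X \<alpha>" and fin: "finite (carrier G)"
  shows "closedin (zar X) (\<Union>\<D>)"
  using div_orbits_cases(2,5) [OF X D] fin by (intro closedin_Union) (auto simp: prime_div_def)

text \<open>\<open>group_action\<close> takes values in \<open>BijGroup\<close>, whose elements are
  extensional functions; this is the reason for \<open>restrict\<close>.\<close>

lemma G_var_closed_sub:
  assumes X: "G_var G X \<alpha>" and cl: "closedin (zar X) \<Delta>" and st: "\<And>g. g \<in> carrier G \<Longrightarrow> \<alpha> g ` \<Delta> = \<Delta>"
  shows "G_var G (sub X \<Delta>) (\<lambda>g. restrict (\<alpha> g) \<Delta>)"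
  unfolding G_var_def
proof (intro conjI ballI)
  interpret group G by (rule G_var_group [OF X])
  have \<Delta>: "\<Delta> \<subseteq> pts X" by (rule closedin_subset [OF cl])
  then have p: "pts (sub X \<Delta>) = \<Delta>" by (auto simp: pts_sub)
  show "variety (sub X \<Delta>)" by (rule variety_sub_closed [OF G_var_variety [OF X] cl])
  have bij: "restrict (\<alpha> g) \<Delta> \<in> Bij \<Delta>" if g: "g \<in> carrier G" for g
  proof -
    have "inj_on (\<alpha> g) \<Delta>" using biso_inj [OF G_var_biso [OF X g]] \<Delta> by (rule inj_on_subset)
    then have "bij_betw (restrict (\<alpha> g) \<Delta>) \<Delta> \<Delta>"
      using st [OF g] by (simp add: bij_betw_def)
    then show ?thesis by (simp add: Bij_def)
  qed
  have mult: "restrict (\<alpha> (g \<otimes>\<^bsub>G\<^esub> h)) \<Delta> = compose \<Delta> (restrict (\<alpha> g) \<Delta>) (restrict (\<alpha> h) \<Delta>)"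
    if g: "g \<in> carrier G" and h: "h \<in> carrier G" for g h
  proof
    fix x show "restrict (\<alpha> (g \<otimes>\<^bsub>G\<^esub> h)) \<Delta> x = compose \<Delta> (restrict (\<alpha> g) \<Delta>) (restrict (\<alpha> h) \<Delta>) x"
    proof (cases "x \<in> \<Delta>")
      case True
      then have "\<alpha> h x \<in> \<Delta>" using st [OF h] by blast
      then show ?thesis using True G_var_mult [OF X g h, of x] \<Delta> by (auto simp: compose_def)
    qed (simp add: compose_def)
  qed
  have "(\<lambda>g. restrict (\<alpha> g) \<Delta>) \<in> hom G (BijGroup \<Delta>)"
    using bij mult by (auto simp: hom_def BijGroup_def)
  then have "group_hom G (BijGroup \<Delta>) (\<lambda>g. restrict (\<alpha> g) \<Delta>)"
    by (simp add: group_hom_def group_hom_axioms_def group_BijGroup is_group)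
  then show "group_action G (pts (sub X \<Delta>)) (\<lambda>g. restrict (\<alpha> g) \<Delta>)"
    unfolding p by (simp add: group_action_def)
  fix g assume g: "g \<in> carrier G"
  have "morphism (sub X \<Delta>) X (\<alpha> g)"
    using X g by (intro morphism_restrict) (simp add: G_var_def)
  then have "morphism (sub X \<Delta>) X (restrict (\<alpha> g) \<Delta>)"
    by (rule morphism_cong [OF function_sheaf_sub [OF G_var_sheaf [OF X]]]) (simp add: p)
  then show "morphism (sub X \<Delta>) (sub X \<Delta>) (restrict (\<alpha> g) \<Delta>)"
    by (rule morphism_into_sub [OF function_sheaf_sub [OF G_var_sheaf [OF X]]])
      (use st [OF g] in \<open>auto simp: p\<close>)
qed

text \<open>An orbit of a finite group is finite, so its union is closed and every irreducible
  subset lies in a single member. Dimension and irreducible components of the union are therefore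
  those of its members, which the group permutes transitively.\<close>

lemma orbit_space_G_variety:
  assumes X: "G_var G X \<alpha>" and D: "\<D> \<in> div_orbits G X \<alpha>" and fin: "finite (carrier G)"
    and dim: "krull_dim (zar X) = enat n"
  shows "G_variety G (n - 1) (fst (orbit_space X \<alpha> \<D>)) (snd (orbit_space X \<alpha> \<D>))"
proof -
  note c = div_orbits_cases [OF X D]
  let ?\<Delta> = "\<Union>\<D>"
  have cl: "closedin (zar X) ?\<Delta>" by (rule closedin_Union_orbit [OF X D fin])
  have Dc: "closedin (zar X) E" "irreducible_in (zar X) E" if "E \<in> \<D>" for E
    using c(2) [OF that] by (auto simp: prime_div_def)
  have sub_D: "\<exists>E\<in>\<D>. Z \<subseteq> E" if "irreducible_in (zar X) Z" "Z \<subseteq> ?\<Delta>" for Z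
    by (rule irreducible_in_Union_closed [OF that(1) c(5) [OF fin] Dc(1) that(2)])
  have gv: "G_var G (sub X ?\<Delta>) (\<lambda>g. restrict (\<alpha> g) ?\<Delta>)"
    by (rule G_var_closed_sub [OF X cl Union_orbit_stable [OF X D]])
  have kd: "krull_dim (subtopology (zar X) E) = enat (n - 1)" if "E \<in> \<D>" for E
  proof -
    \<comment> \<open>The equation forces \<open>n > 0\<close>, so the truncated subtraction in
      \<open>n - 1\<close> is exact.\<close>
    have "krull_dim (subtopology (zar X) E) + 1 = enat n"
      using c(2) [OF that] dim by (simp add: prime_div_def)
    then show ?thesis by (cases "krull_dim (subtopology (zar X) E)") (auto simp: one_enat_def)
  qed
  have "krull_dim (subtopology (zar X) ?\<Delta>) = enat (n - 1)"
  proof (rule order_antisym)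
    show "krull_dim (subtopology (zar X) ?\<Delta>) \<le> enat (n - 1)"
    proof (rule krull_dim_le)
      fix m Z assume "irr_chain (subtopology (zar X) ?\<Delta>) m Z"
      then have Z: "irr_chain (zar X) m Z" "Z m \<subseteq> ?\<Delta>" using cl by (auto simp: irr_chain_closed_subspace)
      then obtain E where E: "E \<in> \<D>" "Z m \<subseteq> E" using sub_D [of "Z m"] by (auto simp: irr_chain_def)
      then have "irr_chain (subtopology (zar X) E) m Z" using Z Dc by (simp add: irr_chain_closed_subspace)
      then show "enat m \<le> enat (n - 1)" using krull_dim_ge kd [OF E(1)] by metis
    qed
    obtain E where E: "E \<in> \<D>" using c(1) by blast
    then show "enat (n - 1) \<le> krull_dim (subtopology (zar X) ?\<Delta>)"
      using krull_dim_closed_mono [OF Dc(1) cl, of E] kd [OF E] by auto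
  qed
  moreover have "\<exists>g\<in>carrier G. restrict (\<alpha> g) ?\<Delta> ` Z = W"
    if "Z \<in> irreducible_components (subtopology (zar X) ?\<Delta>)" "W \<in> irreducible_components (subtopology (zar X) ?\<Delta>)" for Z W
  proof -
    have in_D: "Z \<in> \<D>" if Z: "Z \<in> irreducible_components (subtopology (zar X) ?\<Delta>)" for Z
    proof -
      have irr: "irreducible_in (zar X) Z" "Z \<subseteq> ?\<Delta>"
        using Z by (auto simp: irreducible_components_def irreducible_in_subtopology)
      then obtain E where E: "E \<in> \<D>" "Z \<subseteq> E" using sub_D by blast
      have "irreducible_in (subtopology (zar X) ?\<Delta>) E"
        using E(1) Dc(2) [OF E(1)] by (auto simp: irreducible_in_subtopology)
      then have "E = Z" using Z E(2) by (auto simp: irreducible_components_def)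
      then show ?thesis using E by simp
    qed
    obtain g where g: "g \<in> carrier G" "\<alpha> g ` Z = W" using c(4) in_D \<open>Z \<in> _\<close> \<open>W \<in> _\<close> by blast
    have "Z \<subseteq> ?\<Delta>" using in_D [OF that(1)] by blast
    then have "restrict (\<alpha> g) ?\<Delta> ` Z = \<alpha> g ` Z" by (intro image_cong) auto
    then show ?thesis using g by blast
  qed
  ultimately show ?thesis
    using gv by (simp add: orbit_space_def G_variety_def G_var_def zar_sub)
qed

lemma generic_stabilizer_trivial_imp_generically_free:
  assumes "generic_stabilizer_trivial G X \<alpha>" "pts X \<noteq> {}" shows "generically_free G X \<alpha>"
proof -
  obtain U where U: "zar X closure_of U = pts X" "U \<subseteq> locus_trivial_stabilizer G X \<alpha>"
    using assms(1) unfolding generic_stabilizer_trivial_def by blast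
  have "U \<noteq> {}" using U(1) assms(2) closure_of_empty by metis
  then show ?thesis using U(2) unfolding generically_free_def by blast
qed

lemma orbit_space_free:
  assumes X: "G_var G X \<alpha>" and D: "\<D> \<in> div_orbits G X \<alpha>" and fin: "finite (carrier G)"
    and dim: "krull_dim (zar X) = enat n"
    and gst: "generic_stabilizer_trivial G (fst (orbit_space X \<alpha> \<D>)) (snd (orbit_space X \<alpha> \<D>))"
  shows "orbit_space X \<alpha> \<D> \<in> free_G_varieties G (n - 1)"
proof -
  note c = div_orbits_cases [OF X D]
  obtain E where E: "E \<in> \<D>" using c(1) by blast
  then have "irreducible_in (zar X) E" using c(2) by (auto simp: prime_div_def)
  then have "E \<noteq> {}" "E \<subseteq> pts X" by (auto simp: irreducible_in_def)
  then have "pts (fst (orbit_space X \<alpha> \<D>)) \<noteq> {}"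
    using E by (auto simp: orbit_space_def pts_sub)
  then show ?thesis
    using orbit_space_G_variety [OF X D fin dim] generic_stabilizer_trivial_imp_generically_free [OF gst]
    unfolding free_G_varieties_def by (simp add: case_prod_unfold)
qed

text \<open>By equivariance and injectivity of \<open>f\<close>, the points \<open>x\<close> and
  \<open>f x\<close> have the same stabilizer; an open dense locus is carried to an open dense
  locus.\<close>

lemma generic_stabilizer_trivial_eqbir:
  assumes sh: "function_sheaf X" "function_sheaf Y" and e: "eqbir G X \<alpha> Y \<beta> A B f g"
    and gst: "generic_stabilizer_trivial G X \<alpha>"
  shows "generic_stabilizer_trivial G Y \<beta>"
proof -
  note d = eqbirD [OF e]
  obtain U where U: "openin (zar X) U" "zar X closure_of U = pts X" "U \<subseteq> locus_trivial_stabilizer G X \<alpha>"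
    using gst unfolding generic_stabilizer_trivial_def by blast
  have o: "openin (zar Y) (f ` (A \<inter> U))"
    by (rule biso_openin_image [OF sh d(1,4)]) (use U d(2) in auto)
  have "B \<subseteq> zar Y closure_of (f ` (A \<inter> U))"
    by (rule biso_dense_image [OF sh d(1) _ dense_Int_open [OF U(2) d(2)]]) simp
  then have "zar Y closure_of B \<subseteq> zar Y closure_of (f ` (A \<inter> U))" by (rule closure_of_minimal) simp
  then have dense: "zar Y closure_of (f ` (A \<inter> U)) = pts Y" using d(5) closure_of_subset_topspace by fast
  have "f ` (A \<inter> U) \<subseteq> locus_trivial_stabilizer G Y \<beta>"
  proof
    fix y assume "y \<in> f ` (A \<inter> U)"
    then obtain x where x: "x \<in> A" "x \<in> U" "y = f x" by blast
    have "\<beta> h y = y \<longleftrightarrow> \<alpha> h x = x" if h: "h \<in> carrier G" for h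
    proof -
      have "\<alpha> h x \<in> A" using d(6) [OF h] x(1) by blast
      moreover have "\<beta> h y = f (\<alpha> h x)" using d(7) [OF h x(1)] x(3) by simp
      ultimately show ?thesis using x d(14) by metis
    qed
    then have "stabilizer G \<beta> y = stabilizer G \<alpha> x" by (auto simp: stabilizer_def)
    then show "y \<in> locus_trivial_stabilizer G Y \<beta>"
      using x U(3) d(9,12) by (auto simp: locus_trivial_stabilizer_def)
  qed
  then show ?thesis unfolding generic_stabilizer_trivial_def using o dense by blast
qed


subsection \<open>Transfer of orbits\<close>

definition meets :: "'a set \<Rightarrow> 'a set set \<Rightarrow> bool" where
  "meets A \<D> \<longleftrightarrow> (\<exists>D\<in>\<D>. D \<inter> A \<noteq> {})"

text \<open>Since \<open>A\<close> is stable and the group acts transitively on an orbit, either all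
  members of the orbit meet \<open>A\<close> or none does.\<close>

lemma meets_all:
  assumes X: "G_var G X \<alpha>" and D: "\<D> \<in> div_orbits G X \<alpha>"
    and A: "\<And>g. g \<in> carrier G \<Longrightarrow> \<alpha> g ` A = A" and m: "meets A \<D>" and E: "E \<in> \<D>"
  shows "E \<inter> A \<noteq> {}"
proof -
  obtain D where D': "D \<in> \<D>" "D \<inter> A \<noteq> {}" using m by (auto simp: meets_def)
  obtain g where g: "g \<in> carrier G" "\<alpha> g ` D = E" using div_orbits_cases(4) [OF X D D'(1) E] by blast
  obtain x where "x \<in> D" "x \<in> A" using D'(2) by blast
  then have "\<alpha> g x \<in> E" "\<alpha> g x \<in> A" using g A [OF g(1)] by blast+
  then show ?thesis by blast
qed

context
  fixes G :: "('g, 'm) monoid_scheme" and X :: "('a, 'k::{alg_closed_field, field_char_0}) fspace"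
    and Y :: "('b, 'k) fspace" and \<alpha> \<beta> A B f g
  assumes X: "G_var G X \<alpha>" and Y: "G_var G Y \<beta>" and e: "eqbir G X \<alpha> Y \<beta> A B f g"
    and dim: "krull_dim (zar X) = krull_dim (zar Y)"
begin

lemma transfer_orbit:
  assumes D: "\<D> \<in> div_orbits G X \<alpha>" and m: "meets A \<D>"
  shows "transfer Y A f ` \<D> \<in> div_orbits G Y \<beta>" "meets B (transfer Y A f ` \<D>)"
    "transfer X B g ` transfer Y A f ` \<D> = \<D>"
proof -
  note d = eqbirD [OF e]
  note c = div_orbits_cases [OF X D]
  have pX: "prevariety X" "prevariety Y" using X Y by (auto simp: G_var_def variety_def)
  have ne: "E \<inter> A \<noteq> {}" if "E \<in> \<D>" for E by (rule meets_all [OF X D d(6) m that])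
  note tr = transfer_prime_div [OF pX d(1,2,4) dim c(2) ne]
  obtain E where E: "E \<in> \<D>" using c(1) by blast
  have Ep: "E \<subseteq> pts X" by (rule prime_div_subset [OF c(2) [OF E]])
  have "transfer Y A f ` \<D> = div_orbit G \<beta> (transfer Y A f E)"
  proof -
    have "transfer Y A f ` \<D> = {transfer Y A f (\<alpha> h ` E) | h. h \<in> carrier G}"
      unfolding div_orbits_generate [OF X D E] div_orbit_def by blast
    also have "\<dots> = {\<beta> h ` transfer Y A f E | h. h \<in> carrier G}"
      using transfer_equivariant(1) [OF X Y e _ Ep] by metis
    finally show ?thesis by (simp add: div_orbit_def)
  qed
  then show "transfer Y A f ` \<D> \<in> div_orbits G Y \<beta>"
    unfolding div_orbits_def using tr(1) [OF E E] by blast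
  show "meets B (transfer Y A f ` \<D>)" unfolding meets_def using tr(2) [OF E E] E by blast
  show "transfer X B g ` transfer Y A f ` \<D> = \<D>" using tr(3) by force
qed

text \<open>The maps \<open>f\<close> and \<open>g\<close> themselves restrict to an equivariant
  birational isomorphism of the unions. Density of the domains uses that every member, not only one,
  meets \<open>A\<close> respectively \<open>B\<close>.\<close>

lemma transfer_orbit_space:
  assumes D: "\<D> \<in> div_orbits G X \<alpha>" and m: "meets A \<D>" and fin: "finite (carrier G)"
  shows "\<exists>A' B'. eqbir G (fst (orbit_space X \<alpha> \<D>)) (snd (orbit_space X \<alpha> \<D>))
    (fst (orbit_space Y \<beta> (transfer Y A f ` \<D>))) (snd (orbit_space Y \<beta> (transfer Y A f ` \<D>))) A' B' f g"
proof -
  note d = eqbirD [OF e] and ds = eqbirD [OF eqbir_sym [OF e]]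
  note sh = G_var_sheaf [OF X] G_var_sheaf [OF Y]
  let ?\<E> = "transfer Y A f ` \<D>"
  note t = transfer_orbit [OF D m]
  let ?\<Delta> = "\<Union>\<D>" and ?\<Delta>' = "\<Union>?\<E>"
  have cl: "closedin (zar X) ?\<Delta>" "closedin (zar Y) ?\<Delta>'"
    using closedin_Union_orbit [OF X D fin] closedin_Union_orbit [OF Y t(1) fin] by blast+
  have sub: "?\<Delta> \<subseteq> pts X" "?\<Delta>' \<subseteq> pts Y" using cl closedin_subset by blast+
  have t_int: "transfer Y A f E \<inter> B = f ` (E \<inter> A)" if "E \<in> \<D>" for E
    using div_orbits_cases(2) [OF X D that] by (intro transfer_Int [OF sh d(1)]) (simp add: prime_div_def)
  have "?\<Delta>' \<inter> B = (\<Union>E\<in>\<D>. transfer Y A f E \<inter> B)" by blast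
  also have "\<dots> = (\<Union>E\<in>\<D>. f ` (E \<inter> A))" by (rule SUP_cong [OF refl t_int])
  also have "\<dots> = f ` (?\<Delta> \<inter> A)" by blast
  finally have int: "?\<Delta>' \<inter> B = f ` (?\<Delta> \<inter> A)" .
  have b: "biso X Y (?\<Delta> \<inter> A) (?\<Delta>' \<inter> B) f g"
    unfolding int by (rule biso_restrict [OF sh d(1)]) simp
  have "biso (sub X ?\<Delta>) (sub Y ?\<Delta>') (?\<Delta> \<inter> A) (?\<Delta>' \<inter> B) f g"
    using b by (subst biso_sub [OF sh]) auto
  moreover have "openin (zar (sub X ?\<Delta>)) (?\<Delta> \<inter> A)" "openin (zar (sub Y ?\<Delta>')) (?\<Delta>' \<inter> B)"
    using d(2,4) by (auto simp: zar_sub openin_subtopology)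
  moreover have "zar (sub X ?\<Delta>) closure_of (?\<Delta> \<inter> A) = pts (sub X ?\<Delta>)"
  proof -
    have "?\<Delta> \<subseteq> zar X closure_of (?\<Delta> \<inter> A)"
    proof
      fix x assume "x \<in> ?\<Delta>"
      then obtain E where E: "E \<in> \<D>" "x \<in> E" by blast
      have "irreducible_in (zar X) E" using div_orbits_cases(2) [OF X D E(1)] by (simp add: prime_div_def)
      then have "E \<subseteq> zar X closure_of (E \<inter> A)"
        using irreducible_in_Int_open(2) d(2) meets_all [OF X D d(6) m E(1)] by blast
      moreover have "zar X closure_of (E \<inter> A) \<subseteq> zar X closure_of (?\<Delta> \<inter> A)"
        using E by (intro closure_of_mono) blast
      ultimately show "x \<in> zar X closure_of (?\<Delta> \<inter> A)" using E by blast
    qed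
    then show ?thesis using sub by (auto simp: zar_sub pts_sub closure_of_subtopology)
  qed
  moreover have "zar (sub Y ?\<Delta>') closure_of (?\<Delta>' \<inter> B) = pts (sub Y ?\<Delta>')"
  proof -
    have "?\<Delta>' \<subseteq> zar Y closure_of (?\<Delta>' \<inter> B)"
    proof
      fix x assume "x \<in> ?\<Delta>'"
      then obtain E where E: "E \<in> ?\<E>" "x \<in> E" by blast
      have "irreducible_in (zar Y) E" using div_orbits_cases(2) [OF Y t(1) E(1)] by (simp add: prime_div_def)
      then have "E \<subseteq> zar Y closure_of (E \<inter> B)"
        using irreducible_in_Int_open(2) d(4) meets_all [OF Y t(1) ds(6) t(2) E(1)] by blast
      moreover have "zar Y closure_of (E \<inter> B) \<subseteq> zar Y closure_of (?\<Delta>' \<inter> B)"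
        using E by (intro closure_of_mono) blast
      ultimately show "x \<in> zar Y closure_of (?\<Delta>' \<inter> B)" using E by blast
    qed
    then show ?thesis using sub by (auto simp: zar_sub pts_sub closure_of_subtopology)
  qed
  moreover have "restrict (\<alpha> h) ?\<Delta> ` (?\<Delta> \<inter> A) = ?\<Delta> \<inter> A" if h: "h \<in> carrier G" for h
  proof -
    have "restrict (\<alpha> h) ?\<Delta> ` (?\<Delta> \<inter> A) = \<alpha> h ` (?\<Delta> \<inter> A)" by (intro image_cong) auto
    also have "\<dots> = \<alpha> h ` ?\<Delta> \<inter> \<alpha> h ` A"
      by (rule inj_on_image_Int [OF biso_inj [OF G_var_biso [OF X h]] sub(1) d(8)])
    finally show ?thesis using Union_orbit_stable [OF X D h] d(6) [OF h] by simp
  qed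
  moreover have "f (restrict (\<alpha> h) ?\<Delta> x) = restrict (\<beta> h) ?\<Delta>' (f x)"
    if h: "h \<in> carrier G" and x: "x \<in> ?\<Delta> \<inter> A" for h x
  proof -
    have "f x \<in> ?\<Delta>'" using int x by blast
    then show ?thesis using x d(7) [OF h] by simp
  qed
  ultimately have "eqbir G (sub X ?\<Delta>) (\<lambda>g. restrict (\<alpha> g) ?\<Delta>) (sub Y ?\<Delta>') (\<lambda>g. restrict (\<beta> g) ?\<Delta>')
      (?\<Delta> \<inter> A) (?\<Delta>' \<inter> B) f g"
    unfolding eqbir_def by blast
  then show ?thesis by (auto simp: orbit_space_def)
qed

end


subsection \<open>Birational classes\<close>

lemma free_G_varieties_G_var:
  assumes "P \<in> free_G_varieties G m" shows "G_var G (fst P) (snd P)"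
  using assms G_variety_G_var unfolding free_G_varieties_def by (auto simp: case_prod_unfold)

lemma birational_relI:
  assumes "P \<in> free_G_varieties G m" "Q \<in> free_G_varieties G m"
    and "eqbir G (fst P) (snd P) (fst Q) (snd Q) A B f g"
  shows "(P, Q) \<in> birational_rel G m"
  using assms eqbir_imp_equivariant_birational [OF _ _ assms(3)]
    G_var_sheaf [OF free_G_varieties_G_var [OF assms(1)]] G_var_sheaf [OF free_G_varieties_G_var [OF assms(2)]]
  unfolding birational_rel_def by blast

lemma birational_relE:
  assumes "(P, Q) \<in> birational_rel G m"
  obtains A B f g where "P \<in> free_G_varieties G m" "Q \<in> free_G_varieties G m"
    "eqbir G (fst P) (snd P) (fst Q) (snd Q) A B f g"
proof -
  obtain \<phi> where P: "P \<in> free_G_varieties G m" "Q \<in> free_G_varieties G m"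
    and \<phi>: "equivariant_birational G (fst P) (snd P) (fst Q) (snd Q) \<phi>"
    using assms unfolding birational_rel_def by blast
  have "eqbir G (fst P) (snd P) (fst Q) (snd Q) (fst \<phi>) (snd \<phi> ` fst \<phi>) (snd \<phi>) (inv_into (fst \<phi>) (snd \<phi>))"
    by (rule equivariant_birational_imp_eqbir [OF _ _ \<phi>])
      (use P in \<open>auto intro: G_var_sheaf free_G_varieties_G_var\<close>)
  then show ?thesis using that P by blast
qed

lemma sym_birational_rel: "sym (birational_rel G m)"
proof (rule symI)
  fix P Q assume "(P, Q) \<in> birational_rel G m"
  then show "(Q, P) \<in> birational_rel G m"
    by (rule birational_relE) (blast intro: birational_relI eqbir_sym)
qed

lemma trans_birational_rel: "trans (birational_rel G m)"
proof (rule transI)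
  fix P Q R assume PQ: "(P, Q) \<in> birational_rel G m" and QR: "(Q, R) \<in> birational_rel G m"
  obtain A B f g where 1: "P \<in> free_G_varieties G m" "Q \<in> free_G_varieties G m"
    "eqbir G (fst P) (snd P) (fst Q) (snd Q) A B f g" using PQ by (rule birational_relE)
  obtain A' B' f' g' where 2: "R \<in> free_G_varieties G m"
    "eqbir G (fst Q) (snd Q) (fst R) (snd R) A' B' f' g'" using QR by (rule birational_relE)
  note v = free_G_varieties_G_var [OF 1(1)] free_G_varieties_G_var [OF 1(2)] free_G_varieties_G_var [OF 2(1)]
  show "(P, R) \<in> birational_rel G m"
    by (rule birational_relI [OF 1(1) 2(1)
        eqbir_compose [OF v [THEN G_var_sheaf] v(2) 1(3) 2(2)]])
qed

lemma bir_class_cong: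
  assumes "(P, Q) \<in> birational_rel G m" shows "bir_class G m P = bir_class G m Q"
proof -
  have "birational_rel G m `` {P} = birational_rel G m `` {Q}"
    using assms sym_birational_rel [of G m] trans_birational_rel [of G m]
    unfolding sym_def trans_def by blast
  then show ?thesis by (simp add: bir_class_def)
qed

lemma keys_bir_class:
  assumes "P \<in> free_G_varieties G m" shows "Poly_Mapping.keys (bir_class G m P) \<subseteq> Bir G m"
  using assms by (simp add: bir_class_def Bir_def quotientI)


subsection \<open>Additivity\<close>

text \<open>If the three sets are thought of as sets of divisorial valuations of one function field, the partial
  bijections become identities, and the claim is the additivity of formal differences of sets.\<close>

lemma sum_partial_bijections:
  fixes wP :: "'p \<Rightarrow> 'w::ab_group_add"
  assumes b1: "bij_betw t1 d1 r1" and b2: "bij_betw t2 d2 r2" and b3: "bij_betw t3 d3 r3"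
    and sub: "d1 \<subseteq> P" "d3 \<subseteq> P" "r1 \<subseteq> Q" "d2 \<subseteq> Q" "r2 \<subseteq> R" "r3 \<subseteq> R"
    and fin: "finite (P - d1)" "finite (P - d3)" "finite (Q - r1)" "finite (Q - d2)" "finite (R - r2)" "finite (R - r3)"
    and w: "\<And>x. x \<in> d1 \<Longrightarrow> wQ (t1 x) = wP x" "\<And>y. y \<in> d2 \<Longrightarrow> wR (t2 y) = wQ y" "\<And>x. x \<in> d3 \<Longrightarrow> wR (t3 x) = wP x"
    and c1: "\<And>x. x \<in> d1 \<Longrightarrow> t1 x \<in> d2 \<Longrightarrow> x \<in> d3 \<and> t3 x = t2 (t1 x)"
    and c2: "\<And>x. x \<in> d1 \<Longrightarrow> x \<in> d3 \<Longrightarrow> t1 x \<in> d2"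
    and c3: "\<And>x. x \<in> d3 \<Longrightarrow> t3 x \<in> r2 \<Longrightarrow> x \<in> d1"
  shows "sum wR (R - r3) - sum wP (P - d3) =
    (sum wQ (Q - r1) - sum wP (P - d1)) + (sum wR (R - r2) - sum wQ (Q - d2))"
proof -
  have r: "r1 = t1 ` d1" "r2 = t2 ` d2" "r3 = t3 ` d3" and inj: "inj_on t1 d1" "inj_on t2 d2" "inj_on t3 d3"
    using b1 b2 b3 by (auto simp: bij_betw_def)
  \<comment> \<open>The bijections match \<open>d1 - d3\<close> with \<open>r1 - d2\<close>,
    \<open>d2 - r1\<close> with \<open>r2 - r3\<close>, and \<open>d3 - d1\<close> with
    \<open>r3 - r2\<close>. These are the contributions that do not cancel within a single one of
    the sets \<open>P\<close>, \<open>Q\<close>, \<open>R\<close>.\<close>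
  have s1: "t1 ` (d1 - d3) = r1 - d2" unfolding r using c1 c2 by auto
  have s2: "t2 ` (d2 - r1) = r2 - r3"
  proof
    show "t2 ` (d2 - r1) \<subseteq> r2 - r3"
    proof
      fix z assume "z \<in> t2 ` (d2 - r1)"
      then obtain y where y: "y \<in> d2" "y \<notin> r1" "z = t2 y" by blast
      have "z \<notin> r3"
      proof
        assume "z \<in> r3"
        then obtain x where x: "x \<in> d3" "t3 x = t2 y" using r(3) y(3) by auto
        then have "x \<in> d1" using c3 y(1) r(2) by auto
        then have "t1 x \<in> d2" "t3 x = t2 (t1 x)" using c1 c2 x(1) by auto
        then have "t1 x = y" using inj(2) x(2) y(1) by (auto dest: inj_onD)
        then show False using y(2) r(1) \<open>x \<in> d1\<close> by auto
      qed
      then show "z \<in> r2 - r3" using y r(2) by auto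
    qed
    show "r2 - r3 \<subseteq> t2 ` (d2 - r1)"
    proof
      fix z assume z: "z \<in> r2 - r3"
      then obtain y where y: "y \<in> d2" "z = t2 y" using r(2) by auto
      have "y \<notin> r1"
      proof
        assume "y \<in> r1"
        then obtain x where x: "x \<in> d1" "y = t1 x" using r(1) by auto
        then have "x \<in> d3" "t3 x = z" using c1 y by auto
        then show False using z r(3) by auto
      qed
      then show "z \<in> t2 ` (d2 - r1)" using y by blast
    qed
  qed
  have s3: "t3 ` (d3 - d1) = r3 - r2"
  proof
    show "t3 ` (d3 - d1) \<subseteq> r3 - r2" using c3 r(3) by auto
    show "r3 - r2 \<subseteq> t3 ` (d3 - d1)"
    proof
      fix z assume z: "z \<in> r3 - r2"
      then obtain x where x: "x \<in> d3" "z = t3 x" using r(3) by auto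
      have "x \<notin> d1"
      proof
        assume "x \<in> d1"
        then have "t1 x \<in> d2" "t3 x = t2 (t1 x)" using c1 c2 x(1) by auto
        then show False using z x(2) r(2) by auto
      qed
      then show "z \<in> t3 ` (d3 - d1)" using x by blast
    qed
  qed
  have e1: "sum wQ (r1 - d2) = sum wP (d1 - d3)"
    unfolding s1 [symmetric] using inj(1) w(1) by (subst sum.reindex) (auto intro: inj_on_subset)
  have e2: "sum wR (r2 - r3) = sum wQ (d2 - r1)"
    unfolding s2 [symmetric] using inj(2) w(2) by (subst sum.reindex) (auto intro: inj_on_subset)
  have e3: "sum wR (r3 - r2) = sum wP (d3 - d1)"
    unfolding s3 [symmetric] using inj(3) w(3) by (subst sum.reindex) (auto intro: inj_on_subset)
  \<comment> \<open>\<open>P\<close>, \<open>Q\<close> and \<open>R\<close> may be infinite and only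
    the complements are finite, so each complement is split along the other distinguished subset of
    the same set.\<close>
  have split: "sum v (T - a) = sum v (T - a - b) + sum v (b - a)" if "finite (T - a)" "b \<subseteq> T"
    for v :: "'x \<Rightarrow> 'w" and T a b
  proof -
    have T: "T - a = (T - a - b) \<union> (b - a)" using that(2) by blast
    have "finite (b - a)" by (rule finite_subset [OF _ that(1)]) (use that(2) in blast)
    then have "sum v ((T - a - b) \<union> (b - a)) = sum v (T - a - b) + sum v (b - a)"
      using that(1) by (intro sum.union_disjoint) auto
    then show ?thesis by (simp only: T [symmetric])
  qed
  have cm: "P - d3 - d1 = P - d1 - d3" "Q - d2 - r1 = Q - r1 - d2" "R - r3 - r2 = R - r2 - r3" by blast+
  show ?thesis
    unfolding split [OF fin(1) sub(2), of wP] split [OF fin(2) sub(1), of wP]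
      split [OF fin(3) sub(4), of wQ] split [OF fin(4) sub(3), of wQ]
      split [OF fin(5) sub(6), of wR] split [OF fin(6) sub(5), of wR] e1 e2 e3 cm
    by (simp add: algebra_simps)
qed

section \<open>Free orbits of divisors and additivity of \<open>C_inv\<close>\<close>

definition free_div_orbits :: "('g, 'm) monoid_scheme \<Rightarrow> ('a, 'k) fspace \<Rightarrow> ('g \<Rightarrow> 'a \<Rightarrow> 'a) \<Rightarrow> 'a set set set" where
  "free_div_orbits G X \<alpha> = {\<D> \<in> div_orbits G X \<alpha>.
     generic_stabilizer_trivial G (fst (orbit_space X \<alpha> \<D>)) (snd (orbit_space X \<alpha> \<D>))}"

text \<open>By \<open>codim_one_components\<close> the divisorial components are the prime divisors
  disjoint from \<open>ext_dom\<close>; one that merely meets the exceptional locus does not count.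
  Writing the free exceptional orbits as a complement gives the shape required by
  \<open>sum_partial_bijections\<close>; finiteness comes from the Noetherian topology.\<close>

lemma free_Ex_orbits_eq:
  fixes X Y :: "('a, 'k::field) fspace"
  assumes X: "G_var G X \<alpha>" and Y: "G_var G Y \<beta>" and e: "eqbir G X \<alpha> Y \<beta> U V f f'"
    and dim: "krull_dim (zar X) = enat n"
  shows "free_Ex_orbits G X \<alpha> Y (U, f) =
      free_div_orbits G X \<alpha> - {\<D> \<in> free_div_orbits G X \<alpha>. meets (ext_dom X Y U f) \<D>}"
    and "finite (free_Ex_orbits G X \<alpha> Y (U, f))"
proof -
  let ?A = "ext_dom X Y U f" and ?E = "exceptional_locus X Y (U, f)"
  note dA = eqbirD [OF maxbir_eqbir [OF maxbir_exists(1) [OF X Y e]]]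
  have pX: "prevariety X" using X by (simp add: G_var_def variety_def)
  note noe = noetherian_prevariety [OF pX]
  have E: "?E = pts X - ?A"
    by (rule exceptional_locus_eq [OF G_var_sheaf [OF X] G_var_sheaf [OF Y]])
  have clE: "closedin (zar X) ?E" unfolding E using dA(2) by (simp add: closedin_diff)
  have "pts X - ?E = ?A" using dA(8) E by blast
  then have dense: "zar X closure_of (pts X - ?E) = pts X" using dA(3) by simp
  have comps: "divisorial_components X Y (U, f) = {S. prime_div X S \<and> S \<inter> ?A = {}}"
    unfolding divisorial_components_def codim_one_components [OF noe dim clE dense]
    using E irreducible_in_subset by (auto simp: prime_div_def)
  have "finite (divisorial_components X Y (U, f))"
    unfolding divisorial_components_def
    using finite_irreducible_components [OF noetherian_space_subtopology [OF noe]] by simp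
  then have "finite (Ex_orbits G X \<alpha> Y (U, f))"
    unfolding Ex_orbits_def orbits_eq_div_orbit by (simp add: setcompr_eq_image)
  then show "finite (free_Ex_orbits G X \<alpha> Y (U, f))" by (simp add: free_Ex_orbits_def)
  have "Ex_orbits G X \<alpha> Y (U, f) = {\<D> \<in> div_orbits G X \<alpha>. \<not> meets ?A \<D>}"
  proof (intro equalityI subsetI)
    fix \<D> assume "\<D> \<in> Ex_orbits G X \<alpha> Y (U, f)"
    then obtain S where S: "\<D> = div_orbit G \<alpha> S" "prime_div X S" "S \<inter> ?A = {}"
      unfolding Ex_orbits_def orbits_eq_div_orbit comps by blast
    then have D: "\<D> \<in> div_orbits G X \<alpha>" by (auto simp: div_orbits_def)
    have "S \<in> \<D>" unfolding S(1) by (rule div_orbit_self [OF X prime_div_subset [OF S(2)]])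
    then have "\<not> meets ?A \<D>" using meets_all [OF X D dA(6)] S(3) by blast
    then show "\<D> \<in> {\<D> \<in> div_orbits G X \<alpha>. \<not> meets ?A \<D>}" using D by blast
  next
    fix \<D> assume D: "\<D> \<in> {\<D> \<in> div_orbits G X \<alpha>. \<not> meets ?A \<D>}"
    then obtain S where S: "\<D> = div_orbit G \<alpha> S" "prime_div X S" by (auto simp: div_orbits_def)
    have "S \<in> \<D>" unfolding S(1) by (rule div_orbit_self [OF X prime_div_subset [OF S(2)]])
    then have "S \<inter> ?A = {}" using D unfolding meets_def by blast
    then show "\<D> \<in> Ex_orbits G X \<alpha> Y (U, f)"
      unfolding Ex_orbits_def orbits_eq_div_orbit comps using S by blast
  qed
  then show "free_Ex_orbits G X \<alpha> Y (U, f) =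
      free_div_orbits G X \<alpha> - {\<D> \<in> free_div_orbits G X \<alpha>. meets ?A \<D>}"
    unfolding free_Ex_orbits_def free_div_orbits_def by blast
qed

text \<open>\<open>bir_class\<close> compares spaces with a common point type, hence both varieties
  live on \<open>'a\<close>. Freeness of the transferred orbit is settled before its class, because
  \<open>birational_rel\<close> relates free varieties only.\<close>

lemma transfer_free_orbit:
  fixes X :: "('a, 'k::{alg_closed_field, field_char_0}) fspace" and Y :: "('a, 'k) fspace"
  assumes X: "G_var G X \<alpha>" and Y: "G_var G Y \<beta>" and e: "eqbir G X \<alpha> Y \<beta> A B f g"
    and dim: "krull_dim (zar X) = enat n" "krull_dim (zar Y) = enat n" and fin: "finite (carrier G)"
    and D: "\<D> \<in> free_div_orbits G X \<alpha>" "meets A \<D>"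
  shows "transfer Y A f ` \<D> \<in> free_div_orbits G Y \<beta>" "meets B (transfer Y A f ` \<D>)"
    "transfer X B g ` transfer Y A f ` \<D> = \<D>"
    "bir_class G (n - 1) (orbit_space Y \<beta> (transfer Y A f ` \<D>)) = bir_class G (n - 1) (orbit_space X \<alpha> \<D>)"
proof -
  let ?\<E> = "transfer Y A f ` \<D>"
  have dim': "krull_dim (zar X) = krull_dim (zar Y)" using dim by simp
  have D': "\<D> \<in> div_orbits G X \<alpha>" and gst: "generic_stabilizer_trivial G (fst (orbit_space X \<alpha> \<D>)) (snd (orbit_space X \<alpha> \<D>))"
    using D(1) by (auto simp: free_div_orbits_def)
  note t = transfer_orbit [OF X Y e dim' D' D(2)]
  show "meets B ?\<E>" "transfer X B g ` ?\<E> = \<D>" by (rule t(2), rule t(3))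
  obtain A' B' where e': "eqbir G (fst (orbit_space X \<alpha> \<D>)) (snd (orbit_space X \<alpha> \<D>))
    (fst (orbit_space Y \<beta> ?\<E>)) (snd (orbit_space Y \<beta> ?\<E>)) A' B' f g"
    using transfer_orbit_space [OF X Y e dim' D' D(2) fin] by blast
  have sh: "function_sheaf (fst (orbit_space X \<alpha> \<D>))" "function_sheaf (fst (orbit_space Y \<beta> ?\<E>))"
    by (simp_all add: orbit_space_def function_sheaf_sub G_var_sheaf [OF X] G_var_sheaf [OF Y])
  have gst': "generic_stabilizer_trivial G (fst (orbit_space Y \<beta> ?\<E>)) (snd (orbit_space Y \<beta> ?\<E>))"
    by (rule generic_stabilizer_trivial_eqbir [OF sh e' gst])
  then show "?\<E> \<in> free_div_orbits G Y \<beta>" using t(1) by (simp add: free_div_orbits_def)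
  have "(orbit_space X \<alpha> \<D>, orbit_space Y \<beta> ?\<E>) \<in> birational_rel G (n - 1)"
    by (rule birational_relI [OF orbit_space_free [OF X D' fin dim(1) gst]
          orbit_space_free [OF Y t(1) fin dim(2) gst'] e'])
  then show "bir_class G (n - 1) (orbit_space Y \<beta> ?\<E>) = bir_class G (n - 1) (orbit_space X \<alpha> \<D>)"
    using bir_class_cong by metis
qed

lemma transfer_free_orbit_bij:
  fixes X :: "('a, 'k::{alg_closed_field, field_char_0}) fspace" and Y :: "('a, 'k) fspace"
  assumes X: "G_var G X \<alpha>" and Y: "G_var G Y \<beta>" and e: "eqbir G X \<alpha> Y \<beta> A B f g"
    and dim: "krull_dim (zar X) = enat n" "krull_dim (zar Y) = enat n" and fin: "finite (carrier G)"
  shows "bij_betw (image (transfer Y A f)) {\<D> \<in> free_div_orbits G X \<alpha>. meets A \<D>}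
    {\<D> \<in> free_div_orbits G Y \<beta>. meets B \<D>}"
  using transfer_free_orbit [OF X Y e dim fin] transfer_free_orbit [OF Y X eqbir_sym [OF e] dim(2,1) fin]
  by (intro bij_betw_byWitness [where f' = "image (transfer X B g)"]) auto

lemma transfer_orbit_compose:
  fixes X Y Z :: "('a, 'k::{alg_closed_field, field_char_0}) fspace"
  assumes X: "G_var G X \<alpha>" and Y: "G_var G Y \<beta>" and Z: "G_var G Z \<gamma>"
    and e1: "eqbir G X \<alpha> Y \<beta> A1 B1 f1 g1" and e2: "eqbir G Y \<beta> Z \<gamma> A2 B2 f2 g2"
    and m3: "maxbir G X \<alpha> Z \<gamma> A3 B3 f3 g3" and t: "triangle X A1 f1 A2 f2 A3 f3"
    and dim: "krull_dim (zar X) = krull_dim (zar Y)"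
    and D: "\<D> \<in> div_orbits G X \<alpha>" "meets A1 \<D>" "meets A2 (transfer Y A1 f1 ` \<D>)"
  shows "meets A3 \<D>" "transfer Z A3 f3 ` \<D> = transfer Z A2 f2 ` transfer Y A1 f1 ` \<D>"
proof -
  note d1 = eqbirD [OF e1] and d2 = eqbirD [OF e2]
  note c = div_orbits_cases [OF X D(1)]
  note t1 = transfer_orbit [OF X Y e1 dim D(1,2)]
  have m1: "E \<inter> A1 \<noteq> {}" and m2: "transfer Y A1 f1 E \<inter> A2 \<noteq> {}" if "E \<in> \<D>" for E
    using meets_all [OF X D(1) d1(6) D(2) that] meets_all [OF Y t1(1) d2(6) D(3)] that by blast+
  note tc = transfer_compose [OF X Y Z e1 e2 m3 t dim c(2) m1 m2]
  show "meets A3 \<D>" unfolding meets_def using tc(1) c(1) by blast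
  show "transfer Z A3 f3 ` \<D> = transfer Z A2 f2 ` transfer Y A1 f1 ` \<D>"
    unfolding image_image using tc(2) by (intro image_cong) auto
qed

theorem theorem1:
  fixes G :: "('g, 'm) monoid_scheme" and n :: nat
    and X Y Z :: "('a, 'k::{alg_closed_field, field_char_0}) fspace"
    and \<alpha> \<beta> \<gamma> :: "'g \<Rightarrow> 'a \<Rightarrow> 'a"
    and \<phi> \<psi> :: "('a, 'a) rational_map"
  assumes "group G" and "finite (carrier G)"
    and "smooth_projective_G_variety G n X \<alpha>"
    and "smooth_projective_G_variety G n Y \<beta>"
    and "smooth_projective_G_variety G n Z \<gamma>"
    and "equivariant_birational G X \<alpha> Y \<beta> \<phi>"
    and "equivariant_birational G Y \<beta> Z \<gamma> \<psi>"
  shows "C_inv G n X \<alpha> Y \<beta> \<phi> \<in> carrier (Z_Bir G (n - 1)) \<and>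
    C_inv G n X \<alpha> Z \<gamma> (rational_comp \<psi> \<phi>) = C_inv G n X \<alpha> Y \<beta> \<phi> + C_inv G n Y \<beta> Z \<gamma> \<psi>"
proof -
  note fin = assms(2)
  have X: "G_var G X \<alpha>" and Y: "G_var G Y \<beta>" and Z: "G_var G Z \<gamma>"
    using assms(3-5) G_variety_G_var unfolding smooth_projective_G_variety_def by blast+
  have dim: "krull_dim (zar X) = enat n" "krull_dim (zar Y) = enat n" "krull_dim (zar Z) = enat n"
    using assms(3-5) by (auto simp: smooth_projective_G_variety_def G_variety_def)
  then have dimXY: "krull_dim (zar X) = krull_dim (zar Y)" and dimYX: "krull_dim (zar Y) = krull_dim (zar X)"
    and dimXZ: "krull_dim (zar X) = krull_dim (zar Z)" by simp_all
  note sh = G_var_sheaf [OF X] G_var_sheaf [OF Y] G_var_sheaf [OF Z]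
  obtain U f where \<phi>: "\<phi> = (U, f)" by (cases \<phi>)
  obtain V h where \<psi>: "\<psi> = (V, h)" by (cases \<psi>)
  define W where "W = {x \<in> U. f x \<in> V}"
  define k where "k = h \<circ> f"
  have \<chi>: "rational_comp \<psi> \<phi> = (W, k)" by (simp add: rational_comp_def \<phi> \<psi> W_def k_def)
  have e1: "eqbir G X \<alpha> Y \<beta> U (f ` U) f (inv_into U f)"
    using equivariant_birational_imp_eqbir [OF sh(1,2) assms(6)] by (simp add: \<phi>)
  have e2: "eqbir G Y \<beta> Z \<gamma> V (h ` V) h (inv_into V h)"
    using equivariant_birational_imp_eqbir [OF sh(2,3) assms(7)] by (simp add: \<psi>)
  \<comment> \<open>\<open>eqbir_compose\<close> provides the composite of the two inverses, whereas
    \<open>rational_inv\<close> uses \<open>inv_into W k\<close>; passing through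
    \<open>equivariant_birational\<close> exchanges one for the other.\<close>
  have "equivariant_birational G X \<alpha> Z \<gamma> (W, k)"
    using eqbir_imp_equivariant_birational [OF sh(1,3) eqbir_compose [OF sh Y e1 e2]]
    by (simp add: W_def k_def o_def)
  then have e3: "eqbir G X \<alpha> Z \<gamma> W (k ` W) k (inv_into W k)"
    using equivariant_birational_imp_eqbir [OF sh(1,3)] by fastforce
  define A1 B1 f1 g1 where "A1 = ext_dom X Y U f" and "B1 = ext_dom Y X (f ` U) (inv_into U f)"
    and "f1 = ext_map X Y U f" and "g1 = ext_map Y X (f ` U) (inv_into U f)"
  define A2 B2 f2 g2 where "A2 = ext_dom Y Z V h" and "B2 = ext_dom Z Y (h ` V) (inv_into V h)"
    and "f2 = ext_map Y Z V h" and "g2 = ext_map Z Y (h ` V) (inv_into V h)"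
  define A3 B3 f3 g3 where "A3 = ext_dom X Z W k" and "B3 = ext_dom Z X (k ` W) (inv_into W k)"
    and "f3 = ext_map X Z W k" and "g3 = ext_map Z X (k ` W) (inv_into W k)"
  note defs = A1_def B1_def f1_def g1_def A2_def B2_def f2_def g2_def A3_def B3_def f3_def g3_def
  have m: "maxbir G X \<alpha> Y \<beta> A1 B1 f1 g1" "maxbir G Y \<beta> Z \<gamma> A2 B2 f2 g2" "maxbir G X \<alpha> Z \<gamma> A3 B3 f3 g3"
    unfolding defs using maxbir_exists(1) [OF X Y e1] maxbir_exists(1) [OF Y Z e2] maxbir_exists(1) [OF X Z e3] by blast+
  note e = m [THEN maxbir_eqbir]
  \<comment> \<open>On \<open>W\<close> the three maximal extensions restrict to the given
    representatives, whose composition is \<open>k\<close> by definition.\<close>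
  have tri: "triangle X A1 f1 A2 f2 A3 f3"
  proof -
    note dW = eqbirD [OF e3]
    have "W \<subseteq> A3" "\<And>x. x \<in> W \<Longrightarrow> f3 x = k x"
      unfolding defs using maxbir_exists(2,3) [OF X Z e3] by blast+
    moreover have "U \<subseteq> A1" "\<And>x. x \<in> U \<Longrightarrow> f1 x = f x"
      unfolding defs using maxbir_exists(2,3) [OF X Y e1] by blast+
    moreover have "V \<subseteq> A2" "\<And>x. x \<in> V \<Longrightarrow> f2 x = h x"
      unfolding defs using maxbir_exists(2,3) [OF Y Z e2] by blast+
    ultimately show ?thesis
      unfolding triangle_def using dW(2,3) by (intro exI [of _ W]) (auto simp: W_def k_def)
  qed
  let ?P = "free_div_orbits G X \<alpha>" and ?Q = "free_div_orbits G Y \<beta>" and ?R = "free_div_orbits G Z \<gamma>"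
  let ?m = "\<lambda>S A. {\<D> \<in> S. meets A \<D>}"
  let ?c = "\<lambda>X \<alpha> \<D>. bir_class G (n - 1) (orbit_space X \<alpha> \<D>)"
  have ex1: "free_Ex_orbits G X \<alpha> Y \<phi> = ?P - ?m ?P A1" "finite (?P - ?m ?P A1)"
    using free_Ex_orbits_eq [OF X Y e1 dim(1)] by (simp_all add: \<phi> A1_def)
  have ex1': "free_Ex_orbits G Y \<beta> X (rational_inv \<phi>) = ?Q - ?m ?Q B1" "finite (?Q - ?m ?Q B1)"
    using free_Ex_orbits_eq [OF Y X eqbir_sym [OF e1] dim(2)] by (simp_all add: \<phi> B1_def rational_inv_def)
  have ex2: "free_Ex_orbits G Y \<beta> Z \<psi> = ?Q - ?m ?Q A2" "finite (?Q - ?m ?Q A2)"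
    using free_Ex_orbits_eq [OF Y Z e2 dim(2)] by (simp_all add: \<psi> A2_def)
  have ex2': "free_Ex_orbits G Z \<gamma> Y (rational_inv \<psi>) = ?R - ?m ?R B2" "finite (?R - ?m ?R B2)"
    using free_Ex_orbits_eq [OF Z Y eqbir_sym [OF e2] dim(3)] by (simp_all add: \<psi> B2_def rational_inv_def)
  have ex3: "free_Ex_orbits G X \<alpha> Z (rational_comp \<psi> \<phi>) = ?P - ?m ?P A3" "finite (?P - ?m ?P A3)"
    using free_Ex_orbits_eq [OF X Z e3 dim(1)] by (simp_all add: \<chi> A3_def)
  have ex3': "free_Ex_orbits G Z \<gamma> X (rational_inv (rational_comp \<psi> \<phi>)) = ?R - ?m ?R B3" "finite (?R - ?m ?R B3)"
    using free_Ex_orbits_eq [OF Z X eqbir_sym [OF e3] dim(3)] by (simp_all add: \<chi> B3_def rational_inv_def)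
  have orb: "\<D> \<in> div_orbits G X \<alpha>" if "\<D> \<in> ?P" for \<D> using that by (simp add: free_div_orbits_def)
  have add: "sum (?c Z \<gamma>) (?R - ?m ?R B3) - sum (?c X \<alpha>) (?P - ?m ?P A3) =
    (sum (?c Y \<beta>) (?Q - ?m ?Q B1) - sum (?c X \<alpha>) (?P - ?m ?P A1)) +
    (sum (?c Z \<gamma>) (?R - ?m ?R B2) - sum (?c Y \<beta>) (?Q - ?m ?Q A2))"
  proof (rule sum_partial_bijections)
    show "bij_betw (image (transfer Y A1 f1)) (?m ?P A1) (?m ?Q B1)"
      by (rule transfer_free_orbit_bij [OF X Y e(1) dim(1,2) fin])
    show "bij_betw (image (transfer Z A2 f2)) (?m ?Q A2) (?m ?R B2)"
      by (rule transfer_free_orbit_bij [OF Y Z e(2) dim(2,3) fin])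
    show "bij_betw (image (transfer Z A3 f3)) (?m ?P A3) (?m ?R B3)"
      by (rule transfer_free_orbit_bij [OF X Z e(3) dim(1,3) fin])
    show "?c Y \<beta> (transfer Y A1 f1 ` \<D>) = ?c X \<alpha> \<D>" if "\<D> \<in> ?m ?P A1" for \<D>
      using that by (intro transfer_free_orbit(4) [OF X Y e(1) dim(1,2) fin]) auto
    show "?c Z \<gamma> (transfer Z A2 f2 ` \<D>) = ?c Y \<beta> \<D>" if "\<D> \<in> ?m ?Q A2" for \<D>
      using that by (intro transfer_free_orbit(4) [OF Y Z e(2) dim(2,3) fin]) auto
    show "?c Z \<gamma> (transfer Z A3 f3 ` \<D>) = ?c X \<alpha> \<D>" if "\<D> \<in> ?m ?P A3" for \<D>
      using that by (intro transfer_free_orbit(4) [OF X Z e(3) dim(1,3) fin]) auto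
    show "\<D> \<in> ?m ?P A3 \<and> transfer Z A3 f3 ` \<D> = transfer Z A2 f2 ` transfer Y A1 f1 ` \<D>"
      if "\<D> \<in> ?m ?P A1" "transfer Y A1 f1 ` \<D> \<in> ?m ?Q A2" for \<D>
      using transfer_orbit_compose [OF X Y Z e(1,2) m(3) tri dimXY orb] that by blast
    \<comment> \<open>The triangle is read from \<open>Y\<close>: \<open>g1\<close> takes the
      transferred orbit back to \<open>\<D>\<close>, which meets the domain of \<open>f3\<close>, so
      the transferred orbit meets the domain of \<open>f2\<close>.\<close>
    show "transfer Y A1 f1 ` \<D> \<in> ?m ?Q A2" if D: "\<D> \<in> ?m ?P A1" "\<D> \<in> ?m ?P A3" for \<D>
    proof -
      have DP: "\<D> \<in> ?P" "meets A1 \<D>" using D(1) by auto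
      note t = transfer_free_orbit [OF X Y e(1) dim(1,2) fin DP]
      have "meets A2 (transfer Y A1 f1 ` \<D>)"
        by (rule transfer_orbit_compose(1) [OF Y X Z eqbir_sym [OF e(1)] e(3) m(2)
              triangle_rotate_left [OF sh(1,2) e(1) tri] dimYX _ t(2)])
          (use t(1,3) D(2) in \<open>auto simp: free_div_orbits_def\<close>)
      then show ?thesis using t(1) by simp
    qed
    \<comment> \<open>The triangle is read as \<open>f1 = g2 \<circ> f3\<close>: the orbit
      transferred to \<open>Z\<close> meets the domain of \<open>g2\<close>, so \<open>\<D>\<close>
      meets the domain of \<open>f1\<close>.\<close>
    show "\<D> \<in> ?m ?P A1" if D: "\<D> \<in> ?m ?P A3" "transfer Z A3 f3 ` \<D> \<in> ?m ?R B2" for \<D>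
    proof -
      have DP: "\<D> \<in> ?P" "meets A3 \<D>" "meets B2 (transfer Z A3 f3 ` \<D>)" using D by auto
      have "meets A1 \<D>"
        by (rule transfer_orbit_compose(1) [OF X Z Y e(3) eqbir_sym [OF e(2)] m(1)
              triangle_rotate_right [OF e(2) tri] dimXZ orb [OF DP(1)] DP(2,3)])
      then show ?thesis using DP(1) by simp
    qed
  qed (use ex1(2) ex1'(2) ex2(2) ex2'(2) ex3(2) ex3'(2) in auto)
  \<comment> \<open>The carrier of the free abelian group consists of the finitely supported
    functions with support in \<open>Bir\<close>, so membership is a statement about keys.\<close>
  have keys: "Poly_Mapping.keys (sum (?c X \<alpha>) S) \<subseteq> Bir G (n - 1)"
    if X: "G_var G X \<alpha>" "krull_dim (zar X) = enat n" and S: "S \<subseteq> free_div_orbits G X \<alpha>"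
    for X :: "('a, 'k) fspace" and \<alpha> S
  proof -
    have "Poly_Mapping.keys (?c X \<alpha> \<D>) \<subseteq> Bir G (n - 1)" if "\<D> \<in> S" for \<D>
      using that S by (intro keys_bir_class orbit_space_free [OF X(1) _ fin X(2)]) (auto simp: free_div_orbits_def)
    then show ?thesis using keys_sum [of "?c X \<alpha>" S] by blast
  qed
  have "Poly_Mapping.keys (C_inv G n X \<alpha> Y \<beta> \<phi>) \<subseteq> Bir G (n - 1)"
    unfolding C_inv_def ex1(1) ex1'(1)
    using keys_diff [of "sum (?c Y \<beta>) (?Q - ?m ?Q B1)" "sum (?c X \<alpha>) (?P - ?m ?P A1)"]
      keys [OF Y dim(2), of "?Q - ?m ?Q B1"] keys [OF X dim(1), of "?P - ?m ?P A1"] by blast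
  moreover have "C_inv G n X \<alpha> Z \<gamma> (rational_comp \<psi> \<phi>) = C_inv G n X \<alpha> Y \<beta> \<phi> + C_inv G n Y \<beta> Z \<gamma> \<psi>"
    unfolding C_inv_def ex1(1) ex1'(1) ex2(1) ex2'(1) ex3(1) ex3'(1) by (rule add)
  ultimately show ?thesis by simp
qed

end
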